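(* Let $\alpha_1(s)\mid\cdots\mid\alpha_n(s)$ be monic real polynomials with $\sum_i\deg\alpha_i(s)=n$. Let $(F,G)\in\mathbb R^{n\times n}\times\mathbb R^{n\times m}$ be a controllable pair in $p$-Brunovsky canonical form, with $G=[G_1\ \ 0]$, $G_1\in\mathbb R^{n\times r}$, $\operatorname{rank}G_1=r$, with controllability indices $k_1\ge\cdots\ge k_r>0=k_{r+1}=\cdots=k_m$ and nonzero Brunovsky indices $\underline r:\ r=r_1\ge\cdots\ge r_k>0$ ($k=k_1$). Assume $(k_1,\dots,k_m)\prec(\deg\alpha_n(s),\dots,\deg\alpha_1(s))$, and let $A\in\mathcal O(\underline\alpha)$. Then the map $$\phi:\ \mathcal P_{(A;\underline r)}/\widetilde C_A\longrightarrow\mathcal H_{(F,G_1)},\qquad \widetilde P\longmapsto\begin{bmatrix}p_1A^{k_1}\\ p_2A^{k_2}\\ \vdots\\ p_rA^{k_r}\end{bmatrix}P^{-1},$$ where $P\in\mathcal P_{(A;\underline r)}$ is any matrix in the orbit $\widetilde P$ and $p_1,\dots,p_r$ are the first $r$ rows of $P$, is a diffeomorphism.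
   Context: $\mathcal O(\underline\alpha)$ is the set of matrices in $\mathbb R^{n\times n}$ with invariant polynomials $\alpha_1(s)\mid\cdots\mid\alpha_n(s)$. $\mathcal H_{(F,G_1)}=\{K\in\mathbb R^{r\times n}: F+G_1K\in\mathcal O(\underline\alpha)\}$, regarded as a submanifold of $\mathbb R^{r\times n}$. $a\prec b$ (majorization of nonincreasing sequences, padded with zeros to equal length) means that all partial sums satisfy $\sum_{i\le j}a_i\le\sum_{i\le j}b_i$, with equal total sums. Brunovsky indices of a controllable pair: $r_1+\cdots+r_i=\operatorname{rank}[G\ FG\ \cdots\ F^{i-1}G]$; controllability indices: $k_i=\#\{j:r_j\ge i\}$. $p$-Brunovsky canonical form: for $p\ge q$ put $I_{p,q}=\begin{bmatrix}I_q\\0\end{bmatrix}\in\mathbb R^{p\times q}$ and put $r_{k+1}=0$. $F$ is the $k\times k$ block matrix with block sizes $r_1,\dots,r_k$ whose $(i,i+1)$ block is $I_{r_i,r_{i+1}}$, $1\le i\le k-1$, all other blocks zero. $G=[G_1\ 0]$, where $G_1$ has row blocks of sizes $r_1,\dots,r_k$ and column blocks of sizes $r_k,\ r_{k-1}-r_k,\ \dots,\ r_1-r_2$; the only nonzero block in row block $i$ is in column block $k-i+1$ and equals $\begin{bmatrix}0\\ I_{r_i-r_{i+1}}\end{bmatrix}\in\mathbb R^{r_i\times(r_i-r_{i+1})}$ (so it is $I_{r_k}$ for $i=k$). $\mathcal P_{(A;\underline r)}$ is the set of matrices $P=\begin{bmatrix}P_1\\ \vdots\\P_k\end{bmatrix}\in\mathbb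 R^{n\times n}$ (note $\sum_i r_i=n$) with $\operatorname{rank}P=n$, $P_1\in\mathbb R^{r_1\times n}$ and $P_i\in\mathbb R^{r_i\times n}$ equal to the first $r_i$ rows of $P_1A^{i-1}$, $1\le i\le k$; it is an open subset of a linear space of dimension $rn$. $\widetilde C_A=\{X\in\mathbb R^{n\times n}: X\text{ invertible},\ XA=AX\}$ is a Lie group acting on $\mathcal P_{(A;\underline r)}$ by $P\mapsto PX$; the orbit space $\mathcal P_{(A;\underline r)}/\widetilde C_A$ carries the quotient manifold structure for which the natural projection is a smooth submersion. *)

theory Defs
  imports
    "HOL-Analysis.Analysis"
    "HOL-Computational_Algebra.Polynomial"
begin

section \<open>Smooth manifolds\<close>

text \<open>All iterated directional derivatives up to order \<open>k\<close> exist and are continuous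
  (used for open \<open>U\<close> in finite dimension).\<close>

primrec Ck_on :: "nat \<Rightarrow> 'a::real_normed_vector set \<Rightarrow> ('a \<Rightarrow> 'b::real_normed_vector) \<Rightarrow> bool" where
  "Ck_on 0 U f \<longleftrightarrow> continuous_on U f"
| "Ck_on (Suc k) U f \<longleftrightarrow> (\<forall>x\<in>U. f differentiable (at x)) \<and>
     (\<forall>v. Ck_on k U (\<lambda>x. frechet_derivative f (at x) v))"

text \<open>Smoothness on an arbitrary subset of a Euclidean space, as usual by local extension to a
  smooth map on an open set of the ambient space.  On a relatively open subset of a linear
  subspace this is ordinary smoothness.\<close>

definition smooth_on :: "'a::euclidean_space set \<Rightarrow> ('a \<Rightarrow> 'b::euclidean_space) \<Rightarrow> bool" where
  "smooth_on S f \<longleftrightarrow> (\<forall>x\<in>S. \<exists>U g. open U \<and> x \<in> U \<and> (\<forall>k. Ck_on k U g) \<and> (\<forall>y\<in>U \<inter> S. g y = f y))"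

text \<open>The dimension of the manifolds below is not known to the type system (it depends on a
  centralizer, and may be 0).  So charts take values not in a type of the form
  \<open>real ^ 'd\<close> but in a linear subspace \<open>model M\<close> of a Euclidean space; this subspace plays the role
  of \<open>\<real>\<^sup>d\<close>.  A chart is a pair \<open>(U, \<psi>)\<close>; only the values of \<open>\<psi>\<close> on \<open>U\<close> matter.\<close>

record ('a, 'b) manifold =
  space_top :: "'a topology"
  model :: "'b set"
  atlas :: "('a set \<times> ('a \<Rightarrow> 'b)) set"

abbreviation points :: "('a, 'b) manifold \<Rightarrow> 'a set" where
  "points M \<equiv> topspace (space_top M)"

definition topological_chart ::
    "('a, 'b::euclidean_space) manifold \<Rightarrow> 'a set \<Rightarrow> ('a \<Rightarrow> 'b) \<Rightarrow> bool" where
  "topological_chart M U \<psi> \<longleftrightarrow>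
     openin (space_top M) U \<and> openin (top_of_set (model M)) (\<psi> ` U) \<and>
     homeomorphic_map (subtopology (space_top M) U) (top_of_set (\<psi> ` U)) \<psi>"

definition smooth_manifold :: "('a, 'b::euclidean_space) manifold \<Rightarrow> bool" where
  "smooth_manifold M \<longleftrightarrow>
     subspace (model M) \<and>
     Hausdorff_space (space_top M) \<and> second_countable (space_top M) \<and>
     (\<forall>(U, \<psi>)\<in>atlas M. topological_chart M U \<psi>) \<and>
     (\<Union>(U, \<psi>)\<in>atlas M. U) = points M \<and>
     (\<forall>(U, \<psi>)\<in>atlas M. \<forall>(V, \<eta>)\<in>atlas M. smooth_on (\<psi> ` (U \<inter> V)) (\<eta> \<circ> inv_into U \<psi>))"

definition smooth_map ::
    "('a, 'b::euclidean_space) manifold \<Rightarrow> ('c, 'd::euclidean_space) manifold \<Rightarrow> ('a \<Rightarrow> 'c) \<Rightarrow> bool" where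
  "smooth_map M N f \<longleftrightarrow>
     smooth_manifold M \<and> smooth_manifold N \<and>
     continuous_map (space_top M) (space_top N) f \<and>
     (\<forall>(U, \<psi>)\<in>atlas M. \<forall>(V, \<eta>)\<in>atlas N.
        smooth_on (\<psi> ` (U \<inter> f -` V)) (\<eta> \<circ> f \<circ> inv_into U \<psi>))"

definition diffeomorphism ::
    "('a, 'b::euclidean_space) manifold \<Rightarrow> ('c, 'd::euclidean_space) manifold \<Rightarrow> ('a \<Rightarrow> 'c) \<Rightarrow> bool" where
  "diffeomorphism M N f \<longleftrightarrow>
     bij_betw f (points M) (points N) \<and> smooth_map M N f \<and>
     smooth_map N M (inv_into (points M) f)"

text \<open>The set \<open>\<psi> ` (U \<inter> f -` V)\<close> is relatively open in \<open>model M\<close>, so the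
  derivative \<open>D\<close> within it is uniquely determined on \<open>model M\<close> (and only there).\<close>

definition smooth_submersion ::
    "('a, 'b::euclidean_space) manifold \<Rightarrow> ('c, 'd::euclidean_space) manifold \<Rightarrow> ('a \<Rightarrow> 'c) \<Rightarrow> bool" where
  "smooth_submersion M N f \<longleftrightarrow>
     smooth_map M N f \<and>
     (\<forall>(U, \<psi>)\<in>atlas M. \<forall>(V, \<eta>)\<in>atlas N. \<forall>x\<in>\<psi> ` (U \<inter> f -` V).
        \<exists>D. (\<eta> \<circ> f \<circ> inv_into U \<psi> has_derivative D) (at x within \<psi> ` (U \<inter> f -` V)) \<and>
            D ` model M = model N)"

definition quotient_manifold ::
    "('a, 'b::euclidean_space) manifold \<Rightarrow> ('a \<Rightarrow> 'c) \<Rightarrow> ('c, 'd::euclidean_space) manifold \<Rightarrow> bool" where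
  "quotient_manifold M \<pi> Q \<longleftrightarrow>
     smooth_manifold Q \<and> quotient_map (space_top M) (space_top Q) \<pi> \<and> smooth_submersion M Q \<pi>"

text \<open>An open subset \<open>S\<close> of a linear space \<open>E\<close>, with the identity as its only chart.\<close>

definition open_submanifold :: "'b::euclidean_space set \<Rightarrow> 'b set \<Rightarrow> ('b, 'b) manifold" where
  "open_submanifold E S = \<lparr>space_top = top_of_set S, model = E, atlas = {(S, \<lambda>x. x)}\<rparr>"

text \<open>A subset \<open>S\<close> of a Euclidean space with its induced structure: the charts are all maps that are
  diffeomorphisms (in the sense of \<open>smooth_on\<close>) from an open subset of \<open>S\<close> onto an open subset
  of \<open>E\<close>.  The set \<open>S\<close> is an embedded submanifold of dimension \<open>dim E\<close> iff these charts cover it,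
  i.e. iff \<open>smooth_manifold (submanifold E S)\<close> holds.\<close>

definition submanifold :: "'b::euclidean_space set \<Rightarrow> 'b set \<Rightarrow> ('b, 'b) manifold" where
  "submanifold E S = \<lparr>space_top = top_of_set S, model = E,
     atlas = {(U, \<psi>). openin (top_of_set S) U \<and> inj_on \<psi> U \<and> openin (top_of_set E) (\<psi> ` U) \<and>
                smooth_on U \<psi> \<and> smooth_on (\<psi> ` U) (inv_into U \<psi>)}\<rparr>"


section \<open>Matrices with ordered index types\<close>

text \<open>The indices of a type \<open>'n\<close> are numbered \<open>1, \<dots>, CARD('n)\<close> in increasing order:
  \<open>pos\<close> gives the number of an index and \<open>ix\<close> is the inverse of \<open>pos\<close>.\<close>

definition pos :: "'n::{finite,linorder} \<Rightarrow> nat" where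
  "pos i = card {..i}"

definition ix :: "nat \<Rightarrow> 'n::{finite,linorder}" where
  "ix p = sorted_list_of_set (UNIV :: 'n set) ! (p - 1)"

text \<open>Matrix powers; the library's \<open>^\<close> on \<open>real ^ 'n ^ 'n\<close> is the entrywise power.\<close>

primrec matpow :: "'a::semiring_1 ^ 'n ^ 'n \<Rightarrow> nat \<Rightarrow> 'a ^ 'n ^ 'n" where
  "matpow A 0 = mat 1"
| "matpow A (Suc i) = matpow A i ** A"

text \<open>Position preceding the \<open>i\<close>-th block (\<open>i \<ge> 1\<close>) in a partition with block sizes
  \<open>s 1, s 2, \<dots>\<close>; and entry \<open>(a, b)\<close> of block \<open>(i, j)\<close> of a matrix partitioned
  into row blocks of sizes \<open>s\<close> and column blocks of sizes \<open>t\<close>.\<close>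

definition offset :: "(nat \<Rightarrow> nat) \<Rightarrow> nat \<Rightarrow> nat" where
  "offset s i = (\<Sum>j=1..<i. s j)"

definition block_entry ::
    "real ^ 'c::{finite,linorder} ^ 'd::{finite,linorder} \<Rightarrow> (nat \<Rightarrow> nat) \<Rightarrow> (nat \<Rightarrow> nat) \<Rightarrow>
     nat \<Rightarrow> nat \<Rightarrow> nat \<Rightarrow> nat \<Rightarrow> real" where
  "block_entry M s t i j a b = M $ ix (offset s i + a) $ ix (offset t j + b)"


section \<open>Invariant polynomials\<close>

definition charmat :: "real ^ 'n ^ 'n \<Rightarrow> real poly ^ 'n ^ 'n" where
  "charmat A = (\<chi> i j. (if i = j then [:0, 1:] else 0) - [:A $ i $ j:])"

text \<open>\<open>\<alpha> 1, \<dots>, \<alpha> n\<close> are the monic diagonal elements of the Smith normal form of \<open>s I - A\<close>.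
  Here \<open>invertible\<close> means invertible over the polynomial ring, i.e. unimodular.\<close>

definition invariant_polynomials ::
    "(nat \<Rightarrow> real poly) \<Rightarrow> real ^ 'n::{finite,linorder} ^ 'n::_ \<Rightarrow> bool" where
  "invariant_polynomials \<alpha> A \<longleftrightarrow>
     (\<forall>i\<in>{1..CARD('n)}. lead_coeff (\<alpha> i) = 1) \<and>
     (\<forall>i\<in>{1..<CARD('n)}. \<alpha> i dvd \<alpha> (Suc i)) \<and>
     (\<exists>U V :: real poly ^ 'n::_ ^ 'n::_. invertible U \<and> invertible V \<and>
        U ** charmat A ** V = (\<chi> i j. if i = j then \<alpha> (pos i) else 0))"

definition similarity_class :: "(nat \<Rightarrow> real poly) \<Rightarrow> (real ^ 'n::{finite,linorder} ^ 'n::_) set" where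
  "similarity_class \<alpha> = {A. invariant_polynomials \<alpha> A}"

definition feedback_set ::
    "(nat \<Rightarrow> real poly) \<Rightarrow> real ^ 'n::{finite,linorder} ^ 'n::_ \<Rightarrow> real ^ 'r::finite ^ 'n::_ \<Rightarrow>
     (real ^ 'n::_ ^ 'r) set" where
  "feedback_set \<alpha> F G1 = {K. F + G1 ** K \<in> similarity_class \<alpha>}"


section \<open>Controllable pairs and the Brunovsky form\<close>

text \<open>The rank of \<open>[G  F G  \<dots>  F\<^sup>i\<^sup>-\<^sup>1 G]\<close>, as the dimension of the column space.\<close>

definition controllability_rank :: "real ^ 'n ^ 'n \<Rightarrow> real ^ 'm::finite ^ 'n \<Rightarrow> nat \<Rightarrow> nat" where
  "controllability_rank F G i = dim (\<Union>j<i. columns (matpow F j ** G))"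

definition controllable :: "real ^ 'n ^ 'n \<Rightarrow> real ^ 'm::finite ^ 'n \<Rightarrow> bool" where
  "controllable F G \<longleftrightarrow> controllability_rank F G CARD('n) = CARD('n)"

text \<open>The two sequences of indices are meant for \<open>i \<ge> 1\<close>.\<close>

definition brunovsky_index :: "real ^ 'n ^ 'n \<Rightarrow> real ^ 'm::finite ^ 'n \<Rightarrow> nat \<Rightarrow> nat" where
  "brunovsky_index F G i = controllability_rank F G i - controllability_rank F G (i - 1)"

definition controllability_index :: "real ^ 'n ^ 'n \<Rightarrow> real ^ 'm::finite ^ 'n \<Rightarrow> nat \<Rightarrow> nat" where
  "controllability_index F G i = card {j. 1 \<le> j \<and> i \<le> brunovsky_index F G j}"

text \<open>The \<open>p\<close>-Brunovsky form with \<open>k\<close> blocks of sizes \<open>\<rho> 1 \<ge> \<dots> \<ge> \<rho> k\<close>, where \<open>\<rho> (k + 1) = 0\<close>.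
  Block \<open>(i, i + 1)\<close> of \<open>F\<close> is an identity on top of zero rows; block \<open>(i, k - i + 1)\<close> of \<open>G1\<close> is
  an identity of size \<open>\<rho> i - \<rho> (i + 1)\<close> below \<open>\<rho> (i + 1)\<close> zero rows.\<close>

definition brunovsky_F :: "nat \<Rightarrow> (nat \<Rightarrow> nat) \<Rightarrow> real ^ 'n::{finite,linorder} ^ 'n::_ \<Rightarrow> bool" where
  "brunovsky_F k \<rho> F \<longleftrightarrow>
     (\<forall>i\<in>{1..k}. \<forall>j\<in>{1..k}. \<forall>a\<in>{1..\<rho> i}. \<forall>b\<in>{1..\<rho> j}.
        block_entry F \<rho> \<rho> i j a b = (if j = i + 1 \<and> a = b then 1 else 0))"

definition brunovsky_G1 ::
    "nat \<Rightarrow> (nat \<Rightarrow> nat) \<Rightarrow> real ^ 'r::{finite,linorder} ^ 'n::{finite,linorder} \<Rightarrow> bool" where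
  "brunovsky_G1 k \<rho> G1 \<longleftrightarrow>
     (let \<gamma> = (\<lambda>j. \<rho> (k + 1 - j) - \<rho> (k + 2 - j)) in
      \<forall>i\<in>{1..k}. \<forall>j\<in>{1..k}. \<forall>a\<in>{1..\<rho> i}. \<forall>b\<in>{1..\<gamma> j}.
        block_entry G1 \<rho> \<gamma> i j a b = (if j = k - i + 1 \<and> a = \<rho> (i + 1) + b then 1 else 0))"

definition zero_padded ::
    "real ^ 'r::{finite,linorder} ^ 'n \<Rightarrow> real ^ 'm::{finite,linorder} ^ 'n \<Rightarrow> bool" where
  "zero_padded G1 G \<longleftrightarrow> CARD('r) \<le> CARD('m) \<and>
     (\<forall>i j. G $ i $ j = (if pos j \<le> CARD('r) then G1 $ i $ ix (pos j) else 0))"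

text \<open>Since \<open>take\<close> stops at the end of a list, the shorter list is implicitly padded with zeros.\<close>

definition majorized :: "nat list \<Rightarrow> nat list \<Rightarrow> bool" where
  "majorized a b \<longleftrightarrow>
     (\<forall>j. sum_list (take j a) \<le> sum_list (take j b)) \<and> sum_list a = sum_list b"


section \<open>The parametrizing manifold and the map\<close>

text \<open>The linear condition that the \<open>i\<close>-th row block of \<open>P\<close> consists of the first \<open>\<rho> i\<close> rows
  of \<open>P\<^sub>1 A\<^sup>i\<^sup>-\<^sup>1\<close>, where \<open>P\<^sub>1\<close> consists of the first \<open>\<rho> 1\<close> rows of \<open>P\<close>.\<close>

definition krylov_space ::
    "real ^ 'n::{finite,linorder} ^ 'n::_ \<Rightarrow> nat \<Rightarrow> (nat \<Rightarrow> nat) \<Rightarrow> (real ^ 'n::_ ^ 'n::_) set" where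
  "krylov_space A k \<rho> =
     {P. \<forall>i\<in>{1..k}. \<forall>a\<in>{1..\<rho> i}.
        row (ix (offset \<rho> i + a)) P = row (ix a) P v* matpow A (i - 1)}"

definition krylov_matrices ::
    "real ^ 'n::{finite,linorder} ^ 'n::_ \<Rightarrow> nat \<Rightarrow> (nat \<Rightarrow> nat) \<Rightarrow> (real ^ 'n::_ ^ 'n::_) set" where
  "krylov_matrices A k \<rho> = {P \<in> krylov_space A k \<rho>. rank P = CARD('n)}"

definition centralizer :: "real ^ 'n ^ 'n \<Rightarrow> (real ^ 'n ^ 'n) set" where
  "centralizer A = {X. invertible X \<and> X ** A = A ** X}"

definition orbit :: "real ^ 'n ^ 'n \<Rightarrow> real ^ 'n ^ 'n \<Rightarrow> (real ^ 'n ^ 'n) set" where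
  "orbit A P = (\<lambda>X. P ** X) ` centralizer A"

text \<open>The matrix with rows \<open>p\<^sub>i A\<^sup>\<kappa>\<^sup>i\<close>, where \<open>p\<^sub>i\<close> is the \<open>i\<close>-th row of \<open>P\<close>,
  multiplied by the inverse of \<open>P\<close>.\<close>

definition feedback_of ::
    "real ^ 'n::{finite,linorder} ^ 'n::_ \<Rightarrow> (nat \<Rightarrow> nat) \<Rightarrow> real ^ 'n::_ ^ 'n::_ \<Rightarrow>
     real ^ 'n::_ ^ 'r::{finite,linorder}" where
  "feedback_of A \<kappa> P =
     (\<chi> i. row (ix (pos i)) P v* matpow A (\<kappa> (pos i))) ** matrix_inv P"

end

theory Submission
  imports Defs
begin

text \<open>For invertible \<open>P\<close>, the equation \<open>P A = (F + G\<^sub>1 K) P\<close> says exactly that \<open>P\<close> is a Krylov matrix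
  and that \<open>K\<close> is the feedback \<open>f P\<close> attached to it.  Hence \<open>f\<close> maps onto \<open>\<H>\<close> and its fibres are the
  orbits.  For fixed \<open>K\<close> the equation is linear in \<open>P\<close>, and for \<open>K \<in> \<H>\<close> its solution space is a translate
  of the commutant of \<open>A\<close>, so has constant dimension.  Solving the equation near \<open>(K\<^sub>0, P\<^sub>0)\<close> with a
  prescribed projection of \<open>P\<close> onto the solution space at \<open>K\<^sub>0\<close> gives a smooth local section \<open>\<sigma>\<close> of \<open>f\<close>,
  and \<open>K \<mapsto> \<sigma> K - P\<^sub>0\<close> is a chart of \<open>\<H>\<close> with inverse \<open>y \<mapsto> f (P\<^sub>0 + y)\<close>.  The sections make \<open>f\<close> a
  quotient map and a submersion, so \<open>\<H>\<close> carries the quotient structure.  For any quotient manifold \<open>Q\<close>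
  the bijection \<open>\<H> \<rightarrow> Q\<close> is a smooth homeomorphism with surjective derivatives between spaces of equal
  dimension (invariance of domain), so its inverse is smooth.\<close>

section \<open>Iterated directional derivatives\<close>

text \<open>Since the equation is linear in P, the implicit function theorem reduces to one fact:
  solutions of injective linear systems are as smooth in a parameter as the coefficients
  (\<open>Ck_on_linear_solution\<close>). The same fact yields smoothness of matrix inversion and of
  inverse maps.

  The obstacle is that for K off \<open>\<H>\<close> the kernel of the equation can be smaller, so a
  smooth section cannot be sought among kernel elements alone. With T0 the equation at K0, p the
  projection onto its kernel and T0' the adjoint of T0, the system T0' (T(K) P) + p P = P0 is
  injective at K0, hence solvable for all nearby K, inside \<open>\<H>\<close> or not. This gives a
  smooth solution on an open set, and constancy of the kernel dimension along \<open>\<H>\<close>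
  puts the solution into the kernel for K in \<open>\<H>\<close>.

  The dimension of \<open>\<H>\<close> (that of the Krylov space minus that of the commutant) and
  the dimension of the model of Q are not tied together by any assumption. Their equality therefore
  has to come from topology, and only with it do surjective derivatives become bijective.\<close>

lemma Ck_on_cong:
  assumes "open U" "\<And>x. x \<in> U \<Longrightarrow> f x = g x" "Ck_on k U f"
  shows "Ck_on k U g"
  using assms(2,3)
proof (induction k arbitrary: f g)
  case 0
  then show ?case by (simp cong: continuous_on_cong)
next
  case (Suc k)
  have d: "(g has_derivative frechet_derivative f (at x)) (at x)" if "x \<in> U" for x
  proof (rule has_derivative_transform_within_open[OF _ assms(1) that])
    show "(f has_derivative frechet_derivative f (at x)) (at x)"
      using Suc.prems(2) that by (simp add: frechet_derivative_works)
  qed (use Suc.prems(1) in auto)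
  then have e: "frechet_derivative f (at x) = frechet_derivative g (at x)" if "x \<in> U" for x
    using frechet_derivative_at that by blast
  have "Ck_on k U (\<lambda>x. frechet_derivative g (at x) v)" for v
    by (rule Suc.IH[of "\<lambda>x. frechet_derivative f (at x) v"]) (use e Suc.prems in auto)
  with d show ?case by (auto intro: differentiableI)
qed

text \<open>Lets the inductions below exhibit any convenient formula \<open>f'\<close>: on an open
  set it must agree with \<open>frechet_derivative\<close>.\<close>

lemma Ck_on_SucI:
  assumes "open U" "\<And>x. x \<in> U \<Longrightarrow> (f has_derivative f' x) (at x)"
    "\<And>v. Ck_on k U (\<lambda>x. f' x v)"
  shows "Ck_on (Suc k) U f"
proof -
  have e: "f' x = frechet_derivative f (at x)" if "x \<in> U" for x
    using frechet_derivative_at assms(2) that by blast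
  have "Ck_on k U (\<lambda>x. frechet_derivative f (at x) v)" for v
    by (rule Ck_on_cong[OF assms(1) _ assms(3)[of v]]) (simp add: e)
  with assms(2) show ?thesis by (auto intro: differentiableI)
qed

lemma Ck_on_SucE:
  assumes "Ck_on (Suc k) U f"
  obtains f' where "\<And>x. x \<in> U \<Longrightarrow> (f has_derivative f' x) (at x)"
    "\<And>v. Ck_on k U (\<lambda>x. f' x v)"
  using assms frechet_derivative_works that[of "\<lambda>x. frechet_derivative f (at x)"] by auto

lemma Ck_on_Suc_imp: "open U \<Longrightarrow> Ck_on (Suc k) U f \<Longrightarrow> Ck_on k U f"
proof (induction k arbitrary: f)
  case 0
  then show ?case
    by (auto intro!: continuous_at_imp_continuous_on differentiable_imp_continuous_within)
next
  case (Suc k)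
  obtain f' where "\<And>x. x \<in> U \<Longrightarrow> (f has_derivative f' x) (at x)" "\<And>v. Ck_on (Suc k) U (\<lambda>x. f' x v)"
    using Suc.prems(2) by (rule Ck_on_SucE) blast
  then show ?case using Suc by (intro Ck_on_SucI[of U f f']) auto
qed

lemma Ck_on_imp_continuous_on: "open U \<Longrightarrow> Ck_on k U f \<Longrightarrow> continuous_on U f"
  by (induction k) (simp, metis Ck_on_Suc_imp)

lemma Ck_on_subset: "Ck_on k U f \<Longrightarrow> V \<subseteq> U \<Longrightarrow> Ck_on k V f"
  by (induction k arbitrary: f) (auto intro: continuous_on_subset)

lemma Ck_on_local:
  assumes "open U" "\<And>x. x \<in> U \<Longrightarrow> \<exists>V. open V \<and> x \<in> V \<and> Ck_on k V f"
  shows "Ck_on k U f"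
  using assms(2)
proof (induction k arbitrary: f)
  case 0
  then show ?case
    by (auto intro!: continuous_at_imp_continuous_on simp: continuous_on_eq_continuous_at) 
      (metis continuous_on_eq_continuous_at)
next
  case (Suc k)
  have "Ck_on k U (\<lambda>x. frechet_derivative f (at x) v)" for v
    by (rule Suc.IH) (use Suc.prems in fastforce)
  moreover have "f differentiable (at x)" if "x \<in> U" for x
    using Suc.prems[OF that] by auto
  ultimately show ?case by simp
qed

lemma Ck_on_const: "open U \<Longrightarrow> Ck_on k U (\<lambda>x. c)"
proof (induction k arbitrary: c)
  case (Suc k)
  then show ?case by (intro Ck_on_SucI[where f' = "\<lambda>x v. 0"]) (auto intro: derivative_eq_intros)
qed simp

lemma Ck_on_linear:
  assumes "open U" "bounded_linear l" "Ck_on k U f"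
  shows "Ck_on k U (\<lambda>x. l (f x))"
  using assms(3)
proof (induction k arbitrary: f)
  case 0
  then show ?case using assms(2) by (auto intro: bounded_linear.continuous_on)
next
  case (Suc k)
  obtain f' where "\<And>x. x \<in> U \<Longrightarrow> (f has_derivative f' x) (at x)" "\<And>v. Ck_on k U (\<lambda>x. f' x v)"
    using Suc.prems by (rule Ck_on_SucE) blast
  then show ?case using Suc.IH assms(1,2)
    by (intro Ck_on_SucI[where f' = "\<lambda>x v. l (f' x v)"]) (auto intro: bounded_linear.has_derivative)
qed

lemma Ck_on_ident: "open U \<Longrightarrow> Ck_on k U (\<lambda>x. x)"
proof (cases k)
  case (Suc j)
  assume "open U"
  then show ?thesis unfolding Suc
    by (intro Ck_on_SucI[where f' = "\<lambda>x v. v"]) (auto intro: derivative_eq_intros Ck_on_const)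
qed simp

lemma Ck_on_add:
  assumes "open U" "Ck_on k U f" "Ck_on k U g"
  shows "Ck_on k U (\<lambda>x. f x + g x)"
  using assms(2,3)
proof (induction k arbitrary: f g)
  case 0
  then show ?case by (auto intro: continuous_intros)
next
  case (Suc k)
  obtain f' where "\<And>x. x \<in> U \<Longrightarrow> (f has_derivative f' x) (at x)" "\<And>v. Ck_on k U (\<lambda>x. f' x v)"
    using Suc.prems(1) by (rule Ck_on_SucE) blast
  moreover obtain g' where "\<And>x. x \<in> U \<Longrightarrow> (g has_derivative g' x) (at x)" "\<And>v. Ck_on k U (\<lambda>x. g' x v)"
    using Suc.prems(2) by (rule Ck_on_SucE) blast
  ultimately show ?case using Suc.IH assms(1)
    by (intro Ck_on_SucI[where f' = "\<lambda>x v. f' x v + g' x v"]) (auto intro: derivative_intros)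
qed

lemma Ck_on_diff:
  assumes "open U" "Ck_on k U f" "Ck_on k U g"
  shows "Ck_on k U (\<lambda>x. f x - g x)"
  using Ck_on_add[OF assms(1,2) Ck_on_linear[OF assms(1) bounded_linear_minus[OF bounded_linear_ident] assms(3)]]
  by simp

lemma Ck_on_sum:
  assumes "open U" "finite I" "\<And>i. i \<in> I \<Longrightarrow> Ck_on k U (f i)"
  shows "Ck_on k U (\<lambda>x. \<Sum>i\<in>I. f i x)"
  using assms(2,3) by (induction I) (auto intro: Ck_on_add Ck_on_const assms(1))

lemma Ck_on_bilinear:
  assumes "open U" "bounded_bilinear b" "Ck_on k U f" "Ck_on k U g"
  shows "Ck_on k U (\<lambda>x. b (f x) (g x))"
  using assms(3,4)
proof (induction k arbitrary: f g)
  case 0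
  then show ?case using assms(2) by (auto intro: bounded_bilinear.continuous_on)
next
  case (Suc k)
  obtain f' where f: "\<And>x. x \<in> U \<Longrightarrow> (f has_derivative f' x) (at x)" "\<And>v. Ck_on k U (\<lambda>x. f' x v)"
    using Suc.prems(1) by (rule Ck_on_SucE) blast
  obtain g' where g: "\<And>x. x \<in> U \<Longrightarrow> (g has_derivative g' x) (at x)" "\<And>v. Ck_on k U (\<lambda>x. g' x v)"
    using Suc.prems(2) by (rule Ck_on_SucE) blast
  show ?case
  proof (rule Ck_on_SucI[where f' = "\<lambda>x v. b (f x) (g' x v) + b (f' x v) (g x)"])
    show "((\<lambda>x. b (f x) (g x)) has_derivative (\<lambda>v. b (f x) (g' x v) + b (f' x v) (g x))) (at x)"
      if "x \<in> U" for x
      using bounded_bilinear.FDERIV[OF assms(2) f(1) g(1)] that by simp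
    show "Ck_on k U (\<lambda>x. b (f x) (g' x v) + b (f' x v) (g x))" for v
      using f(2) g(2) assms(1) Suc.prems[THEN Ck_on_Suc_imp[OF assms(1)]]
      by (intro Ck_on_add Suc.IH) auto
  qed (fact assms(1))
qed

text \<open>\<open>Ck_on\<close> only controls derivatives in a fixed direction. Expanding over
  \<open>Basis\<close> replaces a direction that moves with the point by fixed directions with
  scalar coefficients.\<close>

lemma linear_euclidean_expansion:
  fixes l :: "'a::euclidean_space \<Rightarrow> 'b::real_vector"
  assumes "linear l"
  shows "l v = (\<Sum>b\<in>Basis. (v \<bullet> b) *\<^sub>R l b)"
proof -
  have "l v = l (\<Sum>b\<in>Basis. (v \<bullet> b) *\<^sub>R b)" by (simp add: euclidean_representation)
  also have "\<dots> = (\<Sum>b\<in>Basis. (v \<bullet> b) *\<^sub>R l b)"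
    using assms by (simp add: linear_sum linear_cmul)
  finally show ?thesis .
qed

lemma Ck_on_compose:
  fixes f :: "'a::real_normed_vector \<Rightarrow> 'b::euclidean_space"
  assumes "open U" "open V" "f ` U \<subseteq> V" "Ck_on k U f" "Ck_on k V g"
  shows "Ck_on k U (\<lambda>x. g (f x))"
  using assms(3-5)
proof (induction k arbitrary: f g)
  case 0
  then show ?case by (auto intro: continuous_on_compose2)
next
  case (Suc k)
  obtain f' where f: "\<And>x. x \<in> U \<Longrightarrow> (f has_derivative f' x) (at x)" "\<And>v. Ck_on k U (\<lambda>x. f' x v)"
    using Suc.prems(2) by (rule Ck_on_SucE) blast
  obtain g' where g: "\<And>x. x \<in> V \<Longrightarrow> (g has_derivative g' x) (at x)" "\<And>v. Ck_on k V (\<lambda>x. g' x v)"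
    using Suc.prems(3) by (rule Ck_on_SucE) blast
  show ?case
  \<comment> \<open>The chain rule gives \<open>g' (f x) (f' x v)\<close>, whose direction depends
    on x. After expansion only \<open>g' (f x) b\<close> with constant b remains, to which the
    induction hypothesis applies.\<close>
  proof (rule Ck_on_SucI[where f' = "\<lambda>x v. \<Sum>b\<in>Basis. (f' x v \<bullet> b) *\<^sub>R g' (f x) b"])
    fix x assume x: "x \<in> U"
    then have "f x \<in> V" using Suc.prems by auto
    with x have "((\<lambda>x. g (f x)) has_derivative (\<lambda>v. g' (f x) (f' x v))) (at x)"
      using has_derivative_compose[OF f(1) g(1)] by simp
    also have "(\<lambda>v. g' (f x) (f' x v)) = (\<lambda>v. \<Sum>b\<in>Basis. (f' x v \<bullet> b) *\<^sub>R g' (f x) b)"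
      using linear_euclidean_expansion[of "g' (f x)"] g(1)[OF \<open>f x \<in> V\<close>] has_derivative_linear by blast
    finally show "((\<lambda>x. g (f x)) has_derivative (\<lambda>v. \<Sum>b\<in>Basis. (f' x v \<bullet> b) *\<^sub>R g' (f x) b)) (at x)" .
  next
    fix v
    have "Ck_on k U (\<lambda>x. g' (f x) b)" for b
      by (rule Suc.IH[OF Suc.prems(1) _ g(2)[of b]]) (use Ck_on_Suc_imp assms(1) Suc.prems in auto)
    then show "Ck_on k U (\<lambda>x. \<Sum>b\<in>Basis. (f' x v \<bullet> b) *\<^sub>R g' (f x) b)"
      using f(2)[of v] assms(1)
      by (intro Ck_on_sum Ck_on_bilinear[OF _ bounded_bilinear_scaleR]
            Ck_on_linear[OF _ bounded_linear_inner_left]) auto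
  qed (fact assms(1))
qed

section \<open>Smoothness of solutions of linear equations and of inverse maps\<close>

text \<open>The norm of \<open>B x - B x0\<close> is at most the sum of the norms of its values on
  \<open>Basis\<close>, which tends to 0. Once below m/2, it uses up at most half of the lower bound
  m of the injective map \<open>B x0\<close>.\<close>

lemma eventually_linear_bounded_below:
  fixes B :: "'x::metric_space \<Rightarrow> 'a::euclidean_space \<Rightarrow> 'b::euclidean_space"
  assumes "open U" "x0 \<in> U" "\<And>y. continuous_on U (\<lambda>x. B x y)"
    "\<And>x. x \<in> U \<Longrightarrow> linear (B x)" "inj (B x0)"
  obtains m where "m > 0" "\<forall>\<^sub>F x in at x0. \<forall>y. m * norm y \<le> norm (B x y)"
proof -
  obtain m where m: "m > 0" "\<And>y. m * norm y \<le> norm (B x0 y)"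
    using linear_inj_bounded_below_pos[OF assms(4)[OF assms(2)] assms(5)] by metis
  have "((\<lambda>x. B x b) \<longlongrightarrow> B x0 b) (at x0)" for b
    using assms(1-3) by (metis continuous_on_eq_continuous_at isCont_def)
  then have "((\<lambda>x. \<Sum>b\<in>Basis. norm (B x b - B x0 b)) \<longlongrightarrow> (\<Sum>b\<in>(Basis::'a set). norm (B x0 b - B x0 b))) (at x0)"
    by (intro tendsto_intros)
  then have "\<forall>\<^sub>F x in at x0. (\<Sum>b\<in>Basis. norm (B x b - B x0 b)) < m / 2"
    by (rule order_tendstoD) (use m in simp)
  moreover have "\<forall>\<^sub>F x in at x0. x \<in> U"
    using assms(1,2) by (rule eventually_at_in_open')
  ultimately have "\<forall>\<^sub>F x in at x0. \<forall>y. m / 2 * norm y \<le> norm (B x y)"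
  proof eventually_elim
    case (elim x)
    show ?case
    proof
      fix y
      have "B x y - B x0 y = (\<Sum>b\<in>Basis. (y \<bullet> b) *\<^sub>R (B x b - B x0 b))"
        using linear_euclidean_expansion[OF assms(4), of x y] linear_euclidean_expansion[OF assms(4), of x0 y] elim assms(2)
        by (simp add: scaleR_diff_right sum_subtractf)
      also have "norm \<dots> \<le> (\<Sum>b\<in>Basis. norm y * norm (B x b - B x0 b))"
        by (rule sum_norm_le) (auto intro: mult_right_mono Basis_le_norm)
      also have "\<dots> \<le> norm y * (m / 2)"
        unfolding sum_distrib_left[symmetric] using elim by (intro mult_left_mono) auto
      finally have "norm (B x y - B x0 y) \<le> norm y * (m / 2)" .
      moreover have "norm (B x0 y) \<le> norm (B x y) + norm (B x y - B x0 y)"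
        by (metis norm_minus_commute norm_triangle_sub add.commute)
      ultimately show "m / 2 * norm y \<le> norm (B x y)"
        using m(2)[of y] by (simp add: field_simps)
    qed
  qed
  then show ?thesis using that[of "m / 2"] m(1) by simp
qed

lemma inj_if_bounded_below: "linear l \<Longrightarrow> m > 0 \<Longrightarrow> \<forall>y. m * norm y \<le> norm (l y) \<Longrightarrow> inj l"
  by (subst linear_injective_0) (auto, metis mult_le_0_iff norm_le_zero_iff norm_zero not_le)

lemma open_linear_injective:
  fixes B :: "'x::metric_space \<Rightarrow> 'a::euclidean_space \<Rightarrow> 'b::euclidean_space"
  assumes "open U" "\<And>y. continuous_on U (\<lambda>x. B x y)" "\<And>x. x \<in> U \<Longrightarrow> linear (B x)"
  shows "open {x \<in> U. inj (B x)}"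
proof (rule openI)
  fix x0 assume x0: "x0 \<in> {x \<in> U. inj (B x)}"
  then obtain m where m: "m > 0" "\<forall>\<^sub>F x in at x0. \<forall>y. m * norm y \<le> norm (B x y)"
    using eventually_linear_bounded_below[OF assms(1) _ assms(2,3)] by blast
  have "\<forall>\<^sub>F x in at x0. x \<in> U"
    using assms(1) x0 by (intro eventually_at_in_open') auto
  with m(2) have "\<forall>\<^sub>F x in at x0. x \<in> {x \<in> U. inj (B x)}"
    by eventually_elim (use inj_if_bounded_below[OF _ m(1)] assms(3) in blast)
  then have "\<forall>\<^sub>F x in nhds x0. x \<in> {x \<in> U. inj (B x)}"
    using x0 by (simp add: eventually_nhds_conv_at)
  then show "\<exists>e>0. ball x0 e \<subseteq> {x \<in> U. inj (B x)}"
    unfolding eventually_nhds_metric by (auto simp: subset_eq dist_commute mem_ball)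
qed

text \<open>A product rule in which \<open>s\<close> need only be continuous, because a derivative
  of \<open>s\<close> would be multiplied by \<open>t x = 0\<close>. It serves to differentiate a
  solution so far known only to be continuous.\<close>

lemma has_derivative_scaleR_vanishing:
  fixes s :: "'x::real_normed_vector \<Rightarrow> real" and t :: "'x \<Rightarrow> 'b::real_normed_vector"
  assumes "isCont s x" "(t has_derivative t') (at x)" "t x = 0"
  shows "((\<lambda>z. s z *\<^sub>R t z) has_derivative (\<lambda>h. s x *\<^sub>R t' h)) (at x)"
proof -
  interpret bounded_linear t' using assms(2) by (rule has_derivative_bounded_linear)
  obtain K where K: "\<And>h. norm (t' h) \<le> norm h * K" "K > 0" using pos_bounded by blast
  have l1: "((\<lambda>z. norm (t z - t x - t' (z - x)) / norm (z - x)) \<longlongrightarrow> 0) (at x)"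
    using assms(2) by (simp add: has_derivative_iff_norm)
  have s0: "((\<lambda>z. \<bar>s z - s x\<bar>) \<longlongrightarrow> 0) (at x)"
    using assms(1) by (simp add: isCont_def LIM_zero tendsto_rabs_zero)
  have s1: "((\<lambda>z. \<bar>s z\<bar>) \<longlongrightarrow> \<bar>s x\<bar>) (at x)"
    using assms(1) by (auto simp: isCont_def intro: tendsto_intros)
  have lim: "((\<lambda>z. \<bar>s z\<bar> * (norm (t z - t x - t' (z - x)) / norm (z - x)) + \<bar>s z - s x\<bar> * K) \<longlongrightarrow> \<bar>s x\<bar> * 0 + 0 * K) (at x)"
    by (intro tendsto_intros l1 s0 s1)
  have "norm (s z *\<^sub>R t z - s x *\<^sub>R t x - s x *\<^sub>R t' (z - x)) / norm (z - x)
      \<le> \<bar>s z\<bar> * (norm (t z - t x - t' (z - x)) / norm (z - x)) + \<bar>s z - s x\<bar> * K" if "z \<noteq> x" for z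
  proof -
    have "s z *\<^sub>R t z - s x *\<^sub>R t x - s x *\<^sub>R t' (z - x) = s z *\<^sub>R (t z - t x - t' (z - x)) + (s z - s x) *\<^sub>R t' (z - x)"
      using assms(3) by (simp add: algebra_simps)
    also have "norm \<dots> \<le> \<bar>s z\<bar> * norm (t z - t x - t' (z - x)) + \<bar>s z - s x\<bar> * (norm (z - x) * K)"
      using K by (intro norm_triangle_le add_mono) (auto intro: mult_left_mono)
    finally show ?thesis using that by (simp add: field_simps)
  qed
  then have ev: "\<forall>\<^sub>F z in at x. norm (norm (s z *\<^sub>R t z - s x *\<^sub>R t x - s x *\<^sub>R t' (z - x)) / norm (z - x))
      \<le> \<bar>s z\<bar> * (norm (t z - t x - t' (z - x)) / norm (z - x)) + \<bar>s z - s x\<bar> * K"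
    by (auto simp: eventually_at_filter)
  have "((\<lambda>z. norm (s z *\<^sub>R t z - s x *\<^sub>R t x - s x *\<^sub>R t' (z - x)) / norm (z - x)) \<longlongrightarrow> 0) (at x)"
    by (rule Lim_null_comparison[OF ev]) (use lim in simp)
  then show ?thesis
    unfolding has_derivative_iff_norm using bounded_linear_axioms bounded_linear_compose[OF bounded_linear_scaleR_right] by auto
qed

text \<open>The residual \<open>c x - B x (u x0)\<close> equals \<open>B x (u x - u x0)\<close> and
  tends to 0, while near x0 the maps \<open>B x\<close> have a common positive lower bound.\<close>

lemma continuous_on_linear_solution:
  fixes B :: "'x::metric_space \<Rightarrow> 'a::euclidean_space \<Rightarrow> 'b::euclidean_space"
  assumes U: "open U" and lin: "\<And>x. x \<in> U \<Longrightarrow> linear (B x)" and inj: "\<And>x. x \<in> U \<Longrightarrow> inj (B x)"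
    and B: "\<And>y. continuous_on U (\<lambda>x. B x y)" and c: "continuous_on U c"
    and sol: "\<And>x. x \<in> U \<Longrightarrow> B x (u x) = c x"
  shows "continuous_on U u"
proof (intro continuous_at_imp_continuous_on ballI)
  fix x0 assume x0: "x0 \<in> U"
  obtain m where m: "m > 0" "\<forall>\<^sub>F x in at x0. \<forall>y. m * norm y \<le> norm (B x y)"
    using eventually_linear_bounded_below[OF U x0 B lin inj] x0 by blast
  have "\<forall>\<^sub>F x in at x0. x \<in> U" using U x0 by (rule eventually_at_in_open')
  with m(2) have ev: "\<forall>\<^sub>F x in at x0. norm (u x - u x0) \<le> norm (c x - B x (u x0)) / m"
  proof eventually_elim
    case (elim x)
    have "B x (u x - u x0) = c x - B x (u x0)"
      using lin[of x] elim sol by (simp add: linear_diff)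
    with elim(1) have "m * norm (u x - u x0) \<le> norm (c x - B x (u x0))" by metis
    then show ?case using m(1) by (simp add: field_simps)
  qed
  have "((\<lambda>x. c x) \<longlongrightarrow> c x0) (at x0)" "((\<lambda>x. B x (u x0)) \<longlongrightarrow> B x0 (u x0)) (at x0)"
    using B c x0 U by (metis continuous_on_eq_continuous_at isCont_def)+
  then have "((\<lambda>x. norm (c x - B x (u x0)) / m) \<longlongrightarrow> norm (c x0 - B x0 (u x0)) / m) (at x0)"
    using m(1) by (intro tendsto_intros) auto
  then have "((\<lambda>x. u x - u x0) \<longlongrightarrow> 0) (at x0)"
    using Lim_null_comparison[OF ev] sol[OF x0] by simp
  then show "isCont u x0" by (simp add: isCont_def LIM_zero_cancel)
qed

text \<open>Differentiating \<open>B x (u x) = c x\<close> shows that each directional derivative of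
  \<open>u\<close> solves a system with the same \<open>B\<close> and a right-hand side built from
  \<open>u\<close> and first derivatives of \<open>B\<close> and \<open>c\<close>. So each induction
  step gains one derivative.\<close>

lemma Ck_on_linear_solution:
  fixes B :: "'x::real_normed_vector \<Rightarrow> 'a::euclidean_space \<Rightarrow> 'a"
  assumes U: "open U" and lin: "\<And>x. x \<in> U \<Longrightarrow> linear (B x)" and inj: "\<And>x. x \<in> U \<Longrightarrow> inj (B x)"
    and "\<And>y. Ck_on k U (\<lambda>x. B x y)" and "Ck_on k U c"
    and "\<And>x. x \<in> U \<Longrightarrow> B x (u x) = c x"
  shows "Ck_on k U u"
  using assms(4-6)
proof (induction k arbitrary: c u)
  case 0
  then show ?case using continuous_on_linear_solution[OF U lin inj, where c = c and u = u] by simp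
next
  case (Suc k)
  have "\<exists>B'. (\<forall>x\<in>U. ((\<lambda>x. B x y) has_derivative B' x) (at x)) \<and> (\<forall>v. Ck_on k U (\<lambda>x. B' x v))" for y
    using Ck_on_SucE[OF Suc.prems(1)[of y]] by metis
  then obtain B' where B': "\<And>x y. x \<in> U \<Longrightarrow> ((\<lambda>x. B x y) has_derivative B' y x) (at x)"
      "\<And>y v. Ck_on k U (\<lambda>x. B' y x v)" by metis
  obtain c' where c': "\<And>x. x \<in> U \<Longrightarrow> (c has_derivative c' x) (at x)" "\<And>v. Ck_on k U (\<lambda>x. c' x v)"
    using Suc.prems(2) by (rule Ck_on_SucE) blast
  have Bk: "Ck_on k U (\<lambda>x. B x y)" for y
    using Suc.prems(1) U by (rule Ck_on_Suc_imp[rotated])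
  have u: "Ck_on k U u"
    by (rule Suc.IH[OF Bk Ck_on_Suc_imp[OF U Suc.prems(2)] Suc.prems(3)])
  have rhs: "Ck_on k U (\<lambda>x. c' x v - (\<Sum>b\<in>Basis. (u x \<bullet> b) *\<^sub>R B' b x v))" for v
    by (intro Ck_on_diff Ck_on_sum Ck_on_bilinear[OF _ bounded_bilinear_scaleR]
        Ck_on_linear[OF _ bounded_linear_inner_left] U u c' B') auto
  have "\<exists>u'. (u has_derivative u') (at x) \<and> (\<forall>v. B x (u' v) = c' x v - (\<Sum>b\<in>Basis. (u x \<bullet> b) *\<^sub>R B' b x v))"
    if x: "x \<in> U" for x
  proof -
    obtain g where g: "linear g" "g \<circ> B x = id"
      using linear_injective_left_inverse[OF lin inj] x by blast
    then have g': "B x \<circ> g = id" using linear_inverse_left[OF lin[OF x]] by blast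
    have bg: "bounded_linear g" using g(1) by (simp add: linear_conv_bounded_linear)
    have cu: "isCont u x"
      using Ck_on_imp_continuous_on[OF U u] x U continuous_on_eq_continuous_at by blast
    have vanish: "((\<lambda>z. (u z \<bullet> b) *\<^sub>R (B z b - B x b)) has_derivative (\<lambda>v. (u x \<bullet> b) *\<^sub>R B' b x v)) (at x)" for b
      using cu B'(1)[OF x] by (intro has_derivative_scaleR_vanishing) (auto intro!: derivative_eq_intros continuous_intros)
    have "((\<lambda>z. g (c z - (\<Sum>b\<in>Basis. (u z \<bullet> b) *\<^sub>R (B z b - B x b)))) has_derivative
        (\<lambda>v. g (c' x v - (\<Sum>b\<in>Basis. (u x \<bullet> b) *\<^sub>R B' b x v)))) (at x)"
      by (intro bounded_linear.has_derivative[OF bg] has_derivative_diff has_derivative_sum vanish c'(1) x)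
    moreover have "g (c z - (\<Sum>b\<in>Basis. (u z \<bullet> b) *\<^sub>R (B z b - B x b))) = u z" if "z \<in> U" for z
    proof -
      have "(\<Sum>b\<in>Basis. (u z \<bullet> b) *\<^sub>R (B z b - B x b)) = c z - B x (u z)"
        using linear_euclidean_expansion[OF lin[OF that], of "u z"] linear_euclidean_expansion[OF lin[OF x], of "u z"]
          Suc.prems(3)[OF that] by (simp add: scaleR_diff_right sum_subtractf)
      then show ?thesis using g(2) by (simp add: fun_eq_iff)
    qed
    ultimately have "(u has_derivative (\<lambda>v. g (c' x v - (\<Sum>b\<in>Basis. (u x \<bullet> b) *\<^sub>R B' b x v)))) (at x)"
      by (rule has_derivative_transform_within_open[OF _ U x])
    then show ?thesis using g' by (auto simp: fun_eq_iff)
  qed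
  then obtain u' where u': "\<And>x. x \<in> U \<Longrightarrow> (u has_derivative u' x) (at x)"
     "\<And>x v. x \<in> U \<Longrightarrow> B x (u' x v) = c' x v - (\<Sum>b\<in>Basis. (u x \<bullet> b) *\<^sub>R B' b x v)" by metis
  show ?case
    by (rule Ck_on_SucI[OF U u'(1)], assumption) (rule Suc.IH[OF Bk rhs u'(2)])
qed

text \<open>The derivative of \<open>h\<close> at y in direction v solves the linear system
  \<open>g' (h y) w = v\<close>, whose coefficients are \<open>Ck_on k\<close> as soon as
  \<open>h\<close> is. The assumed continuity of \<open>h\<close> starts the induction.\<close>

lemma Ck_on_inverse:
  fixes g :: "'a::euclidean_space \<Rightarrow> 'a"
  assumes U: "open U" and V: "open V" and g: "\<And>k. Ck_on k U g" and "\<And>x. x \<in> U \<Longrightarrow> (g has_derivative g' x) (at x)"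
    and inj: "\<And>x. x \<in> U \<Longrightarrow> inj (g' x)"
    and h: "continuous_on V h" "h ` V \<subseteq> U" "\<And>y. y \<in> V \<Longrightarrow> g (h y) = y"
  shows "Ck_on k V h"
proof (induction k)
  case 0
  show ?case using h by simp
next
  case (Suc k)
  have lin: "linear (g' (h y))" if "y \<in> V" for y
    using assms(4) h(2) that has_derivative_linear by blast
  have "\<exists>h'. (h has_derivative h') (at y) \<and> (\<forall>v. g' (h y) (h' v) = v)" if y: "y \<in> V" for y
  proof -
    have hy: "h y \<in> U" using h y by auto
    obtain l where l: "linear l" "l \<circ> g' (h y) = id"
      using linear_injective_left_inverse[OF lin[OF y] inj[OF hy]] by blast
    have "(h has_derivative l) (at y)"
    proof (rule has_derivative_inverse_basic)
      show "(g has_derivative g' (h y)) (at (h y))" using assms(4) hy by blast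
      show "isCont h y" using h(1) y V continuous_on_eq_continuous_at by blast
    qed (use l y V h in \<open>auto simp: linear_conv_bounded_linear\<close>)
    moreover have "g' (h y) \<circ> l = id" using linear_inverse_left[OF lin[OF y]] l by blast
    ultimately show ?thesis by (auto simp: fun_eq_iff)
  qed
  then obtain h' where h': "\<And>y. y \<in> V \<Longrightarrow> (h has_derivative h' y) (at y)"
      "\<And>y v. y \<in> V \<Longrightarrow> g' (h y) (h' y v) = v" by metis
  have g'k: "Ck_on k U (\<lambda>x. g' x w)" for w
    by (rule Ck_on_cong[OF U, of "\<lambda>x. frechet_derivative g (at x) w"])
       (use g[of "Suc k"] assms(4) frechet_derivative_at in \<open>fastforce+\<close>)
  have gh: "Ck_on k V (\<lambda>y. g' (h y) w)" for w
    by (rule Ck_on_compose[OF V U h(2) Suc g'k])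
  have "Ck_on k V (\<lambda>y. h' y v)" for v
    by (rule Ck_on_linear_solution[where B = "\<lambda>y. g' (h y)" and c = "\<lambda>_. v"])
       (use V lin inj h gh h'(2) Ck_on_const in auto)
  then show ?case using Ck_on_SucI[OF V h'(1)] by blast
qed

section \<open>Smooth maps on subsets of Euclidean spaces\<close>

lemma smooth_onI_Ck:
  assumes "open U" "S \<subseteq> U" "\<And>k. Ck_on k U g" "\<And>y. y \<in> S \<Longrightarrow> g y = f y"
  shows "smooth_on S f"
  using assms unfolding smooth_on_def by blast

lemma smooth_on_subset: "smooth_on S f \<Longrightarrow> T \<subseteq> S \<Longrightarrow> smooth_on T f"
  unfolding smooth_on_def by (rule ballI, drule bspec, erule (1) subsetD) blast

lemma smooth_on_eq: "smooth_on S f \<Longrightarrow> (\<And>x. x \<in> S \<Longrightarrow> f x = g x) \<Longrightarrow> smooth_on S g"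
  unfolding smooth_on_def by (metis Int_iff)

lemma smooth_on_local:
  assumes "\<And>x. x \<in> S \<Longrightarrow> \<exists>U. open U \<and> x \<in> U \<and> smooth_on (S \<inter> U) f"
  shows "smooth_on S f"
  unfolding smooth_on_def
proof
  fix x assume x: "x \<in> S"
  then obtain U where U: "open U" "x \<in> U" "smooth_on (S \<inter> U) f" using assms by blast
  then obtain V g where V: "open V" "x \<in> V" "\<forall>k. Ck_on k V g" "\<forall>y\<in>V \<inter> (S \<inter> U). g y = f y"
    unfolding smooth_on_def using x by (metis IntI)
  then show "\<exists>U g. open U \<and> x \<in> U \<and> (\<forall>k. Ck_on k U g) \<and> (\<forall>y\<in>U \<inter> S. g y = f y)"
    using U by (intro exI[of _ "U \<inter> V"] exI[of _ g]) (auto intro: Ck_on_subset)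
qed

lemma smooth_on_open_imp_Ck_on:
  assumes "open U" "smooth_on U f"
  shows "Ck_on k U f"
proof (rule Ck_on_local[OF assms(1)])
  fix x assume "x \<in> U"
  then obtain V g where V: "open V" "x \<in> V" "\<forall>k. Ck_on k V g" "\<forall>y\<in>V \<inter> U. g y = f y"
    using assms(2) unfolding smooth_on_def by blast
  then have "Ck_on k (V \<inter> U) f"
    using assms(1) by (intro Ck_on_cong[of "V \<inter> U" g f]) (auto intro: Ck_on_subset)
  then show "\<exists>V. open V \<and> x \<in> V \<and> Ck_on k V f"
    using V assms(1) \<open>x \<in> U\<close> by blast
qed

lemma smooth_on_imp_continuous_on:
  assumes "smooth_on S f"
  shows "continuous_on S f"
proof (rule continuous_on_eq_continuous_within[THEN iffD2], rule)
  fix x assume x: "x \<in> S"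
  then obtain U g where U: "open U" "x \<in> U" "\<forall>k. Ck_on k U g" "\<forall>y\<in>U \<inter> S. g y = f y"
    using assms unfolding smooth_on_def by blast
  then have "continuous_on U g" using Ck_on_imp_continuous_on by blast
  then have "continuous (at x within S) g"
    using U continuous_on_eq_continuous_at continuous_at_imp_continuous_at_within by blast
  moreover have "\<forall>\<^sub>F y in at x within S. g y = f y"
    using U unfolding eventually_at_topological by blast
  ultimately show "continuous (at x within S) f"
    using U x by (metis IntI Lim_transform_eventually continuous_within)
qed

lemma smooth_on_has_derivative:
  assumes "smooth_on S f" "x \<in> S"
  obtains D where "(f has_derivative D) (at x within S)"
proof -
  obtain U g where U: "open U" "x \<in> U" "\<forall>k. Ck_on k U g" "\<forall>y\<in>U \<inter> S. g y = f y"
    using assms unfolding smooth_on_def by blast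
  then have "Ck_on (Suc 0) U g" by blast
  then obtain D where "(g has_derivative D) (at x)"
    by (rule Ck_on_SucE) (use U(2) in blast)
  then have "(g has_derivative D) (at x within S)" by (rule has_derivative_at_withinI)
  moreover have "\<forall>\<^sub>F y in at x within S. g y = f y"
    using U unfolding eventually_at_topological by blast
  ultimately have "(f has_derivative D) (at x within S)"
    using U assms(2) by (auto intro: has_derivative_transform_eventually)
  then show ?thesis by (rule that)
qed

lemma smooth_on_compose:
  assumes "smooth_on S f" "smooth_on T g" "f ` S \<subseteq> T"
  shows "smooth_on S (\<lambda>x. g (f x))"
  unfolding smooth_on_def
proof
  fix x assume x: "x \<in> S"
  obtain U f1 where U: "open U" "x \<in> U" "\<forall>k. Ck_on k U f1" "\<forall>y\<in>U \<inter> S. f1 y = f y"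
    using assms(1) x unfolding smooth_on_def by blast
  obtain V g1 where V: "open V" "f x \<in> V" "\<forall>k. Ck_on k V g1" "\<forall>y\<in>V \<inter> T. g1 y = g y"
    using bspec[OF assms(2)[unfolded smooth_on_def], of "f x"] assms(3) x by blast
  define W where "W = U \<inter> f1 -` V"
  have "continuous_on U f1" using U Ck_on_imp_continuous_on by blast
  then have W: "open W" unfolding W_def using U V by (simp add: continuous_open_preimage)
  have "Ck_on k W (\<lambda>x. g1 (f1 x))" for k
  proof (rule Ck_on_compose[OF W V(1)])
    show "Ck_on k W f1" by (rule Ck_on_subset[of _ U]) (use U(3) in \<open>auto simp: W_def\<close>)
  qed (use V(3) in \<open>auto simp: W_def\<close>)
  moreover have "\<forall>y\<in>W \<inter> S. g1 (f1 y) = g (f y)"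
    using U(4) V(4) assms(3) by (auto simp: W_def)
  ultimately show "\<exists>U h. open U \<and> x \<in> U \<and> (\<forall>k. Ck_on k U h) \<and> (\<forall>y\<in>U \<inter> S. h y = g (f y))"
    using W x U V by (intro exI[of _ W] exI[of _ "\<lambda>x. g1 (f1 x)"]) (auto simp: W_def)
qed

lemma smooth_on_add:
  assumes "smooth_on S f" "smooth_on S g"
  shows "smooth_on S (\<lambda>x. f x + g x)"
  unfolding smooth_on_def
proof
  fix x assume x: "x \<in> S"
  obtain U f1 where U: "open U" "x \<in> U" "\<forall>k. Ck_on k U f1" "\<forall>y\<in>U \<inter> S. f1 y = f y"
    using assms(1) x unfolding smooth_on_def by blast
  obtain V g1 where V: "open V" "x \<in> V" "\<forall>k. Ck_on k V g1" "\<forall>y\<in>V \<inter> S. g1 y = g y"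
    using assms(2) x unfolding smooth_on_def by blast
  have "Ck_on k (U \<inter> V) (\<lambda>x. f1 x + g1 x)" for k
    using U V by (intro Ck_on_add) (auto intro: Ck_on_subset)
  then show "\<exists>U h. open U \<and> x \<in> U \<and> (\<forall>k. Ck_on k U h) \<and> (\<forall>y\<in>U \<inter> S. h y = f y + g y)"
    using U V by (intro exI[of _ "U \<inter> V"] exI[of _ "\<lambda>x. f1 x + g1 x"]) auto
qed

lemma smooth_on_linear:
  fixes l :: "'a::euclidean_space \<Rightarrow> 'b::euclidean_space"
  shows "linear l \<Longrightarrow> smooth_on S l"
  by (rule smooth_onI_Ck[where U = UNIV and g = l])
     (auto simp: linear_conv_bounded_linear intro: Ck_on_linear[where f = "\<lambda>x. x"] Ck_on_ident)

lemma smooth_on_const: "smooth_on S (\<lambda>x. c)"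
  by (rule smooth_onI_Ck[where U = UNIV]) (auto intro: Ck_on_const)

section \<open>Derivatives within linear subspaces, and an inverse function theorem there\<close>

lemma orthogonal_projection_exists:
  fixes E :: "'a::euclidean_space set"
  assumes "subspace E"
  obtains p where "linear p" "\<And>x. p x \<in> E" "\<And>x. x \<in> E \<Longrightarrow> p x = x" "\<And>x y. y \<in> E \<Longrightarrow> (x - p x) \<bullet> y = 0"
proof -
  obtain B where B: "B \<subseteq> E" "pairwise orthogonal B" "\<And>x. x \<in> B \<Longrightarrow> norm x = 1" "independent B" "span B = E"
    using orthonormal_basis_subspace[OF assms] by metis
  have fin: "finite B" using B(4) independent_imp_finite by blast
  define p where "p x = (\<Sum>b\<in>B. (x \<bullet> b) *\<^sub>R b)" for x
  have lin: "linear p"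
    unfolding p_def by (rule linearI) (simp_all add: algebra_simps sum.distrib scaleR_sum_right)
  have inE: "p x \<in> E" for x
    unfolding p_def using B(1) assms by (auto intro!: subspace_sum subspace_scale)
  have pb: "p x \<bullet> b = x \<bullet> b" if "b \<in> B" for x b
  proof -
    have "(c \<bullet> b) = (if c = b then 1 else 0)" if "c \<in> B" for c
      using B(2) B(3)[of b] that \<open>b \<in> B\<close> by (auto simp: pairwise_def orthogonal_def norm_eq_1)
    then have "p x \<bullet> b = (\<Sum>c\<in>B. (x \<bullet> c) * (if c = b then 1 else 0))"
      unfolding p_def inner_sum_left by simp
    then show ?thesis using fin that by (simp add: if_distrib cong: if_cong)
  qed
  have orth: "(x - p x) \<bullet> y = 0" if "y \<in> E" for x y
    using that unfolding B(5)[symmetric]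
    by (induction rule: span_induct) (auto simp: subspace_def inner_right_distrib inner_diff_left pb)
  have "p x = x" if "x \<in> E" for x
    using orth[of "x - p x" x] that inE assms by (simp add: subspace_diff)
  then show ?thesis using that lin inE orth by blast
qed

lemma open_preimage_subspace:
  fixes l :: "'a::euclidean_space \<Rightarrow> 'b::euclidean_space"
  assumes "openin (top_of_set E) S" "linear l" "\<And>x. l x \<in> E"
  shows "open {x. l x \<in> S}"
proof -
  obtain T where T: "open T" "S = E \<inter> T" using assms(1) by (auto simp: openin_open)
  have "{x. l x \<in> S} = l -` T" using T assms(3) by auto
  then show ?thesis
    using T linear_continuous_on[of l UNIV] assms(2)
    by (simp add: linear_conv_bounded_linear continuous_open_vimage continuous_on_eq_continuous_at)
qed

text \<open>Precomposing with a linear map into E trades a derivative within S for an ordinary one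
  on the open preimage of S, where derivatives are unique.\<close>

lemma has_derivative_within_subspace:
  fixes f :: "'a::euclidean_space \<Rightarrow> 'b::real_normed_vector" and p :: "'a \<Rightarrow> 'a"
  assumes "openin (top_of_set E) S" "linear p" "\<And>x. p x \<in> E" "p x \<in> S"
    "(f has_derivative D) (at (p x) within S)"
  shows "((\<lambda>y. f (p y)) has_derivative (\<lambda>v. D (p v))) (at x)"
proof -
  let ?U = "{y. p y \<in> S}"
  have o: "open ?U" using open_preimage_subspace[OF assms(1-3)] .
  have "bounded_linear p" using assms(2) by (simp add: linear_conv_bounded_linear)
  then have "(p has_derivative p) (at x within ?U)" by (rule bounded_linear_imp_has_derivative)
  moreover have "(f has_derivative D) (at (p x) within p ` ?U)"
    using assms(5) by (rule has_derivative_subset) auto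
  ultimately have "((\<lambda>y. f (p y)) has_derivative (\<lambda>v. D (p v))) (at x within ?U)"
    by (rule has_derivative_in_compose)
  then show ?thesis using at_within_open[of x ?U] o assms(4) by simp
qed

text \<open>With p the projection onto E, both \<open>\<lambda>v. D (p v)\<close> and
  \<open>\<lambda>v. D' (p v)\<close> are ordinary derivatives of functions that agree near
  x.\<close>

lemma has_derivative_within_subspace_unique:
  fixes f g :: "'a::euclidean_space \<Rightarrow> 'b::real_normed_vector"
  assumes "subspace E" "openin (top_of_set E) S" "x \<in> S"
    "(f has_derivative D) (at x within S)" "(g has_derivative D') (at x within S)"
    "\<And>y. y \<in> S \<Longrightarrow> f y = g y" "v \<in> E"
  shows "D v = D' v"
proof -
  obtain p where p: "linear p" "\<And>x. p x \<in> E" "\<And>x. x \<in> E \<Longrightarrow> p x = x"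
    using orthogonal_projection_exists[OF assms(1)] by metis
  have x: "p x = x" using p(3) assms(2,3) openin_imp_subset by blast
  have o: "open {y. p y \<in> S}" using open_preimage_subspace[OF assms(2) p(1,2)] .
  have "((\<lambda>y. f (p y)) has_derivative (\<lambda>v. D (p v))) (at x)"
    using has_derivative_within_subspace[OF assms(2) p(1,2), of x f D] x assms(3,4) by simp
  then have "((\<lambda>y. g (p y)) has_derivative (\<lambda>v. D (p v))) (at x)"
    by (rule has_derivative_transform_within_open[OF _ o]) (use x assms(3,6) in auto)
  moreover have "((\<lambda>y. g (p y)) has_derivative (\<lambda>v. D' (p v))) (at x)"
    using has_derivative_within_subspace[OF assms(2) p(1,2), of x g D'] x assms(3,5) by simp
  ultimately have "(\<lambda>v. D (p v)) = (\<lambda>v. D' (p v))" by (rule has_derivative_unique)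
  then show ?thesis using p(3)[OF assms(7)] by (metis (no_types))
qed

text \<open>Projecting onto E' does not change f on S, so D and its projection are derivatives of
  the same map and agree on E.\<close>

lemma has_derivative_within_subspace_range:
  fixes f :: "'a::euclidean_space \<Rightarrow> 'b::euclidean_space"
  assumes "subspace E" "openin (top_of_set E) S" "x \<in> S"
    "(f has_derivative D) (at x within S)" "subspace E'" "f ` S \<subseteq> E'" "v \<in> E"
  shows "D v \<in> E'"
proof -
  obtain q where q: "linear q" "\<And>x. q x \<in> E'" "\<And>x. x \<in> E' \<Longrightarrow> q x = x"
    using orthogonal_projection_exists[OF assms(5)] by metis
  have bq: "bounded_linear q" using q(1) by (simp add: linear_conv_bounded_linear)
  have "((\<lambda>y. q (f y)) has_derivative (\<lambda>v. q (D v))) (at x within S)"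
    by (rule bounded_linear.has_derivative[OF bq assms(4)])
  then have "D v = q (D v)"
    using has_derivative_within_subspace_unique[OF assms(1-4) _ _ assms(7)] q(3) assms(6) by fastforce
  then show ?thesis using q(2) by metis
qed

text \<open>The chain rule for \<open>u (v z) = z\<close> makes D' a right inverse of D on
  E.\<close>

lemma has_derivative_right_inverse_onto:
  fixes u :: "'a::euclidean_space \<Rightarrow> 'b::euclidean_space"
  assumes L: "subspace L" "openin (top_of_set L) S" and E: "subspace E" "openin (top_of_set E) T"
    and y: "y \<in> T" and u: "(u has_derivative D) (at (v y) within S)" "u ` S \<subseteq> E"
    and v: "(v has_derivative D') (at y within T)" "v ` T \<subseteq> S" and uv: "\<And>z. z \<in> T \<Longrightarrow> u (v z) = z"
  shows "D ` L = E"
proof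
  have vy: "v y \<in> S" using v(2) y by auto
  show "D ` L \<subseteq> E"
    using has_derivative_within_subspace_range[OF L vy u(1) E(1) u(2)] by auto
  show "E \<subseteq> D ` L"
  proof
    fix w assume w: "w \<in> E"
    have "((\<lambda>z. u (v z)) has_derivative (\<lambda>w. D (D' w))) (at y within T)"
      using v(1) has_derivative_subset[OF u(1) v(2)] by (rule has_derivative_in_compose)
    then have "D (D' w) = w"
      using has_derivative_within_subspace_unique[OF E y _ has_derivative_ident _ w] uv by blast
    moreover have "D' w \<in> L"
      using has_derivative_within_subspace_range[OF E y v(1) L(1) _ w] v(2) openin_imp_subset[OF L(2)] by auto
    ultimately show "w \<in> D ` L" by (metis imageI)
  qed
qed

text \<open>Reduces to open sets of the full space: E' is moved onto E by an isometry, and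
  \<open>g\<close> is extended by the identity on the orthogonal complement of E. Equal dimensions
  provide the isometry and, together with surjectivity, make the derivative of the extension
  bijective.\<close>

lemma smooth_on_inverse:
  fixes g :: "'a::euclidean_space \<Rightarrow> 'b::euclidean_space"
  assumes E: "subspace E" "openin (top_of_set E) S" and E': "subspace E'" "openin (top_of_set E') T"
    and dim: "dim E = dim E'"
    and g: "smooth_on S g" "g ` S \<subseteq> T"
    and onto: "\<And>x. x \<in> S \<Longrightarrow> \<exists>D. (g has_derivative D) (at x within S) \<and> D ` E = E'"
    and h: "continuous_on T h" "h ` T \<subseteq> S" "\<And>y. y \<in> T \<Longrightarrow> g (h y) = y"
  shows "smooth_on T h"
proof -
  obtain p where p: "linear p" "\<And>x. p x \<in> E" "\<And>x. x \<in> E \<Longrightarrow> p x = x"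
    using orthogonal_projection_exists[OF E(1)] by metis
  obtain i j where i: "linear i" "i ` E' = E" and j: "linear j" "j ` E = E'"
    and ij: "\<And>x. x \<in> E' \<Longrightarrow> j (i x) = x" "\<And>x. x \<in> E \<Longrightarrow> i (j x) = x"
    using isometries_subspaces[OF E'(1) E(1)] dim by metis
  have SE: "S \<subseteq> E" and TE': "T \<subseteq> E'" using E(2) E'(2) openin_imp_subset by blast+
  have ljp: "linear (\<lambda>x. j (p x))" using linear_compose[OF p(1) j(1)] by (simp add: o_def)
  have jpE: "j (p x) \<in> E'" for x using j(2) p(2) by auto
  define U where "U = {x. p x \<in> S}"
  define V where "V = {x. j (p x) \<in> T}"
  have U: "open U" unfolding U_def using open_preimage_subspace[OF E(2) p(1,2)] .
  have V: "open V" unfolding V_def using open_preimage_subspace[OF E'(2) ljp jpE] .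
  define G where "G x = i (g (p x)) + (x - p x)" for x
  define K where "K y = h (j (p y)) + (y - p y)" for y
  have lq: "linear (\<lambda>x. x - p x)" using linear_compose_sub[OF linear_id p(1)] by (simp add: id_def)
  have pq: "p (x - p x) = 0" for x using p(2,3) by (simp add: linear_diff[OF p(1)])
  have "smooth_on U G" unfolding G_def
    by (intro smooth_on_add smooth_on_linear[OF lq] smooth_on_compose[OF _ smooth_on_linear[OF i(1)]]
        smooth_on_compose[OF smooth_on_linear[OF p(1)] g(1)]) (auto simp: U_def)
  then have G: "Ck_on k U G" for k using U smooth_on_open_imp_Ck_on by blast
  have "\<exists>D. (G has_derivative D) (at x) \<and> inj D" if "x \<in> U" for x
  proof -
    have px: "p x \<in> S" using that by (simp add: U_def)
    obtain D where D: "(g has_derivative D) (at (p x) within S)" "D ` E = E'" using onto[OF px] by blast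
    have "((\<lambda>y. g (p y)) has_derivative (\<lambda>v. D (p v))) (at x)"
      by (rule has_derivative_within_subspace[OF E(2) p(1,2) px D(1)])
    then have "((\<lambda>y. i (g (p y))) has_derivative (\<lambda>v. i (D (p v)))) (at x)"
      using bounded_linear.has_derivative i(1) linear_conv_bounded_linear by blast
    moreover have "((\<lambda>x. x - p x) has_derivative (\<lambda>x. x - p x)) (at x)"
      using bounded_linear_imp_has_derivative lq linear_conv_bounded_linear by blast
    ultimately have der: "(G has_derivative (\<lambda>v. i (D (p v)) + (v - p v))) (at x)"
      unfolding G_def by (rule has_derivative_add)
    \<comment> \<open>Surjectivity is easy to exhibit; for an endomorphism of a finite-dimensional
      space it yields the injectivity that \<open>Ck_on_inverse\<close> asks for.\<close>
    have "surj (\<lambda>v. i (D (p v)) + (v - p v))"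
      unfolding surj_def
    proof
      fix y
      have "p y \<in> i ` D ` E" using D(2) i(2) p(2) by auto
      then obtain e where e: "e \<in> E" "p y = i (D e)" by auto
      have "p (e + (y - p y)) = e" using pq p(3)[OF e(1)] by (simp add: linear_add[OF p(1)])
      then show "\<exists>v. y = i (D (p v)) + (v - p v)"
        using e(2) by (intro exI[of _ "e + (y - p y)"]) simp
    qed
    then have "inj (\<lambda>v. i (D (p v)) + (v - p v))"
      using der has_derivative_linear linear_surjective_imp_injective by blast
    then show ?thesis using der by blast
  qed
  then obtain G' where G': "\<And>x. x \<in> U \<Longrightarrow> (G has_derivative G' x) (at x)" "\<And>x. x \<in> U \<Longrightarrow> inj (G' x)"
    by metis
  have pK: "p (K y) = h (j (p y))" if "y \<in> V" for y
  proof -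
    have "h (j (p y)) \<in> E" using h(2) SE that by (auto simp: V_def)
    then show ?thesis using pq p(3) by (simp add: K_def linear_add[OF p(1)])
  qed
  have GK: "G (K y) = y" if "y \<in> V" for y
    using pK[OF that] h(3) that ij(2)[OF p(2)] by (simp add: G_def V_def) (simp add: K_def)
  have KV: "K ` V \<subseteq> U" using pK h(2) by (auto simp: U_def V_def)
  have contK: "continuous_on V K"
    unfolding K_def
    by (intro continuous_on_add continuous_on_compose2[OF h(1)] linear_continuous_on)
       (use ljp lq in \<open>auto simp: V_def linear_conv_bounded_linear\<close>)
  have "Ck_on k V K" for k
    by (rule Ck_on_inverse[OF U V G G' contK KV GK])
  then have "smooth_on V K" by (intro smooth_onI_Ck[OF V order_refl]) auto
  then have "smooth_on T (\<lambda>y. K (i y))"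
    using TE' i(2) ij by (intro smooth_on_compose[OF smooth_on_linear[OF i(1)]]) (auto simp: V_def p(3))
  then show ?thesis
  proof (rule smooth_on_eq)
    fix y assume y: "y \<in> T"
    then have "i y \<in> E" "j (i y) = y" using TE' i(2) ij by auto
    then show "K (i y) = h y" by (simp add: K_def p(3))
  qed
qed

section \<open>Charts and quotients with local sections\<close>

lemma second_countable_euclidean: "second_countable (euclidean :: 'a::second_countable_topology topology)"
proof -
  obtain \<B> :: "'a set set" where "countable \<B>" "\<And>C. C \<in> \<B> \<Longrightarrow> open C"
    "\<And>S. open S \<Longrightarrow> \<exists>U. U \<subseteq> \<B> \<and> S = \<Union>U"
    using univ_second_countable by blast
  then show ?thesis unfolding second_countable_def open_openin[symmetric]
    by (metis Union_iff Union_upper subsetD)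
qed

lemma topological_chart_inj_on: "topological_chart M U \<psi> \<Longrightarrow> inj_on \<psi> U"
  unfolding topological_chart_def
  by (metis homeomorphic_imp_injective_map inf.absorb2 openin_subset topspace_subtopology)

lemma topological_chart_open_image:
  assumes "topological_chart M U \<psi>" "openin (space_top M) V" "V \<subseteq> U"
  shows "openin (top_of_set (model M)) (\<psi> ` V)"
proof -
  have "openin (subtopology (space_top M) U) V" using assms by (simp add: openin_subtopology_alt) blast
  then have "openin (top_of_set (\<psi> ` U)) (\<psi> ` V)"
    using assms(1) homeomorphic_imp_open_map unfolding topological_chart_def open_map_def by blast
  then show ?thesis using assms(1) openin_trans unfolding topological_chart_def by blast
qed

lemma topological_chart_continuous_map:
  assumes "topological_chart M U \<psi>"
  shows "continuous_map (subtopology (space_top M) U) (top_of_set (\<psi> ` U)) \<psi>"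
    "continuous_map (top_of_set (\<psi> ` U)) (subtopology (space_top M) U) (inv_into U \<psi>)"
proof -
  have h: "homeomorphic_map (subtopology (space_top M) U) (top_of_set (\<psi> ` U)) \<psi>"
    and U: "U \<subseteq> topspace (space_top M)"
    using assms openin_subset unfolding topological_chart_def by blast+
  then show "continuous_map (subtopology (space_top M) U) (top_of_set (\<psi> ` U)) \<psi>"
    using homeomorphic_imp_continuous_map by blast
  obtain g where g: "homeomorphic_maps (subtopology (space_top M) U) (top_of_set (\<psi> ` U)) \<psi> g"
    using h homeomorphic_map_maps by blast
  have eq: "g y = inv_into U \<psi> y" if "y \<in> \<psi> ` U" for y
    using g that U topological_chart_inj_on[OF assms]
    by (auto simp: homeomorphic_maps_def inf.absorb2)
  show "continuous_map (top_of_set (\<psi> ` U)) (subtopology (space_top M) U) (inv_into U \<psi>)"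
  proof (rule continuous_map_eq)
    show "continuous_map (top_of_set (\<psi> ` U)) (subtopology (space_top M) U) g"
      using g unfolding homeomorphic_maps_def by blast
  qed (use eq in auto)
qed

lemma smooth_manifold_open_submanifold:
  assumes "subspace E" "openin (top_of_set E) S"
  shows "smooth_manifold (open_submanifold E S)"
proof -
  have "homeomorphic_map (subtopology (top_of_set S) S) (top_of_set S) (\<lambda>x. x)"
    using homeomorphic_map_id[of "top_of_set S" "top_of_set S"] by (simp add: subtopology_subtopology id_def)
  then have "topological_chart (open_submanifold E S) S (\<lambda>x. x)"
    using assms unfolding topological_chart_def open_submanifold_def by simp
  moreover have "smooth_on S ((\<lambda>x. x) \<circ> inv_into S (\<lambda>x. x))"
    by (rule smooth_on_eq[OF smooth_on_linear[OF linear_id]]) (simp add: inv_into_f_f[of "\<lambda>x. x" S])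
  ultimately show ?thesis
    using assms(1) unfolding smooth_manifold_def
    by (auto simp: open_submanifold_def Hausdorff_space_subtopology second_countable_subtopology
        second_countable_euclidean)
qed

lemma homeomorphic_map_top_of_set:
  assumes "continuous_on U f" "inj_on f U" "continuous_on (f ` U) (inv_into U f)"
  shows "homeomorphic_map (top_of_set U) (top_of_set (f ` U)) f"
  unfolding homeomorphic_map_maps homeomorphic_maps_def
  using assms by (intro exI[of _ "inv_into U f"]) (auto simp: continuous_map_in_subtopology inv_into_into)

text \<open>Charts of \<open>submanifold E S\<close> are smooth in both directions by the choice of
  the atlas, so transition maps are smooth and only the covering has to be assumed.\<close>

lemma smooth_manifold_submanifold:
  assumes "subspace E" "\<And>x. x \<in> S \<Longrightarrow> \<exists>(U, \<psi>)\<in>atlas (submanifold E S). x \<in> U"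
  shows "smooth_manifold (submanifold E S)"
proof -
  let ?N = "submanifold E S"
  have chart: "topological_chart ?N U \<psi>" if "(U, \<psi>) \<in> atlas ?N" for U \<psi>
  proof -
    have *: "openin (top_of_set S) U" "inj_on \<psi> U" "openin (top_of_set E) (\<psi> ` U)"
      "smooth_on U \<psi>" "smooth_on (\<psi> ` U) (inv_into U \<psi>)"
      using that by (auto simp: submanifold_def)
    moreover have "subtopology (top_of_set S) U = top_of_set U"
      using *(1) openin_imp_subset by (metis inf.absorb2 subtopology_subtopology)
    ultimately show ?thesis unfolding topological_chart_def
      using homeomorphic_map_top_of_set smooth_on_imp_continuous_on by (auto simp: submanifold_def)
  qed
  have "smooth_on (\<psi> ` (U \<inter> V)) (\<eta> \<circ> inv_into U \<psi>)"
    if "(U, \<psi>) \<in> atlas ?N" "(V, \<eta>) \<in> atlas ?N" for U \<psi> V \<eta>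
  proof -
    have "smooth_on (\<psi> ` (U \<inter> V)) (inv_into U \<psi>)"
      by (rule smooth_on_subset[of "\<psi> ` U"]) (use that in \<open>auto simp: submanifold_def\<close>)
    then show ?thesis unfolding o_def
      by (rule smooth_on_compose[where T = V])
         (use that in \<open>auto simp: submanifold_def inv_into_f_f\<close>)
  qed
  moreover have "U \<subseteq> S" if "(U, \<psi>) \<in> atlas ?N" for U \<psi>
    using that openin_imp_subset by (auto simp: submanifold_def)
  then have "(\<Union>(U, \<psi>)\<in>atlas ?N. U) = points ?N"
    using assms(2) by (fastforce simp: submanifold_def)
  ultimately show ?thesis unfolding smooth_manifold_def
    using assms(1) chart
    by (auto simp: submanifold_def Hausdorff_space_subtopology second_countable_subtopology
        second_countable_euclidean)
qed

text \<open>Modelled on S the Krylov matrices, H the feedback set and f the feedback map. The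
  sections must pass through a prescribed point P, not merely exist near \<open>f P\<close>; this is
  what makes f submersive at every point of S.\<close>

locale local_sections =
  fixes L S :: "'p::euclidean_space set" and E H :: "'k::euclidean_space set" and f :: "'p \<Rightarrow> 'k"
  assumes L: "subspace L" and S: "openin (top_of_set L) S"
    and N: "smooth_manifold (submanifold E H)"
    and smooth_f: "smooth_on S f" and f_image: "f ` S = H"
    and local_section: "\<And>P. P \<in> S \<Longrightarrow> \<exists>W \<sigma>. open W \<and> f P \<in> W \<and> smooth_on (H \<inter> W) \<sigma> \<and> \<sigma> ` (H \<inter> W) \<subseteq> S \<and>
        (\<forall>K\<in>H \<inter> W. f (\<sigma> K) = K) \<and> \<sigma> (f P) = P"
begin

lemma E: "subspace E"
  using N by (simp add: smooth_manifold_def submanifold_def)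

lemma chart_submanifold:
  assumes "(U, \<psi>) \<in> atlas (submanifold E H)"
  shows "openin (top_of_set H) U" "U \<subseteq> H" "inj_on \<psi> U" "openin (top_of_set E) (\<psi> ` U)" "\<psi> ` U \<subseteq> E"
    "smooth_on U \<psi>" "smooth_on (\<psi> ` U) (inv_into U \<psi>)"
proof -
  have *: "openin (top_of_set H) U \<and> inj_on \<psi> U \<and> openin (top_of_set E) (\<psi> ` U) \<and>
    smooth_on U \<psi> \<and> smooth_on (\<psi> ` U) (inv_into U \<psi>)"
    using assms by (simp add: submanifold_def)
  then show "openin (top_of_set H) U" "inj_on \<psi> U" "openin (top_of_set E) (\<psi> ` U)"
    "smooth_on U \<psi>" "smooth_on (\<psi> ` U) (inv_into U \<psi>)" by blast+
  show "U \<subseteq> H" "\<psi> ` U \<subseteq> E" using * openin_imp_subset by blast+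
qed

lemma continuous_f: "continuous_map (top_of_set S) (top_of_set H) f"
  using smooth_on_imp_continuous_on[OF smooth_f] f_image by (auto simp: continuous_map_in_subtopology)

lemma open_preimage: "openin (top_of_set H) V \<Longrightarrow> openin (top_of_set L) (S \<inter> f -` V)"
  using openin_continuous_map_preimage[OF continuous_f, of V] openin_trans[OF _ S]
  by (simp add: vimage_def Int_def)

text \<open>If the preimage of U is open, then near any K in U the set U is the preimage of that
  open set under a continuous section, hence open.\<close>

lemma quotient_map_f: "quotient_map (top_of_set S) (top_of_set H) f"
  unfolding quotient_map_def
proof (intro conjI allI impI iffI)
  fix U assume U: "U \<subseteq> topspace (top_of_set H)" "openin (top_of_set S) {x \<in> topspace (top_of_set S). f x \<in> U}"
  show "openin (top_of_set H) U"
  proof (subst openin_subopen, intro ballI)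
    fix K assume K: "K \<in> U"
    then obtain P where P: "P \<in> S" "f P = K" using U(1) f_image by auto
    obtain W \<sigma> where W: "open W" "K \<in> W" "smooth_on (H \<inter> W) \<sigma>" "\<sigma> ` (H \<inter> W) \<subseteq> S"
      "\<forall>K\<in>H \<inter> W. f (\<sigma> K) = K"
      using local_section[OF P(1)] P(2) by metis
    have cont: "continuous_map (top_of_set (H \<inter> W)) (top_of_set S) \<sigma>"
      using smooth_on_imp_continuous_on[OF W(3)] W(4) by (auto simp: continuous_map_in_subtopology)
    have "openin (top_of_set (H \<inter> W)) {K \<in> H \<inter> W. \<sigma> K \<in> {x \<in> S. f x \<in> U}}"
      using openin_continuous_map_preimage[OF cont U(2)] unfolding topspace_euclidean_subtopology .
    then have "openin (top_of_set H) {K \<in> H \<inter> W. \<sigma> K \<in> {x \<in> S. f x \<in> U}}"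
      using W(1) openin_trans openin_open_Int by blast
    moreover have "{K \<in> H \<inter> W. \<sigma> K \<in> {x \<in> S. f x \<in> U}} = {K \<in> H \<inter> W. K \<in> U}" using W(4,5) by auto
    ultimately show "\<exists>T. openin (top_of_set H) T \<and> K \<in> T \<and> T \<subseteq> U"
      using K U(1) W(2) by (intro exI[of _ "{K \<in> H \<inter> W. K \<in> U}"]) auto
  qed
qed (use f_image openin_continuous_map_preimage[OF continuous_f] in auto)

text \<open>A section through x, read in the chart \<open>\<eta>\<close>, is a smooth right inverse
  of \<open>\<eta> \<circ> f\<close>, so the derivative at x is onto.\<close>

lemma chart_submersion:
  assumes c: "(V, \<eta>) \<in> atlas (submanifold E H)"
  shows "smooth_on (S \<inter> f -` V) (\<eta> \<circ> f)"
    and "x \<in> S \<inter> f -` V \<Longrightarrow> \<exists>D. (\<eta> \<circ> f has_derivative D) (at x within S \<inter> f -` V) \<and> D ` L = E"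
proof -
  note c = chart_submanifold[OF c]
  show sm: "smooth_on (S \<inter> f -` V) (\<eta> \<circ> f)" unfolding o_def
    by (rule smooth_on_compose[OF smooth_on_subset[OF smooth_f] c(6)]) auto
  assume x: "x \<in> S \<inter> f -` V"
  then obtain W \<sigma> where W: "open W" "f x \<in> W" "smooth_on (H \<inter> W) \<sigma>" "\<sigma> ` (H \<inter> W) \<subseteq> S"
      "\<forall>K\<in>H \<inter> W. f (\<sigma> K) = K" "\<sigma> (f x) = x"
    using local_section[of x] by blast
  have \<sigma>: "\<sigma> K \<in> S" if "K \<in> H" "K \<in> W" for K using W(4) that by blast
  obtain D where D: "(\<eta> \<circ> f has_derivative D) (at x within S \<inter> f -` V)"
    using smooth_on_has_derivative[OF sm x] .
  define T where "T = \<eta> ` (V \<inter> W)"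
  define v where "v = (\<lambda>y. \<sigma> (inv_into V \<eta> y))"
  have inv: "inv_into V \<eta> (\<eta> K) = K" if "K \<in> V" for K using c(3) that by simp
  have "openin (top_of_set V) (V \<inter> W)" using W(1) by (simp add: openin_open_Int)
  moreover have "homeomorphic_map (top_of_set V) (top_of_set (\<eta> ` V)) \<eta>"
    using c by (intro homeomorphic_map_top_of_set smooth_on_imp_continuous_on) auto
  ultimately have "openin (top_of_set (\<eta> ` V)) T"
    unfolding T_def using homeomorphic_imp_open_map open_map_def by blast
  then have oT: "openin (top_of_set E) T" using c(4) openin_trans by blast
  have sv: "smooth_on T v" unfolding v_def T_def
    by (rule smooth_on_compose[OF smooth_on_subset[OF c(7)] W(3)]) (use c(2) inv in auto)
  have yT: "\<eta> (f x) \<in> T" using x W by (auto simp: T_def)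
  obtain D' where D': "(v has_derivative D') (at (\<eta> (f x)) within T)"
    using smooth_on_has_derivative[OF sv yT] .
  have vx: "v (\<eta> (f x)) = x" using x inv W(6) by (simp add: v_def)
  have "D ` L = E"
  proof (rule has_derivative_right_inverse_onto[OF L _ E oT yT _ _ D'])
    show "openin (top_of_set L) (S \<inter> f -` V)" using open_preimage c(1) .
    show "(\<eta> \<circ> f has_derivative D) (at (v (\<eta> (f x))) within S \<inter> f -` V)" using D vx by simp
  qed (use c(2,5) \<sigma> W(5) inv in \<open>auto simp: v_def T_def\<close>)
  then show "\<exists>D. (\<eta> \<circ> f has_derivative D) (at x within S \<inter> f -` V) \<and> D ` L = E" using D by blast
qed

text \<open>The inverse g of \<open>\<phi>\<close> is smooth because locally it equals
  \<open>\<pi> \<circ> \<sigma>\<close> for a section \<open>\<sigma>\<close> of f. Smoothness of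
  \<open>\<phi>\<close> follows from that of g by \<open>smooth_on_inverse\<close>, which needs
  surjective derivatives, models of equal dimension, and the continuity of \<open>\<phi>\<close>
  that the quotient topology provides.\<close>

lemma quotient_diffeomorphism:
  fixes Q :: "('q, 'c::euclidean_space) manifold"
  assumes Q: "quotient_manifold (open_submanifold L S) \<pi> Q"
    and \<phi>: "\<And>P. P \<in> S \<Longrightarrow> \<phi> (\<pi> P) = f P" "inj_on \<phi> (\<pi> ` S)"
  shows "diffeomorphism Q (submanifold E H) \<phi>"
proof -
  let ?N = "submanifold E H"
  define g where "g = inv_into (points Q) \<phi>"
  have topM: "space_top (open_submanifold L S) = top_of_set S" and topN: "space_top ?N = top_of_set H"
    and modN: "model ?N = E"
    by (simp_all add: open_submanifold_def submanifold_def)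
  have Qm: "smooth_manifold Q" and q\<pi>: "quotient_map (top_of_set S) (space_top Q) \<pi>"
    and sub: "smooth_submersion (open_submanifold L S) Q \<pi>"
    using Q unfolding quotient_manifold_def topM by blast+
  have E': "subspace (model Q)" using Qm by (simp add: smooth_manifold_def)
  have pts: "points Q = \<pi> ` S" using q\<pi> by (simp add: quotient_map_def)
  have gf: "g (f P) = \<pi> P" if "P \<in> S" for P
    using \<phi>(1)[OF that] that unfolding g_def pts by (metis \<phi>(2) imageI inv_into_f_f)
  have bij: "bij_betw \<phi> (points Q) H"
    unfolding bij_betw_def pts using \<phi> f_image by (auto simp: image_iff)
  have gH: "g K \<in> points Q" if "K \<in> H" for K
    unfolding g_def using bij that by (metis bij_betw_imp_surj_on inv_into_into)
  have \<phi>H: "\<phi> q \<in> H" if "q \<in> points Q" for q using bij that bij_betwE by blast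
  have \<phi>g: "\<phi> (g K) = K" if "K \<in> H" for K
    unfolding g_def using bij that by (metis bij_betw_imp_surj_on f_inv_into_f)
  have g\<phi>: "g (\<phi> q) = q" if "q \<in> points Q" for q
    unfolding g_def using bij that by (metis bij_betw_imp_inj_on inv_into_f_f)
  have cont\<phi>: "continuous_map (space_top Q) (top_of_set H) \<phi>"
  proof -
    have "continuous_map (top_of_set S) (top_of_set H) (\<phi> \<circ> \<pi>)"
      by (rule continuous_map_eq[OF continuous_f]) (simp add: \<phi>(1))
    then show ?thesis using continuous_compose_quotient_map_eq[OF q\<pi>] by blast
  qed
  have contg: "continuous_map (top_of_set H) (space_top Q) g"
  proof -
    have "continuous_map (top_of_set S) (space_top Q) (g \<circ> f)"
      by (rule continuous_map_eq[OF quotient_imp_continuous_map[OF q\<pi>]]) (simp add: gf)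
    then show ?thesis using continuous_compose_quotient_map_eq[OF quotient_map_f] by blast
  qed
  have id_chart: "(S, \<lambda>x. x) \<in> atlas (open_submanifold L S)" by (simp add: open_submanifold_def)
  have inv_id: "inv_into S (\<lambda>x. x) x = x" if "x \<in> S" for x
    using inv_into_f_f[of "\<lambda>x. x" S x] that by simp
  have \<pi>sm: "smooth_on (S \<inter> \<pi> -` V) (\<eta> \<circ> \<pi>)"
    and \<pi>D: "\<forall>x\<in>S \<inter> \<pi> -` V. \<exists>D. (\<eta> \<circ> \<pi> has_derivative D) (at x within S \<inter> \<pi> -` V) \<and> D ` L = model Q"
    if V: "(V, \<eta>) \<in> atlas Q" for V \<eta>
  proof -
    have "smooth_map (open_submanifold L S) Q \<pi>" using sub by (simp add: smooth_submersion_def)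
    then have "smooth_on ((\<lambda>x. x) ` (S \<inter> \<pi> -` V)) (\<eta> \<circ> \<pi> \<circ> inv_into S (\<lambda>x. x))"
      using id_chart V unfolding smooth_map_def by fast
    then show "smooth_on (S \<inter> \<pi> -` V) (\<eta> \<circ> \<pi>)"
      by (simp add: image_ident) (erule smooth_on_eq, simp add: inv_id)
    have "\<forall>x\<in>(\<lambda>x. x) ` (S \<inter> \<pi> -` V). \<exists>D. (\<eta> \<circ> \<pi> \<circ> inv_into S (\<lambda>x. x) has_derivative D)
        (at x within (\<lambda>x. x) ` (S \<inter> \<pi> -` V)) \<and> D ` model (open_submanifold L S) = model Q"
      using sub id_chart V unfolding smooth_submersion_def by fast
    then have *: "\<forall>x\<in>S \<inter> \<pi> -` V. \<exists>D. (\<eta> \<circ> \<pi> \<circ> inv_into S (\<lambda>x. x) has_derivative D) (at x within S \<inter> \<pi> -` V) \<and> D ` L = model Q"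
      by (simp add: open_submanifold_def)
    show "\<forall>x\<in>S \<inter> \<pi> -` V. \<exists>D. (\<eta> \<circ> \<pi> has_derivative D) (at x within S \<inter> \<pi> -` V) \<and> D ` L = model Q"
    proof
      fix x assume x: "x \<in> S \<inter> \<pi> -` V"
      then obtain D where D: "(\<eta> \<circ> \<pi> \<circ> inv_into S (\<lambda>x. x) has_derivative D) (at x within S \<inter> \<pi> -` V)" "D ` L = model Q"
        using * by blast
      have "(\<eta> \<circ> \<pi> has_derivative D) (at x within S \<inter> \<pi> -` V)"
        by (rule has_derivative_transform[OF x _ D(1)]) (simp add: inv_id)
      then show "\<exists>D. (\<eta> \<circ> \<pi> has_derivative D) (at x within S \<inter> \<pi> -` V) \<and> D ` L = model Q"
        using D(2) by blast
    qed
  qed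
  have chartQ: "topological_chart Q V \<eta>" if "(V, \<eta>) \<in> atlas Q" for V \<eta>
    using Qm that unfolding smooth_manifold_def by fast
  have chartN: "topological_chart ?N U \<psi>" if "(U, \<psi>) \<in> atlas ?N" for U \<psi>
    using N that unfolding smooth_manifold_def by fast
  have VQ: "V \<subseteq> points Q" if "(V, \<eta>) \<in> atlas Q" for V \<eta>
    using chartQ[OF that] openin_subset by (auto simp: topological_chart_def)
  have gsm: "smooth_on (\<psi> ` (U \<inter> g -` V)) (\<eta> \<circ> g \<circ> inv_into U \<psi>)"
    if U: "(U, \<psi>) \<in> atlas ?N" and V: "(V, \<eta>) \<in> atlas Q" for U \<psi> V \<eta>
  proof -
    note c = chart_submanifold[OF U]
    have g1: "smooth_on (U \<inter> g -` V) (\<lambda>K. \<eta> (g K))"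
    proof (rule smooth_on_local)
      fix K assume K: "K \<in> U \<inter> g -` V"
      then obtain P where P: "P \<in> S" "f P = K" using c(2) f_image by blast
      obtain W \<sigma> where W: "open W" "K \<in> W" "smooth_on (H \<inter> W) \<sigma>" "\<sigma> ` (H \<inter> W) \<subseteq> S"
        "\<forall>K\<in>H \<inter> W. f (\<sigma> K) = K"
        using local_section[OF P(1)] P(2) by metis
      have \<sigma>: "\<sigma> K \<in> S" "\<pi> (\<sigma> K) = g K" if "K \<in> U \<inter> g -` V \<inter> W" for K
      proof -
        have "K \<in> H \<inter> W" using that c(2) by blast
        then show "\<sigma> K \<in> S" "\<pi> (\<sigma> K) = g K" using W(4,5) gf[of "\<sigma> K"] by auto
      qed
      have "smooth_on (U \<inter> g -` V \<inter> W) (\<lambda>K. (\<eta> \<circ> \<pi>) (\<sigma> K))"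
        by (rule smooth_on_compose[OF smooth_on_subset[OF W(3)] \<pi>sm[OF V]]) (use \<sigma> c(2) in auto)
      then have "smooth_on (U \<inter> g -` V \<inter> W) (\<lambda>K. \<eta> (g K))"
        by (rule smooth_on_eq) (simp add: \<sigma>)
      then show "\<exists>W. open W \<and> K \<in> W \<and> smooth_on (U \<inter> g -` V \<inter> W) (\<lambda>K. \<eta> (g K))"
        using W by blast
    qed
    have "smooth_on (\<psi> ` (U \<inter> g -` V)) (\<lambda>y. \<eta> (g (inv_into U \<psi> y)))"
      by (rule smooth_on_compose[OF smooth_on_subset[OF c(7)] g1]) (use c(3) in auto)
    then show ?thesis by (simp add: o_def)
  qed
  have smg: "smooth_map ?N Q g"
    unfolding smooth_map_def topN using N Qm contg gsm by blast
  have \<phi>sm: "smooth_on (\<eta> ` (V \<inter> \<phi> -` U)) (\<psi> \<circ> \<phi> \<circ> inv_into V \<eta>)"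
    if U: "(U, \<psi>) \<in> atlas ?N" and V: "(V, \<eta>) \<in> atlas Q" for U \<psi> V \<eta>
  proof -
    note c = chart_submanifold[OF U]
    note tN = chartN[OF U] and tQ = chartQ[OF V]
    have inj\<eta>: "inj_on \<eta> V" using topological_chart_inj_on[OF tQ] .
    have VQ: "V \<subseteq> points Q" "openin (space_top Q) V"
      using VQ[OF V] tQ by (auto simp: topological_chart_def)
    define S' where "S' = \<psi> ` (U \<inter> g -` V)"
    define T where "T = \<eta> ` (V \<inter> \<phi> -` U)"
    define G where "G = \<eta> \<circ> g \<circ> inv_into U \<psi>"
    define h where "h = \<psi> \<circ> \<phi> \<circ> inv_into V \<eta>"
    have "U \<inter> g -` V = {K \<in> U. g K \<in> V}" by auto
    then have "openin (top_of_set H) (U \<inter> g -` V)"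
      using openin_continuous_map_preimage_gen[OF contg c(1) VQ(2)] by simp
    then have oS: "openin (top_of_set E) S'"
      using topological_chart_open_image[OF tN] unfolding S'_def topN modN by blast
    have "V \<inter> \<phi> -` U = {q \<in> V. \<phi> q \<in> U}" by auto
    then have "openin (space_top Q) (V \<inter> \<phi> -` U)"
      using openin_continuous_map_preimage_gen[OF cont\<phi> VQ(2) c(1)] by simp
    then have oT: "openin (top_of_set (model Q)) T"
      using topological_chart_open_image[OF tQ] unfolding T_def by blast
    have GS: "G (\<psi> K) = \<eta> (g K)" if "K \<in> U" for K using that c(3) by (simp add: G_def)
    have hT: "h (\<eta> q) = \<psi> (\<phi> q)" if "q \<in> V" for q using that inj\<eta> by (simp add: h_def)
    have GST: "G ` S' \<subseteq> T" using GS \<phi>g c(2) by (auto simp: S'_def T_def subset_iff)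
    have hTS: "h ` T \<subseteq> S'" using hT g\<phi> VQ(1) by (auto simp: S'_def T_def subset_iff)
    have Gh: "G (h y) = y" if "y \<in> T" for y
      using that GS hT g\<phi> VQ(1) by (auto simp: T_def subset_iff)
    have hG: "h (G x) = x" if "x \<in> S'" for x
      using that GS hT \<phi>g c(2) by (auto simp: S'_def subset_iff)
    have smG: "smooth_on S' G" using gsm[OF U V] by (simp add: S'_def G_def)
    have conth: "continuous_on T h"
    proof -
      have 1: "continuous_map (top_of_set T) (space_top Q) (inv_into V \<eta>)"
        using topological_chart_continuous_map(2)[OF tQ] continuous_map_in_subtopology
          continuous_map_from_subtopology_mono[of euclidean "\<eta> ` V" "space_top Q" "inv_into V \<eta>" T]
        by (metis T_def image_mono inf_le1)
      have 2: "continuous_map (top_of_set T) (top_of_set U) (\<lambda>y. \<phi> (inv_into V \<eta> y))"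
        using continuous_map_compose[OF 1 cont\<phi>] inj\<eta>
        by (auto simp: continuous_map_in_subtopology o_def T_def)
      have 3: "continuous_map (top_of_set U) euclidean \<psi>"
        using smooth_on_imp_continuous_on[OF c(6)] by simp
      show ?thesis using continuous_map_compose[OF 2 3] by (simp add: h_def o_def)
    qed
    \<comment> \<open>Invariance of domain, applied to G and to its inverse h, compares the two
      models as soon as the charts meet.\<close>
    have dim: "dim E = dim (model Q)" if "T \<noteq> {}"
    proof (rule antisym)
      have S0: "S' \<noteq> {}" using hTS that by blast
      have iG: "inj_on G S'" by (rule inj_on_inverseI[of _ h]) (rule hG)
      have ih: "inj_on h T" by (rule inj_on_inverseI[of _ G]) (rule Gh)
      show "dim E \<le> dim (model Q)"
        by (rule invariance_of_dimension_subspaces[OF oS E E' smooth_on_imp_continuous_on[OF smG] _ iG S0])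
          (use GST openin_imp_subset[OF oT] in blast)
      show "dim (model Q) \<le> dim E"
        by (rule invariance_of_dimension_subspaces[OF oT E' E conth _ ih that])
          (use hTS openin_imp_subset[OF oS] in blast)
    qed
    have onto: "\<exists>D. (G has_derivative D) (at x within S') \<and> D ` E = model Q" if x: "x \<in> S'" for x
    proof -
      obtain K where K: "K \<in> U" "g K \<in> V" "x = \<psi> K" using x by (auto simp: S'_def)
      obtain P where P: "P \<in> S" "f P = K" using K c(2) f_image by blast
      have \<pi>P: "\<pi> P \<in> V" using gf[OF P(1)] P(2) K(2) by simp
      obtain D1 where D1: "(\<eta> \<circ> \<pi> has_derivative D1) (at P within S \<inter> \<pi> -` V)" "D1 ` L = model Q"
        using \<pi>D[OF V] P(1) \<pi>P by blast
      obtain D2 where D2: "(\<psi> \<circ> f has_derivative D2) (at P within S \<inter> f -` U)" "D2 ` L = E"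
        using chart_submersion(2)[OF U, of P] P K by blast
      obtain D3 where D3: "(G has_derivative D3) (at x within S')"
        using smooth_on_has_derivative[OF smG x] .
      define S0 where "S0 = (S \<inter> \<pi> -` V) \<inter> (S \<inter> f -` U)"
      have "S \<inter> \<pi> -` V = {P \<in> topspace (top_of_set S). \<pi> P \<in> V}" by auto
      then have "openin (top_of_set S) (S \<inter> \<pi> -` V)"
        using openin_continuous_map_preimage[OF quotient_imp_continuous_map[OF q\<pi>] VQ(2)] by simp
      then have oS0: "openin (top_of_set L) S0"
        unfolding S0_def using openin_trans[OF _ S] open_preimage[OF c(1)] by blast
      have PS0: "P \<in> S0" using P K \<pi>P by (auto simp: S0_def)
      have im: "(\<psi> \<circ> f) ` S0 \<subseteq> S'"
        using gf by (auto simp: S0_def S'_def)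
      have a: "(\<psi> \<circ> f has_derivative D2) (at P within S0)"
        by (rule has_derivative_subset[OF D2(1)]) (auto simp: S0_def)
      have b: "(G has_derivative D3) (at ((\<psi> \<circ> f) P) within (\<psi> \<circ> f) ` S0)"
        using has_derivative_subset[OF D3 im] P K by simp
      have "((\<lambda>z. G ((\<psi> \<circ> f) z)) has_derivative (\<lambda>v. D3 (D2 v))) (at P within S0)"
        by (rule has_derivative_in_compose[OF a b])
      moreover have "(\<eta> \<circ> \<pi> has_derivative D1) (at P within S0)"
        by (rule has_derivative_subset[OF D1(1)]) (auto simp: S0_def)
      moreover have "G ((\<psi> \<circ> f) z) = (\<eta> \<circ> \<pi>) z" if "z \<in> S0" for z
        using that GS gf by (auto simp: S0_def)
      \<comment> \<open>By the chain rule \<open>D3\<close> after \<open>D2\<close> is the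
        derivative of \<open>\<eta> \<circ> \<pi>\<close>, which maps L onto the model of Q;
        therefore \<open>D3\<close> maps E onto it.\<close>
      ultimately have eq: "D3 (D2 v) = D1 v" if "v \<in> L" for v
        using has_derivative_within_subspace_unique[OF L oS0 PS0 _ _ _ that] by blast
      have "D3 ` E = model Q"
      proof
        show "D3 ` E \<subseteq> model Q"
          using has_derivative_within_subspace_range[OF E oS x D3 E'] GST openin_imp_subset[OF oT] by blast
        show "model Q \<subseteq> D3 ` E"
        proof
          fix w assume "w \<in> model Q"
          then obtain v where v: "v \<in> L" "w = D1 v" using D1(2) by blast
          then show "w \<in> D3 ` E" using eq D2(2) by (metis imageI)
        qed
      qed
      then show ?thesis using D3 by blast
    qed
    have "smooth_on T h" if "T \<noteq> {}"
      by (rule smooth_on_inverse[OF E oS E' oT dim[OF that] smG GST onto conth hTS Gh])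
    then have "smooth_on T h" by (cases "T = {}") (auto simp: smooth_on_def)
    then show ?thesis by (simp add: T_def h_def)
  qed
  have "smooth_map Q ?N \<phi>"
    unfolding smooth_map_def topN using N Qm cont\<phi> \<phi>sm by blast
  then show ?thesis
    unfolding diffeomorphism_def using bij smg by (simp add: g_def topN)
qed

text \<open>Carries the structure of H over to the set of classes by the bijection g that f and
  \<open>\<pi>\<close> induce. The chart values must move as well, into another type, and the bound
  on \<open>dim E\<close> leaves room there for an isometric copy E' of E.\<close>

lemma quotient_manifold_exists:
  fixes \<pi> :: "'p \<Rightarrow> 'q"
  assumes \<pi>: "\<And>P P'. P \<in> S \<Longrightarrow> P' \<in> S \<Longrightarrow> \<pi> P = \<pi> P' \<longleftrightarrow> f P = f P'"
    and dim: "dim E \<le> DIM('c::euclidean_space)"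
  shows "\<exists>Q :: ('q, 'c) manifold. quotient_manifold (open_submanifold L S) \<pi> Q"
proof -
  let ?N = "submanifold E H"
  obtain E' :: "'c set" where E': "subspace E'" "dim E' = dim E"
    using choose_subspace_of_subspace[of "dim E" "UNIV :: 'c set"] dim by auto
  obtain i :: "'k \<Rightarrow> 'c" and j where i: "linear i" "i ` E = E'" and j: "linear j" "j ` E' = E"
    and ji: "\<And>x. x \<in> E \<Longrightarrow> j (i x) = x" and ij: "\<And>x. x \<in> E' \<Longrightarrow> i (j x) = x"
    using isometries_subspaces[OF E E'(1)] E'(2) by metis
  \<comment> \<open>The chosen preimage does not matter, since by assumption \<open>\<pi>\<close> is
    constant on the fibres of f.\<close>
  define g where "g K = \<pi> (inv_into S f K)" for K
  have gf: "g (f P) = \<pi> P" if "P \<in> S" for P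
  proof -
    have "inv_into S f (f P) \<in> S" "f (inv_into S f (f P)) = f P"
      using that by (auto simp: inv_into_into f_inv_into_f)
    then show ?thesis using \<pi>[of "inv_into S f (f P)" P] that by (simp add: g_def)
  qed
  have injg: "inj_on g H"
  proof (rule inj_onI)
    fix K K' assume "K \<in> H" "K' \<in> H" "g K = g K'"
    then show "K = K'" unfolding f_image[symmetric] using gf \<pi> by auto
  qed
  define \<phi> where "\<phi> = inv_into H g"
  have \<phi>g: "\<phi> (g K) = K" if "K \<in> H" for K using injg that by (simp add: \<phi>_def)
  \<comment> \<open>Pulling back the topology along \<open>\<phi>\<close> makes g a homeomorphism,
    so that \<open>\<pi>\<close>, which is g after f on S, inherits from f the property of being a
    quotient map.\<close>
  define X where "X = pullback_topology (g ` H) \<phi> (top_of_set H)"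
  define tr where "tr = (\<lambda>(U, \<psi>). (g ` U, \<lambda>q. i (\<psi> (\<phi> q))))"
  define Q where "Q = \<lparr>space_top = X, model = E', atlas = tr ` atlas ?N\<rparr>"
  have topX: "topspace X = g ` H"
    unfolding X_def topspace_pullback_topology using \<phi>g by auto
  have topM: "space_top (open_submanifold L S) = top_of_set S" by (simp add: open_submanifold_def)
  have homeo: "homeomorphic_maps X (top_of_set H) \<phi> g"
    unfolding homeomorphic_maps_def
  proof (intro conjI ballI)
    have "continuous_map X (top_of_set H) (id \<circ> \<phi>)" unfolding X_def by (rule continuous_map_pullback) simp
    then show "continuous_map X (top_of_set H) \<phi>" by simp
    have "continuous_map (top_of_set H) (top_of_set H) (\<phi> \<circ> g)"
      by (rule continuous_map_eq[of _ _ "\<lambda>x. x"]) (auto simp: \<phi>g)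
    then show "continuous_map (top_of_set H) X g" unfolding X_def by (rule continuous_map_pullback') auto
  qed (auto simp: topX \<phi>g)
  then have hX: "homeomorphic_map X (top_of_set H) \<phi>" by (rule homeomorphic_maps_imp_map)
  have hg: "homeomorphic_map (top_of_set H) X g"
    using homeo homeomorphic_maps_sym homeomorphic_maps_imp_map by blast
  have hs: "X homeomorphic_space top_of_set H" using homeo homeomorphic_space_def by blast
  have hi: "homeomorphic_map (top_of_set E) (top_of_set E') i"
    by (rule homeomorphic_maps_imp_map[of _ _ _ j])
      (use i j ji ij in \<open>auto simp: homeomorphic_maps_def continuous_map_in_subtopology
        linear_continuous_on linear_conv_bounded_linear\<close>)
  have tr_chart: "topological_chart Q (g ` U) (\<lambda>q. i (\<psi> (\<phi> q)))" if U: "(U, \<psi>) \<in> atlas ?N" for U \<psi>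
  proof -
    note c = chart_submanifold[OF U]
    have im: "(\<lambda>q. i (\<psi> (\<phi> q))) ` g ` U = i ` \<psi> ` U"
      using \<phi>g c(2) by (auto simp: image_image subset_iff intro!: image_cong)
    have o1: "openin X (g ` U)" using homeomorphic_map_openness_eq[OF hg] c(1) by blast
    have o2: "openin (top_of_set E') (i ` \<psi> ` U)"
      using homeomorphic_map_openness_eq[OF hi] c(4) by blast
    have \<phi>gU: "\<phi> ` g ` U = U" using \<phi>g c(2) by (auto simp: image_image subset_iff)
    have gU: "g ` H \<inter> g ` U = g ` U" using c(2) by auto
    have HU: "H \<inter> U = U" and EU: "E \<inter> \<psi> ` U = \<psi> ` U" "E' \<inter> i ` \<psi> ` U = i ` \<psi> ` U"
      using c(2,5) i(2) by auto
    have h1: "homeomorphic_map (subtopology X (g ` U)) (top_of_set U) \<phi>"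
      using homeomorphic_map_subtopologies[OF hX, of "g ` U" U] \<phi>gU HU
      by (simp add: topX gU subtopology_subtopology)
    have h2: "homeomorphic_map (top_of_set U) (top_of_set (\<psi> ` U)) \<psi>"
      using c by (intro homeomorphic_map_top_of_set smooth_on_imp_continuous_on)
    have h3: "homeomorphic_map (top_of_set (\<psi> ` U)) (top_of_set (i ` \<psi> ` U)) i"
      using homeomorphic_map_subtopologies[OF hi, of "\<psi> ` U" "i ` \<psi> ` U"] EU
      by (simp add: subtopology_subtopology)
    have "homeomorphic_map (subtopology X (g ` U)) (top_of_set (i ` \<psi> ` U)) (i \<circ> (\<psi> \<circ> \<phi>))"
      by (rule homeomorphic_map_compose[OF homeomorphic_map_compose[OF h1 h2] h3])
    then show ?thesis unfolding topological_chart_def im using o1 o2 by (simp add: Q_def o_def)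
  qed
  have tr_inv: "inv_into (g ` U) (\<lambda>q. i (\<psi> (\<phi> q))) (i y) = g (inv_into U \<psi> y)"
    if U: "(U, \<psi>) \<in> atlas ?N" and y: "y \<in> \<psi> ` U" for U \<psi> y
  proof -
    note c = chart_submanifold[OF U]
    obtain K where K: "K \<in> U" "y = \<psi> K" using y by blast
    have "inv_into (g ` U) (\<lambda>q. i (\<psi> (\<phi> q))) (i (\<psi> (\<phi> (g K)))) = g K"
      by (rule inv_into_f_f[OF topological_chart_inj_on[OF tr_chart[OF U]]]) (use K in auto)
    then show ?thesis using K c(2,3) \<phi>g by (simp add: subset_iff)
  qed
  have smQ: "smooth_manifold Q"
    unfolding smooth_manifold_def
  proof (intro conjI)
    show "subspace (model Q)" using E' by (simp add: Q_def)
    show "Hausdorff_space (space_top Q)"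
      using homeomorphic_Hausdorff_space[OF hs] by (simp add: Q_def Hausdorff_space_subtopology)
    show "second_countable (space_top Q)"
      using homeomorphic_space_second_countability[OF hs]
      by (simp add: Q_def second_countable_subtopology second_countable_euclidean)
    show "\<forall>(U, \<psi>)\<in>atlas Q. topological_chart Q U \<psi>"
      using tr_chart by (auto simp: Q_def tr_def)
    have "(\<Union>(U, \<psi>)\<in>atlas ?N. U) = H" using N by (simp add: smooth_manifold_def submanifold_def)
    then have "g ` H = g ` (\<Union>(U, \<psi>)\<in>atlas ?N. U)" by (rule arg_cong[OF sym])
    also have "\<dots> = (\<Union>(U, \<psi>)\<in>atlas ?N. g ` U)" by (simp add: image_UN split_def)
    finally have "g ` H = (\<Union>(U, \<psi>)\<in>atlas ?N. g ` U)" .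
    then show "(\<Union>(U, \<psi>)\<in>atlas Q. U) = points Q"
      by (simp add: Q_def tr_def topX split_def)
    show "\<forall>(U, \<psi>)\<in>atlas Q. \<forall>(V, \<eta>)\<in>atlas Q. smooth_on (\<psi> ` (U \<inter> V)) (\<eta> \<circ> inv_into U \<psi>)"
    proof clarify
      fix U' \<psi>' V' \<eta>' assume "(U', \<psi>') \<in> atlas Q" "(V', \<eta>') \<in> atlas Q"
      then obtain U \<psi> V \<eta> where UV: "(U, \<psi>) \<in> atlas ?N" "(V, \<eta>) \<in> atlas ?N"
        "U' = g ` U" "\<psi>' = (\<lambda>q. i (\<psi> (\<phi> q)))" "V' = g ` V" "\<eta>' = (\<lambda>q. i (\<eta> (\<phi> q)))"
        by (auto simp: Q_def tr_def)
      note c = chart_submanifold[OF UV(1)] and d = chart_submanifold[OF UV(2)]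
      have "U' \<inter> V' = g ` (U \<inter> V)"
        unfolding UV by (rule inj_on_image_Int[OF injg c(2) d(2), symmetric])
      then have dom: "\<psi>' ` (U' \<inter> V') = i ` \<psi> ` (U \<inter> V)"
        using \<phi>g c(2) unfolding UV(4) image_image by (auto simp: image_image subset_iff intro!: image_cong)
      have 1: "smooth_on (i ` \<psi> ` (U \<inter> V)) j" by (rule smooth_on_linear[OF j(1)])
      have 2: "smooth_on (\<psi> ` (U \<inter> V)) (\<eta> \<circ> inv_into U \<psi>)"
        using N UV(1,2) unfolding smooth_manifold_def by fast
      have jE: "j (i y) = y" if "y \<in> \<psi> ` U" for y using ji that c(5) by blast
      have "smooth_on (i ` \<psi> ` (U \<inter> V)) (\<lambda>y. i ((\<eta> \<circ> inv_into U \<psi>) (j y)))"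
        by (rule smooth_on_compose[OF smooth_on_compose[OF 1 2] smooth_on_linear[OF i(1), of UNIV]])
          (use jE in auto)
      then show "smooth_on (\<psi>' ` (U' \<inter> V')) (\<eta>' \<circ> inv_into U' \<psi>')"
        unfolding dom
      proof (rule smooth_on_eq)
        fix y assume "y \<in> i ` \<psi> ` (U \<inter> V)"
        then obtain K where K: "K \<in> U" "K \<in> V" "y = i (\<psi> K)" by blast
        have "(\<eta>' \<circ> inv_into U' \<psi>') y = i (\<eta> (\<phi> (g (inv_into U \<psi> (\<psi> K)))))"
          using tr_inv[OF UV(1), of "\<psi> K"] K by (simp add: UV)
        then show "i ((\<eta> \<circ> inv_into U \<psi>) (j y)) = (\<eta>' \<circ> inv_into U' \<psi>') y"
          using K c(2,3) \<phi>g jE by (simp add: subset_iff)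
      qed
    qed
  qed
  have quot: "quotient_map (top_of_set S) X \<pi>"
    by (rule quotient_map_eq[OF quotient_map_compose[OF quotient_map_f hg[unfolded homeomorphic_map_def, THEN conjunct1]]])
      (simp add: gf)
  have id: "(\<lambda>x. x) ` Z = Z" for Z :: "'p set" by simp
  have inv_id: "inv_into S (\<lambda>x. x) x = x" if "x \<in> S" for x
    using inv_into_f_f[of "\<lambda>x. x" S x] that by simp
  have sub: "smooth_on (S \<inter> \<pi> -` V') (\<eta>' \<circ> \<pi> \<circ> inv_into S (\<lambda>x. x)) \<and>
     (\<forall>x\<in>S \<inter> \<pi> -` V'. \<exists>D. (\<eta>' \<circ> \<pi> \<circ> inv_into S (\<lambda>x. x) has_derivative D) (at x within S \<inter> \<pi> -` V') \<and> D ` L = E')"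
    if "(V', \<eta>') \<in> atlas Q" for V' \<eta>'
  proof -
    obtain V \<eta> where V: "(V, \<eta>) \<in> atlas ?N" "V' = g ` V" "\<eta>' = (\<lambda>q. i (\<eta> (\<phi> q)))"
      using \<open>(V', \<eta>') \<in> atlas Q\<close> by (auto simp: Q_def tr_def)
    have VH: "V \<subseteq> H" using chart_submanifold[OF V(1)] by blast
    have "g (f x) \<in> g ` V \<longleftrightarrow> f x \<in> V" if "x \<in> S" for x
      using inj_on_image_mem_iff[OF injg _ VH] f_image that by blast
    then have dom: "S \<inter> \<pi> -` V' = S \<inter> f -` V" using gf V(2) by auto
    have eq: "(\<eta>' \<circ> \<pi> \<circ> inv_into S (\<lambda>x. x)) x = i ((\<eta> \<circ> f) x)" if "x \<in> S \<inter> f -` V" for x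
      using that gf[of x] \<phi>g[of "f x"] VH by (auto simp: V(3) inv_id)
    have "smooth_on (S \<inter> f -` V) (\<lambda>x. i ((\<eta> \<circ> f) x))"
      by (rule smooth_on_compose[OF chart_submersion(1)[OF V(1)] smooth_on_linear[OF i(1), of UNIV]]) simp
    then have s: "smooth_on (S \<inter> f -` V) (\<eta>' \<circ> \<pi> \<circ> inv_into S (\<lambda>x. x))"
      by (rule smooth_on_eq) (simp only: eq)
    have d: "\<exists>D. (\<eta>' \<circ> \<pi> \<circ> inv_into S (\<lambda>x. x) has_derivative D) (at x within S \<inter> f -` V) \<and> D ` L = E'"
      if x: "x \<in> S \<inter> f -` V" for x
    proof -
      obtain D where D: "(\<eta> \<circ> f has_derivative D) (at x within S \<inter> f -` V)" "D ` L = E"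
        using chart_submersion(2)[OF V(1) x] by blast
      have Di: "((\<lambda>x. i ((\<eta> \<circ> f) x)) has_derivative (\<lambda>v. i (D v))) (at x within S \<inter> f -` V)"
        using bounded_linear.has_derivative[OF _ D(1)] i(1) linear_conv_bounded_linear by blast
      have "(\<eta>' \<circ> \<pi> \<circ> inv_into S (\<lambda>x. x) has_derivative (\<lambda>v. i (D v))) (at x within S \<inter> f -` V)"
        by (rule has_derivative_transform[OF x _ Di]) (rule eq)
      moreover have "(\<lambda>v. i (D v)) ` L = E'" using D(2) i(2) by (metis image_image)
      ultimately show ?thesis by blast
    qed
    show ?thesis unfolding dom using s d by blast
  qed
  have M: "smooth_manifold (open_submanifold L S)" by (rule smooth_manifold_open_submanifold[OF L S])
  have "smooth_map (open_submanifold L S) Q \<pi>"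
    unfolding smooth_map_def
    using M smQ quotient_imp_continuous_map[OF quot] sub
    by (simp add: open_submanifold_def split_beta) (simp add: Q_def)
  then have "smooth_submersion (open_submanifold L S) Q \<pi>"
    unfolding smooth_submersion_def using sub
    by (simp add: open_submanifold_def split_beta) (simp add: Q_def)
  then have "quotient_manifold (open_submanifold L S) \<pi> Q"
    unfolding quotient_manifold_def topM using smQ quot by (simp add: Q_def)
  then show ?thesis by blast
qed

end

section \<open>Linear equations with kernels of constant dimension\<close>

text \<open>Abstracts the equation \<open>P ** A = (F + G1 ** K) ** P\<close>, with GL the
  invertible matrices. Kernel elements outside GL must lie in L too, because the whole kernel is
  split off from L to obtain the model of a chart. \<open>dim_L\<close> leaves room for a common
  model in the space of feedbacks.\<close>

locale linear_equation_family =
  fixes T :: "'k::euclidean_space \<Rightarrow> 'p::euclidean_space \<Rightarrow> 'q::euclidean_space"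
    and L GL :: "'p set" and f :: "'p \<Rightarrow> 'k" and d :: nat
  assumes linear_T: "\<And>K. linear (T K)" and Ck_T: "\<And>k P. Ck_on k UNIV (\<lambda>K. T K P)"
    and subspace_L: "subspace L" and open_GL: "open GL" and smooth_f: "smooth_on GL f"
    and kernel_subset: "\<And>K P. T K P = 0 \<Longrightarrow> P \<in> L"
    and kernel_GL: "\<And>K P. P \<in> GL \<Longrightarrow> T K P = 0 \<longleftrightarrow> P \<in> L \<and> K = f P"
    and dim_kernel: "\<And>P. P \<in> L \<inter> GL \<Longrightarrow> dim {X. T (f P) X = 0} = d"
    and dim_L: "dim L \<le> DIM('k)"
begin

abbreviation "S \<equiv> L \<inter> GL"
abbreviation "H \<equiv> f ` S"

lemma subspace_kernel: "subspace {X. T K X = 0}"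
  using linear_subspace_kernel[OF linear_T] .

text \<open>Near \<open>f P\<^sub>0\<close> the kernels of \<open>T K\<close> with \<open>K \<in> H\<close> have constant dimension, so they project
  isomorphically onto the kernel at \<open>f P\<^sub>0\<close>; \<open>\<sigma> K\<close> is the kernel element that projects onto \<open>P\<^sub>0\<close>.\<close>

lemma normalized_section:
  assumes P0: "P0 \<in> S"
  obtains p W \<sigma> where "linear p" "\<And>x. p x \<in> {X. T (f P0) X = 0}"
    "\<And>x y. T (f P0) y = 0 \<Longrightarrow> (x - p x) \<bullet> y = 0" "p P0 = P0" "open W" "f P0 \<in> W" "smooth_on W \<sigma>"
    "\<And>K. K \<in> H \<inter> W \<Longrightarrow> \<sigma> K \<in> S \<and> f (\<sigma> K) = K \<and> p (\<sigma> K) = P0"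
    "\<And>K X. K \<in> W \<Longrightarrow> T K X = 0 \<Longrightarrow> p X = P0 \<Longrightarrow> X = \<sigma> K"
proof -
  define N0 where "N0 = {X. T (f P0) X = 0}"
  obtain p where p: "linear p" "\<And>x. p x \<in> N0" "\<And>x. x \<in> N0 \<Longrightarrow> p x = x" "\<And>x y. y \<in> N0 \<Longrightarrow> (x - p x) \<bullet> y = 0"
    using orthogonal_projection_exists[of N0] subspace_kernel unfolding N0_def by metis
  have P0N: "P0 \<in> N0" using kernel_GL[of P0 "f P0"] P0 by (simp add: N0_def)
  \<comment> \<open>The adjoint merges the conditions T K P = 0 and p P = P0 into one square system.
    At K = f P0 it is positive definite, since the inner product of P with its image is |T P|^2 + |p
    P|^2, so it stays injective nearby. Its solution \<open>\<sigma> K\<close> exists also for K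
    outside H, where it need not be in the kernel.\<close>
  define \<Phi> where "\<Phi> K P = adjoint (T (f P0)) (T K P) + p P" for K P
  have adj: "linear (adjoint (T (f P0)))" using linear_T by (rule adjoint_linear)
  have lin: "linear (\<Phi> K)" for K
    unfolding \<Phi>_def using linear_compose_add[OF linear_compose[OF linear_T adj] p(1)] by (simp add: o_def)
  have Ck: "Ck_on k UNIV (\<lambda>K. \<Phi> K P)" for k P
    unfolding \<Phi>_def
    by (intro Ck_on_add Ck_on_linear[OF _ _ Ck_T] Ck_on_const) (use adj in \<open>auto simp: linear_conv_bounded_linear\<close>)
  define W0 where "W0 = {K \<in> UNIV. inj (\<Phi> K)}"
  have oW0: "open W0" unfolding W0_def
    by (rule open_linear_injective) (use lin Ck[of 0] in auto)
  have inj0: "inj (\<Phi> (f P0))"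
    unfolding linear_injective_0[OF lin]
  proof (intro allI impI)
    fix P assume 0: "\<Phi> (f P0) P = 0"
    have "(P - p P) \<bullet> p P = 0" using p(2,4) by blast
    then have "P \<bullet> \<Phi> (f P0) P = T (f P0) P \<bullet> T (f P0) P + p P \<bullet> p P"
      by (simp add: \<Phi>_def inner_add_right adjoint_works[OF linear_T] inner_diff_left)
    then have "T (f P0) P \<bullet> T (f P0) P + p P \<bullet> p P = 0" using 0 by simp
    then have "T (f P0) P = 0" "p P = 0"
      using inner_ge_zero[of "T (f P0) P"] inner_ge_zero[of "p P"] inner_eq_zero_iff
      by (metis add_nonneg_eq_0_iff)+
    then show "P = 0" using p(3)[of P] by (simp add: N0_def)
  qed
  define \<sigma> where "\<sigma> K = inv (\<Phi> K) P0" for K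
  have \<Phi>\<sigma>: "\<Phi> K (\<sigma> K) = P0" if "K \<in> W0" for K
    unfolding \<sigma>_def using that surj_f_inv_f[OF linear_injective_imp_surjective[OF lin]] by (simp add: W0_def)
  have uniq: "X = \<sigma> K" if "K \<in> W0" "T K X = 0" "p X = P0" for K X
  proof -
    have "\<Phi> K X = P0" using that(2,3) linear_0[OF adj] by (simp add: \<Phi>_def)
    then show ?thesis using that(1) \<Phi>\<sigma>[OF that(1)] by (auto simp: W0_def dest: injD)
  qed
  have Ck\<sigma>: "Ck_on k W0 \<sigma>" for k
    by (rule Ck_on_linear_solution[where B = \<Phi> and c = "\<lambda>_. P0"])
      (use oW0 lin \<Phi>\<sigma> Ck_on_subset[OF Ck] Ck_on_const in \<open>auto simp: W0_def\<close>)
  define W where "W = W0 \<inter> \<sigma> -` GL"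
  have oW: "open W" unfolding W_def
    using Ck_on_imp_continuous_on[OF oW0 Ck\<sigma>] oW0 open_GL by (rule continuous_open_preimage)
  have \<sigma>0: "\<sigma> (f P0) = P0"
    using uniq[of "f P0" P0] inj0 P0N p(3) by (simp add: W0_def N0_def)
  show ?thesis
  proof
    show "linear p" "p P0 = P0" "open W" using p P0N oW by auto
    show "p x \<in> {X. T (f P0) X = 0}" for x using p(2) by (simp add: N0_def)
    show "(x - p x) \<bullet> y = 0" if "T (f P0) y = 0" for x y using p(4) that by (simp add: N0_def)
    show "f P0 \<in> W" using inj0 \<sigma>0 P0 by (simp add: W_def W0_def)
    show "smooth_on W \<sigma>" using Ck\<sigma> by (intro smooth_onI_Ck[OF oW0]) (auto simp: W_def)
    show "X = \<sigma> K" if "K \<in> W" "T K X = 0" "p X = P0" for K X using uniq that by (simp add: W_def)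
    fix K assume K: "K \<in> H \<inter> W"
    let ?N = "{X. T K X = 0}"
    have W0: "K \<in> W0" using K by (simp add: W_def)
    \<comment> \<open>On the kernel of \<open>T K\<close> the map \<open>\<Phi> K\<close> reduces to
      p. So p is injective there and, the dimensions being equal, maps this kernel onto
      \<open>N0\<close>; a preimage of P0 solves the square system and hence is
      \<open>\<sigma> K\<close>.\<close>
    have "inj_on p (span ?N)"
      unfolding span_eq_iff[THEN iffD2, OF subspace_kernel]
    proof (rule inj_onI)
      fix X Y assume "X \<in> ?N" "Y \<in> ?N" "p X = p Y"
      then have "\<Phi> K X = \<Phi> K Y" by (simp add: \<Phi>_def)
      then show "X = Y" using W0 by (auto simp: W0_def dest: injD)
    qed
    then have "dim (p ` ?N) = dim ?N" by (rule dim_image_eq[OF p(1)])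
    also have "\<dots> = dim N0" using dim_kernel K P0 by (auto simp: N0_def)
    finally have "p ` ?N = N0"
      using p(2) subspace_kernel linear_subspace_image[OF p(1)]
      by (intro subspace_dim_equal) (auto simp: N0_def)
    then obtain X where X: "T K X = 0" "p X = P0" using P0N by (auto simp: image_iff)
    then have "T K (\<sigma> K) = 0" "p (\<sigma> K) = P0" using uniq[OF W0 X] by auto
    moreover have "\<sigma> K \<in> GL" using K by (simp add: W_def)
    ultimately show "\<sigma> K \<in> S \<and> f (\<sigma> K) = K \<and> p (\<sigma> K) = P0" using kernel_GL[of "\<sigma> K" K] by auto
  qed
qed

text \<open>The chart records the displacement \<open>\<sigma> K - P0\<close>. It is killed by p, so
  it lies in the orthogonal complement E0 of the kernel inside L: near P0 the slice P0 + E0 is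
  mapped by f to H, with inverse \<open>\<sigma>\<close>.\<close>

lemma submanifold_chart:
  assumes P0: "P0 \<in> S" and E: "subspace E" "dim E = dim L - d"
  shows "\<exists>(U, \<psi>)\<in>atlas (submanifold E H). f P0 \<in> U"
proof -
  obtain p W \<sigma> where p: "linear p" "\<And>x. p x \<in> {X. T (f P0) X = 0}"
    "\<And>x y. T (f P0) y = 0 \<Longrightarrow> (x - p x) \<bullet> y = 0" "p P0 = P0"
    and W: "open W" "f P0 \<in> W" "smooth_on W \<sigma>"
    and \<sigma>: "\<And>K. K \<in> H \<inter> W \<Longrightarrow> \<sigma> K \<in> S \<and> f (\<sigma> K) = K \<and> p (\<sigma> K) = P0"
    and uniq: "\<And>K X. K \<in> W \<Longrightarrow> T K X = 0 \<Longrightarrow> p X = P0 \<Longrightarrow> X = \<sigma> K"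
    by (rule normalized_section[OF P0]) (rule that, assumption+)
  let ?N = "{X. T (f P0) X = 0}"
  define E0 where "E0 = {y \<in> L. \<forall>x\<in>?N. orthogonal x y}"
  have NL: "?N \<subseteq> L" using kernel_subset by blast
  have "dim E0 + dim ?N = dim L"
    unfolding E0_def by (rule dim_subspace_orthogonal_to_vectors[OF subspace_kernel subspace_L NL])
  then have dE: "dim E0 = dim E" using E(2) dim_kernel[OF P0] by simp
  have sE0: "subspace E0"
    using subspace_L unfolding E0_def subspace_def orthogonal_def
    by (auto simp: inner_add_right)
  have pE0: "p y = 0 \<longleftrightarrow> (\<forall>x\<in>?N. orthogonal x y)" for y
  proof
    assume "p y = 0"
    then show "\<forall>x\<in>?N. orthogonal x y" using p(3)[of _ y] by (auto simp: orthogonal_def inner_commute)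
  next
    assume "\<forall>x\<in>?N. orthogonal x y"
    then have "p y \<bullet> y = 0" using p(2) by (auto simp: orthogonal_def)
    moreover have "(y - p y) \<bullet> p y = 0" using p(2,3) by blast
    ultimately show "p y = 0" by (simp add: inner_diff_right inner_commute)
  qed
  have E0_iff: "y \<in> E0 \<longleftrightarrow> y \<in> L \<and> p y = 0" for y using pE0 by (simp add: E0_def)
  \<comment> \<open>E0 depends on P0, whereas all charts must share one model; isometries move every
    E0 into the same E.\<close>
  obtain i j where i: "linear i" "i ` E0 = E" and j: "linear j" "j ` E = E0"
    and ji: "\<And>x. x \<in> E0 \<Longrightarrow> j (i x) = x" and ij: "\<And>x. x \<in> E \<Longrightarrow> i (j x) = x"
    using isometries_subspaces[OF sE0 E(1) dE] by metis
  define U where "U = H \<inter> W"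
  define \<psi> where "\<psi> K = i (\<sigma> K - P0)" for K
  define GW where "GW = GL \<inter> f -` W"
  have oGW: "open GW"
    unfolding GW_def using smooth_on_imp_continuous_on[OF smooth_f] open_GL W(1) by (rule continuous_open_preimage)
  have \<sigma>E0: "\<sigma> K - P0 \<in> E0" if "K \<in> U" for K
    using \<sigma>[of K] that P0 subspace_L p(4)
    by (simp add: U_def E0_iff subspace_diff linear_diff[OF p(1)])
  have j\<psi>: "P0 + j (\<psi> K) = \<sigma> K" if "K \<in> U" for K using ji[OF \<sigma>E0[OF that]] by (simp add: \<psi>_def)
  have f\<psi>: "f (P0 + j (\<psi> K)) = K" if "K \<in> U" for K using j\<psi>[OF that] \<sigma> that by (simp add: U_def)
  have inj: "inj_on \<psi> U" by (rule inj_on_inverseI[of _ "\<lambda>z. f (P0 + j z)"]) (rule f\<psi>)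
  \<comment> \<open>The exact image shows that it is open in E. Every slice point in
    \<open>GW\<close> is attained, because it solves the equation with projection P0 and such a
    solution is unique.\<close>
  have im: "\<psi> ` U = E \<inter> {z. P0 + j z \<in> GW}"
  proof (intro equalityI subsetI)
    fix z assume "z \<in> \<psi> ` U"
    then obtain K where K: "K \<in> U" "z = \<psi> K" by blast
    then show "z \<in> E \<inter> {z. P0 + j z \<in> GW}"
      using \<sigma>E0[OF K(1)] i(2) j\<psi>[OF K(1)] \<sigma>[of K] by (auto simp: \<psi>_def GW_def U_def)
  next
    fix z assume z: "z \<in> E \<inter> {z. P0 + j z \<in> GW}"
    define K where "K = f (P0 + j z)"
    have jz: "j z \<in> E0" using z j(2) by blast
    then have S: "P0 + j z \<in> S" using z P0 subspace_L by (auto simp: GW_def E0_def subspace_add)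
    then have KU: "K \<in> U" using z by (auto simp: U_def K_def GW_def)
    have "T K (P0 + j z) = 0" using kernel_GL[of "P0 + j z" K] S by (simp add: K_def)
    moreover have "p (P0 + j z) = P0"
      using jz pE0 p(4) by (simp add: linear_add[OF p(1)] E0_def)
    ultimately have "P0 + j z = \<sigma> K"
      using uniq[of K "P0 + j z"] KU by (simp add: U_def)
    then have "\<psi> K = i (j z)" unfolding \<psi>_def by (metis add_diff_cancel_left')
    then show "z \<in> \<psi> ` U" using KU ij z by (metis IntD1 imageI)
  qed
  have "continuous_on UNIV (\<lambda>z. P0 + j z)"
    using j(1) by (intro continuous_intros linear_continuous_on) (simp add: linear_conv_bounded_linear)
  then have "open ((\<lambda>z. P0 + j z) -` GW)"
    using oGW by (simp add: continuous_on_eq_continuous_at open_vimage)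
  then have oim: "openin (top_of_set E) (\<psi> ` U)"
    unfolding im by (simp add: openin_open_Int vimage_def)
  have "smooth_on U \<psi>"
    unfolding \<psi>_def
  proof (rule smooth_on_compose[where T = UNIV and g = i])
    show "smooth_on U (\<lambda>K. \<sigma> K - P0)"
      using smooth_on_add[OF smooth_on_subset[OF W(3)] smooth_on_const[of U "- P0"]] by (simp add: U_def)
  qed (use smooth_on_linear[OF i(1)] in auto)
  moreover have "smooth_on (\<psi> ` U) (inv_into U \<psi>)"
  proof -
    have "smooth_on (\<psi> ` U) (\<lambda>z. f (P0 + j z))"
      by (rule smooth_on_compose[OF smooth_on_add[OF smooth_on_const smooth_on_linear[OF j(1)]] smooth_f])
        (use im in \<open>auto simp: GW_def\<close>)
    then show ?thesis by (rule smooth_on_eq) (use f\<psi> inj in auto)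
  qed
  ultimately have "(U, \<psi>) \<in> atlas (submanifold E H)"
    using inj oim W(1) by (simp add: submanifold_def U_def openin_open_Int)
  moreover have "f P0 \<in> U" using P0 W(2) by (simp add: U_def)
  ultimately show ?thesis by blast
qed

lemma local_sections_exists: "\<exists>E. local_sections L S E H f \<and> dim E \<le> dim L"
proof -
  obtain E :: "'k set" where E: "subspace E" "dim E = dim L - d"
    by (rule choose_subspace_of_subspace[of "dim L - d" "UNIV :: 'k set"]) (use dim_L in auto)
  have "local_sections L S E H f"
  proof
    show "openin (top_of_set L) S" using open_GL by (simp add: openin_open_Int)
    show "smooth_manifold (submanifold E H)"
      by (rule smooth_manifold_submanifold[OF E(1)]) (use submanifold_chart[OF _ E] in blast)
    show "smooth_on S f" using smooth_on_subset[OF smooth_f] by blast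
    fix P assume P: "P \<in> S"
    then obtain p W \<sigma> where W: "open W" "f P \<in> W" "smooth_on W \<sigma>" "p P = P"
      "\<And>K. K \<in> H \<inter> W \<Longrightarrow> \<sigma> K \<in> S \<and> f (\<sigma> K) = K \<and> p (\<sigma> K) = P"
      "\<And>K X. K \<in> W \<Longrightarrow> T K X = 0 \<Longrightarrow> p X = P \<Longrightarrow> X = \<sigma> K"
      by (rule normalized_section) (rule that, assumption+)
    have "\<sigma> (f P) = P" using W(6)[OF W(2) _ W(4)] kernel_GL[of P "f P"] P by auto
    then show "\<exists>W \<sigma>. open W \<and> f P \<in> W \<and> smooth_on (H \<inter> W) \<sigma> \<and> \<sigma> ` (H \<inter> W) \<subseteq> S \<and>
        (\<forall>K\<in>H \<inter> W. f (\<sigma> K) = K) \<and> \<sigma> (f P) = P"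
      using W smooth_on_subset[OF W(3), of "H \<inter> W"] by (intro exI[of _ W] exI[of _ \<sigma>]) auto
  qed (fact subspace_L, simp)
  then show ?thesis using E(2) by auto
qed

end

section \<open>Similarity and invariant polynomials\<close>

text \<open>The value p(B), computed by Horner's scheme.\<close>

definition poly_matrix :: "real ^ 'n ^ 'n \<Rightarrow> real poly \<Rightarrow> real ^ 'n ^ 'n" where
  "poly_matrix B p = fold_coeffs (\<lambda>c M. c *\<^sub>R mat 1 + B ** M) p 0"

lemma poly_matrix_0 [simp]: "poly_matrix B 0 = 0"
  by (simp add: poly_matrix_def)

lemma poly_matrix_pCons [simp]: "poly_matrix B (pCons c p) = c *\<^sub>R mat 1 + B ** poly_matrix B p"
  by (cases "p = 0 \<and> c = 0") (auto simp: poly_matrix_def)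

lemma matrix_mult_add_left: "((A :: 'a::semiring_1 ^ 'n ^ 'm) + B) ** C = A ** C + B ** C"
  by (simp add: matrix_matrix_mult_def vec_eq_iff distrib_right sum.distrib)

lemma matrix_mult_diff_left: "((A :: 'a::ring_1 ^ 'n ^ 'm) - B) ** C = A ** C - B ** C"
  by (simp add: matrix_matrix_mult_def vec_eq_iff left_diff_distrib sum_subtractf)

lemma matrix_mult_diff_right: "(A :: 'a::ring_1 ^ 'n ^ 'm) ** (B - C) = A ** B - A ** C"
  by (simp add: matrix_matrix_mult_def vec_eq_iff right_diff_distrib sum_subtractf)

lemma matrix_mult_scaleR_left: "(c *\<^sub>R (A :: real ^ 'n ^ 'm)) ** B = c *\<^sub>R (A ** B)"
  by (rule scalar_matrix_assoc[symmetric])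

lemma matrix_mult_scaleR_right: "(A :: real ^ 'n ^ 'm) ** (c *\<^sub>R B) = c *\<^sub>R (A ** B)"
  by (simp add: matrix_scalar_ac scalar_matrix_assoc)

lemma matrix_mult_vector_smult: "(M :: 'a::comm_semiring_1 ^ 'n ^ 'm) *v (p *s x) = p *s (M *v x)"
  by (simp add: vec_eq_iff matrix_vector_mult_def sum_distrib_left mult_ac)

lemma poly_matrix_add: "poly_matrix B (p + q) = poly_matrix B p + poly_matrix B q"
  by (induction p q rule: poly_induct2) (simp_all add: matrix_add_ldistrib algebra_simps)

lemma poly_matrix_smult: "poly_matrix B (smult c p) = c *\<^sub>R poly_matrix B p"
  by (induction p) (simp_all add: scaleR_add_right matrix_mult_scaleR_right)

lemma poly_matrix_mult: "poly_matrix B (p * q) = poly_matrix B p ** poly_matrix B q"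
  by (induction p) (simp_all add: poly_matrix_add poly_matrix_smult matrix_mult_add_left matrix_mul_assoc
      matrix_mult_scaleR_left)

lemma poly_matrix_intertwine:
  assumes "B ** T = T ** A"
  shows "poly_matrix B p ** T = T ** poly_matrix A p"
proof (induction p)
  case (pCons c p)
  have "B ** poly_matrix B p ** T = T ** (A ** poly_matrix A p)"
    by (metis assms matrix_mul_assoc pCons.IH)
  then show ?case
    by (simp add: matrix_add_ldistrib matrix_mult_add_left matrix_mult_scaleR_left matrix_mult_scaleR_right)
qed simp

text \<open>The evaluation homomorphism of the \<open>\<real>[s]\<close>-module \<open>\<real>[s]\<^sup>n\<close> onto \<open>\<real>\<^sup>n\<close>, on which \<open>s\<close> acts as \<open>B\<close>.\<close>

definition eval_vec :: "real ^ 'n ^ 'n \<Rightarrow> real poly ^ 'n \<Rightarrow> real ^ 'n" where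
  "eval_vec B u = (\<Sum>c\<in>UNIV. poly_matrix B (u $ c) *v axis c 1)"

definition const_vec :: "real ^ 'n \<Rightarrow> real poly ^ 'n" where
  "const_vec x = (\<chi> c. [:x $ c:])"

definition const_mat :: "real ^ 'n ^ 'm \<Rightarrow> real poly ^ 'n ^ 'm" where
  "const_mat M = (\<chi> i j. [:M $ i $ j:])"

lemma eval_vec_add: "eval_vec B (u + v) = eval_vec B u + eval_vec B v"
  by (simp add: eval_vec_def poly_matrix_add matrix_vector_mult_add_rdistrib sum.distrib)

lemma eval_vec_0: "eval_vec B 0 = 0"
  by (simp add: eval_vec_def)

lemma eval_vec_sum: "eval_vec B (\<Sum>i\<in>I. u i) = (\<Sum>i\<in>I. eval_vec B (u i))"
  by (induction I rule: infinite_finite_induct) (simp_all add: eval_vec_add eval_vec_0)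

lemma eval_vec_smult: "eval_vec B (p *s u) = poly_matrix B p *v eval_vec B u"
  by (simp add: eval_vec_def poly_matrix_mult matrix_vector_mul_assoc[symmetric] linear_sum)

lemma eval_vec_const: "eval_vec B (const_vec x) = x"
proof -
  have "eval_vec B (const_vec x) = (\<Sum>c\<in>UNIV. x $ c *s axis c 1)"
    by (simp add: eval_vec_def const_vec_def scaleR_matrix_vector_assoc[symmetric] scalar_mult_eq_scaleR)
  then show ?thesis by (simp add: basis_expansion)
qed

lemma eval_vec_mult:
  "eval_vec B (M *v v) = (\<Sum>c\<in>UNIV. poly_matrix B (v $ c) *v eval_vec B (column c M))"
  by (simp add: matrix_mult_sum eval_vec_sum eval_vec_smult)

lemma const_vec_axis: "const_vec (axis c 1) = axis c 1"
  by (simp add: const_vec_def axis_def vec_eq_iff one_pCons)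

lemma mult_axis: "(M :: 'a::semiring_1 ^ 'n ^ 'm) *v axis c 1 = column c M"
  by (simp add: matrix_vector_mult_def column_def axis_def vec_eq_iff if_distrib cong: if_cong)

lemma sum_const_poly: "(\<Sum>i\<in>I. [:f i:]) = [:\<Sum>i\<in>I. f i:]"
  by (induction I rule: infinite_finite_induct) auto

lemma const_mat_mult: "const_mat (X ** Y) = const_mat X ** const_mat Y"
  by (simp add: const_mat_def matrix_matrix_mult_def vec_eq_iff sum_const_poly mult_pCons_left mult.commute)

lemma const_mat_1: "const_mat (mat 1) = mat 1"
  by (simp add: const_mat_def mat_def vec_eq_iff one_pCons)

lemma charmat_eq: "charmat A = mat [:0, 1:] - const_mat A"
  by (simp add: charmat_def const_mat_def mat_def vec_eq_iff)

lemma mat_mult_left: "mat a ** (X :: 'a::comm_semiring_1 ^ 'n ^ 'm) = (\<chi> i j. a * X $ i $ j)"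
  by (simp add: matrix_matrix_mult_def mat_def vec_eq_iff if_distrib[of "\<lambda>x. x * _"] cong: if_cong)

lemma mat_mult_right: "(X :: 'a::comm_semiring_1 ^ 'n ^ 'm) ** mat a = (\<chi> i j. a * X $ i $ j)"
  by (simp add: matrix_matrix_mult_def mat_def vec_eq_iff if_distrib mult.commute cong: if_cong)

lemma charmat_mult_const: "charmat A *v const_vec x = [:0, 1:] *s const_vec x - const_vec (A *v x)"
proof -
  have "const_mat A *v const_vec x = const_vec (A *v x)"
    by (simp add: const_mat_def const_vec_def matrix_vector_mult_def vec_eq_iff sum_const_poly mult_pCons_left mult.commute)
  moreover have "mat [:0, 1:] *v const_vec x = [:0, 1:] *s const_vec x"
    by (simp add: matrix_vector_mult_def mat_def vec_eq_iff if_distrib[of "\<lambda>x. x * _"] cong: if_cong)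
  ultimately show ?thesis by (simp add: charmat_eq matrix_vector_mult_diff_rdistrib)
qed

lemma eval_vec_diff: "eval_vec B (u - v) = eval_vec B u - eval_vec B v"
  using eval_vec_add[of B "u - v" v] by simp

text \<open>The columns of s I - B are s e - B e with e a unit vector; as s acts as B under
  evaluation, they evaluate to 0.\<close>

lemma eval_vec_charmat: "eval_vec B (charmat B *v z) = 0"
proof -
  have "eval_vec B (column c (charmat B)) = 0" for c
  proof -
    have "column c (charmat B) = charmat B *v const_vec (axis c 1)"
      by (simp only: const_vec_axis mult_axis)
    then show ?thesis
      by (simp add: charmat_mult_const eval_vec_diff eval_vec_smult eval_vec_const)
  qed
  then show ?thesis by (simp add: eval_vec_mult)
qed

text \<open>View the space of real vectors with s acting as A as the cokernel of s I - A. The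
  hypothesis says that U carries the image of \<open>charmat A\<close> into that of
  \<open>charmat B\<close>, so it induces a module homomorphism T. Since U is onto, so is T, and a
  surjective square matrix is invertible.\<close>

lemma similar_if_charmat_equivalent:
  fixes A B :: "real ^ 'n ^ 'n"
  assumes "invertible U" "U ** charmat A = charmat B ** Z"
  shows "\<exists>T. invertible T \<and> T ** A = B ** T"
proof -
  define f where "f x = eval_vec B (U *v const_vec x)" for x
  have cadd: "const_vec (x + y) = const_vec x + const_vec y" for x y :: "real ^ 'n"
    by (simp add: const_vec_def vec_eq_iff)
  have cscale: "const_vec (c *\<^sub>R x) = [:c:] *s const_vec x" for c and x :: "real ^ 'n"
    by (simp add: const_vec_def vec_eq_iff)
  have "linear f"
  proof (rule linearI)
    show "f (x + y) = f x + f y" for x y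
      by (simp add: f_def cadd matrix_vector_right_distrib eval_vec_add)
    show "f (c *\<^sub>R x) = c *\<^sub>R f x" for c x
      by (simp add: f_def cscale matrix_mult_vector_smult eval_vec_smult scaleR_matrix_vector_assoc[symmetric])
  qed
  define T where "T = matrix f"
  have T: "T *v x = eval_vec B (U *v const_vec x)" for x
    using \<open>linear f\<close> by (simp add: T_def f_def matrix_works)
  have "B *v (T *v x) = T *v (A *v x)" for x
  proof -
    have "U *v (charmat A *v const_vec x) = charmat B *v (Z *v const_vec x)"
      using assms(2) by (simp add: matrix_vector_mul_assoc)
    then have "eval_vec B (U *v ([:0, 1:] *s const_vec x - const_vec (A *v x))) = 0"
      by (simp add: eval_vec_charmat charmat_mult_const)
    then show ?thesis
      by (simp add: T matrix_vector_mult_diff_distrib matrix_mult_vector_smult eval_vec_diff eval_vec_smult)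
  qed
  then have BT: "B ** T = T ** A" by (simp add: matrix_eq matrix_vector_mul_assoc)
  \<comment> \<open>T is defined through constant vectors. Extending the relation to all polynomial
    vectors allows preimages of constant vectors under U, in general not constant, to witness
    surjectivity.\<close>
  have eq: "eval_vec B (U *v v) = T *v eval_vec A v" for v
  proof -
    have "eval_vec B (column c U) = T *v axis c 1" for c
      using T[of "axis c 1"] by (simp only: const_vec_axis mult_axis)
    then have "eval_vec B (U *v v) = (\<Sum>c\<in>UNIV. (poly_matrix B (v $ c) ** T) *v axis c 1)"
      by (simp add: eval_vec_mult matrix_vector_mul_assoc)
    also have "\<dots> = T *v eval_vec A v"
      by (simp add: poly_matrix_intertwine[OF BT] eval_vec_def linear_sum matrix_vector_mul_assoc)
    finally show ?thesis .
  qed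
  obtain U' where U': "U ** U' = mat 1" using assms(1) by (auto simp: invertible_def)
  have "surj ((*v) T)"
  proof (rule surjI)
    show "T *v eval_vec A (U' *v const_vec y) = y" for y
      by (simp add: eq[symmetric] matrix_vector_mul_assoc U' eval_vec_const)
  qed
  then have "invertible T" by (simp add: invertible_right_inverse matrix_right_invertible_surjective)
  then show ?thesis using BT by metis
qed

text \<open>Two matrices with the same diagonal form have unimodularly equivalent characteristic
  matrices, to which \<open>similar_if_charmat_equivalent\<close> applies. Conversely, an invertible
  real T is unimodular over the polynomials and conjugates \<open>charmat A\<close> into
  \<open>charmat B\<close>.\<close>

lemma similarity_class_iff:
  fixes A B :: "real ^ 'n::{finite,linorder} ^ 'n::_"
  assumes A: "A \<in> similarity_class \<alpha>"
  shows "B \<in> similarity_class \<alpha> \<longleftrightarrow> (\<exists>T. invertible T \<and> T ** A = B ** T)"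
proof
  let ?D = "(\<chi> i j. if i = j then \<alpha> (pos i) else 0) :: real poly ^ 'n::_ ^ 'n::_"
  obtain U V where U: "invertible U" "invertible V" "U ** charmat A ** V = ?D"
    using A by (auto simp: similarity_class_def invariant_polynomials_def)
  {
    assume "B \<in> similarity_class \<alpha>"
    then obtain U2 V2 where U2: "invertible U2" "invertible V2" "U2 ** charmat B ** V2 = ?D"
      by (auto simp: similarity_class_def invariant_polynomials_def)
    obtain V' where V': "V ** V' = mat 1" using U(2) by (auto simp: invertible_def)
    obtain U2' where U2': "U2' ** U2 = mat 1" "U2 ** U2' = mat 1" using U2(1) by (auto simp: invertible_def)
    have "(U2' ** U) ** charmat A = U2' ** (U ** charmat A ** V) ** V'"
      by (simp add: V' flip: matrix_mul_assoc)
    also have "\<dots> = (U2' ** U2) ** charmat B ** (V2 ** V')"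
      unfolding U(3) U2(3)[symmetric] by (simp only: matrix_mul_assoc)
    finally have "(U2' ** U) ** charmat A = charmat B ** (V2 ** V')"
      by (simp add: U2'(1))
    moreover have "invertible (U2' ** U)"
      using U(1) U2' by (intro invertible_mult) (auto simp: invertible_def)
    ultimately show "\<exists>T. invertible T \<and> T ** A = B ** T"
      by (intro similar_if_charmat_equivalent)
  }
  {
    assume "\<exists>T. invertible T \<and> T ** A = B ** T"
    then obtain T T' where T: "T ** A = B ** T" "T ** T' = mat 1" "T' ** T = mat 1"
      by (auto simp: invertible_def)
    have inv: "const_mat T ** const_mat T' = mat 1" "const_mat T' ** const_mat T = mat 1"
      using T(2,3) by (metis const_mat_mult const_mat_1)+
    have "const_mat T ** charmat A = charmat B ** const_mat T"
      using T(1) by (simp add: charmat_eq matrix_mult_diff_left matrix_mult_diff_right mat_mult_left mat_mult_right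
          flip: const_mat_mult)
    then have "charmat A = const_mat T' ** charmat B ** const_mat T"
      by (metis inv(2) matrix_mul_assoc matrix_mul_lid)
    then have "(U ** const_mat T') ** charmat B ** (const_mat T ** V) = ?D"
      using U(3) by (simp add: matrix_mul_assoc)
    moreover have "invertible (U ** const_mat T')" "invertible (const_mat T ** V)"
      using U(1,2) inv by (intro invertible_mult; auto simp: invertible_def)+
    ultimately have "\<exists>U V. invertible U \<and> invertible V \<and> U ** charmat B ** V = ?D" by blast
    then show "B \<in> similarity_class \<alpha>"
      using A by (simp add: similarity_class_def invariant_polynomials_def)
  }
qed

section \<open>Brunovsky indices\<close>

lemma dim_Un_le: "finite T \<Longrightarrow> dim (S \<union> T) \<le> dim S + card (T :: 'a::euclidean_space set)"
  by (induction T rule: finite_induct) (auto simp: dim_insert)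

text \<open>A basis of X extends to one of Y by dim Y - dim X vectors, whose images under F can add
  at most as many dimensions.\<close>

lemma dim_Un_linear_image_le:
  fixes F :: "'a::euclidean_space \<Rightarrow> 'b::euclidean_space"
  assumes F: "linear F" and XY: "X \<subseteq> Y"
  shows "dim (Z \<union> F ` Y) + dim X \<le> dim (Z \<union> F ` X) + dim Y"
proof -
  obtain B where B: "B \<subseteq> X" "independent B" "X \<subseteq> span B" "card B = dim X"
    using basis_exists by blast
  obtain B' where B': "B \<subseteq> B'" "B' \<subseteq> Y" "independent B'" "Y \<subseteq> span B'"
    using maximal_independent_subset_extend[of B Y] B XY by blast
  have fin: "finite B'" "finite B" using B' B independent_imp_finite by blast+
  have cB': "card B' = dim Y" using B' basis_card_eq_dim by blast
  let ?S = "(Z \<union> F ` X) \<union> F ` (B' - B)"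
  have "F ` Y \<subseteq> span (F ` B')"
    using B'(4) linear_span_image[OF F] by blast
  also have "\<dots> \<subseteq> span ?S" using B(1) by (intro span_mono) auto
  finally have "dim (Z \<union> F ` Y) \<le> dim ?S"
    by (intro dim_mono) (auto intro: span_base)
  also have "\<dots> \<le> dim (Z \<union> F ` X) + card (F ` (B' - B))" using fin by (intro dim_Un_le) auto
  also have "card (F ` (B' - B)) \<le> card (B' - B)" using fin by (intro card_image_le) auto
  also have "card (B' - B) = dim Y - dim X" using B'(1) fin cB' B(4) by (simp add: card_Diff_subset)
  finally show ?thesis using dim_subset[OF XY] by linarith
qed

lemma columns_matrix_mult: "columns ((F :: 'a::semiring_1 ^ 'n ^ 'k) ** M) = (*v) F ` columns M"
proof -
  have "column i (F ** M) = F *v column i M" for i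
    by (simp add: column_def matrix_matrix_mult_def matrix_vector_mult_def vec_eq_iff)
  then show ?thesis by (auto simp: columns_def)
qed

lemma matpow_commute: "A ** matpow A i = matpow A i ** A"
  by (induction i) (simp_all add: matrix_mul_assoc)

context
  fixes F :: "real ^ 'n ^ 'n" and G :: "real ^ 'm::finite ^ 'n"
begin

abbreviation "krylov_columns i \<equiv> \<Union>j<i. columns (matpow F j ** G)"

lemma krylov_columns_Suc: "krylov_columns (Suc i) = columns G \<union> (*v) F ` krylov_columns i"
proof -
  have "columns (matpow F (Suc j) ** G) = (*v) F ` columns (matpow F j ** G)" for j
    by (simp only: columns_matrix_mult[symmetric] matrix_mul_assoc matpow_commute[symmetric] matpow.simps)
  then show ?thesis by (simp only: lessThan_Suc_eq_insert_0) (simp add: image_UN)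
qed

lemma controllability_rank_mono: "i \<le> j \<Longrightarrow> controllability_rank F G i \<le> controllability_rank F G j"
  unfolding controllability_rank_def by (intro dim_subset UN_mono) auto

text \<open>Each step applies F and adjoins the columns of G, so the dimensions gained at one step
  bound those gained at the next.\<close>

lemma controllability_rank_concave:
  "controllability_rank F G (Suc (Suc i)) + controllability_rank F G i \<le> 2 * controllability_rank F G (Suc i)"
proof -
  have "krylov_columns i \<subseteq> krylov_columns (Suc i)" by (intro UN_mono) auto
  from dim_Un_linear_image_le[OF _ this, of "(*v) F" "columns G"]
  show ?thesis unfolding controllability_rank_def krylov_columns_Suc[symmetric]
    by (simp add: matrix_vector_mul_linear)
qed

lemma brunovsky_index_decreasing:
  assumes "1 \<le> i" "i \<le> j"
  shows "brunovsky_index F G j \<le> brunovsky_index F G i"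
  using assms(2,1)
proof (induction j rule: dec_induct)
  case (step j)
  obtain l where l: "j = Suc l" using step by (cases j) auto
  have "brunovsky_index F G (Suc j) \<le> brunovsky_index F G j"
    using controllability_rank_concave[of l] controllability_rank_mono[of l "Suc l"]
      controllability_rank_mono[of "Suc l" "Suc (Suc l)"]
    by (simp add: brunovsky_index_def l)
  then show ?case using step by simp
qed simp

lemma sum_brunovsky_index: "(\<Sum>i=1..N. brunovsky_index F G i) = controllability_rank F G N"
proof (induction N)
  case (Suc N)
  then show ?case using controllability_rank_mono[of N "Suc N"] by (simp add: brunovsky_index_def)
qed (simp add: controllability_rank_def)

lemma brunovsky_index_eq_0:
  assumes "controllable F G" "CARD('n) < i"
  shows "brunovsky_index F G i = 0"
proof -
  have "controllability_rank F G i \<le> CARD('n)"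
    unfolding controllability_rank_def using dim_subset_UNIV[where 'a = "real ^ 'n"] by simp
  moreover have "CARD('n) \<le> controllability_rank F G (i - 1)"
    using assms controllability_rank_mono[of "CARD('n)" "i - 1"] by (simp add: controllable_def)
  ultimately show ?thesis by (simp add: brunovsky_index_def)
qed

text \<open>The two index sequences are conjugate partitions: the Brunovsky indices decrease, so the
  j counted by \<open>controllability_index F G a\<close> form an initial segment. Its finiteness,
  which \<open>card\<close> needs, comes from the indices vanishing beyond n.\<close>

lemma le_controllability_index_iff:
  assumes "controllable F G" "1 \<le> a" "1 \<le> i"
  shows "i \<le> controllability_index F G a \<longleftrightarrow> a \<le> brunovsky_index F G i"
proof -
  let ?J = "{j. 1 \<le> j \<and> a \<le> brunovsky_index F G j}"
  have "?J \<subseteq> {1..CARD('n)}"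
  proof
    fix j assume "j \<in> ?J"
    then show "j \<in> {1..CARD('n)}" using brunovsky_index_eq_0[OF assms(1), of j] assms(2) by force
  qed
  then have fin: "finite ?J" by (rule finite_subset) simp
  show ?thesis
  proof
    assume le: "a \<le> brunovsky_index F G i"
    have "{1..i} \<subseteq> ?J"
      using le brunovsky_index_decreasing[of _ i] by (auto intro: order_trans)
    then show "i \<le> controllability_index F G a"
      using card_mono[OF fin, of "{1..i}"] by (simp add: controllability_index_def)
  next
    assume i: "i \<le> controllability_index F G a"
    show "a \<le> brunovsky_index F G i"
    proof (rule ccontr)
      assume nle: "\<not> a \<le> brunovsky_index F G i"
      have "?J \<subseteq> {1..<i}"
      proof
        fix j assume j: "j \<in> ?J"
        then have "\<not> i \<le> j" using brunovsky_index_decreasing[OF assms(3), of j] nle by force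
        then show "j \<in> {1..<i}" using j by simp
      qed
      then have "card ?J \<le> i - 1" using card_mono[of "{1..<i}" ?J] by simp
      then show False using i assms(3) by (simp add: controllability_index_def)
    qed
  qed
qed

text \<open>Indices beyond k vanish and k is at most n, so the sum telescopes to the controllability
  rank at n.\<close>

lemma sum_brunovsky_index_controllable:
  assumes "controllable F G" "k = controllability_index F G 1"
  shows "(\<Sum>i=1..k. brunovsky_index F G i) = CARD('n)"
proof -
  have z: "brunovsky_index F G i = 0" if "k < i" for i
    using le_controllability_index_iff[OF assms(1), of 1 i] that assms(2) by (cases "i = 0") auto
  have "k \<le> CARD('n)"
    using le_controllability_index_iff[OF assms(1), of 1 k] brunovsky_index_eq_0[OF assms(1), of k] assms(2)
    by (cases "k = 0") (auto intro: leI)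
  then have "(\<Sum>i=1..k. brunovsky_index F G i) = (\<Sum>i=1..CARD('n). brunovsky_index F G i)"
    by (intro sum.mono_neutral_left) (auto intro: z)
  then show ?thesis using assms(1) unfolding sum_brunovsky_index controllable_def by simp
qed

end

section \<open>Numbering of indices and positions in block partitions\<close>

lemma pos_ix:
  assumes "1 \<le> m" "m \<le> CARD('n::{finite,linorder})"
  shows "pos (ix m :: 'n) = m"
proof -
  let ?xs = "sorted_list_of_set (UNIV :: 'n set)"
  have len: "length ?xs = CARD('n)" by simp
  have st: "sorted_wrt (<) ?xs" by simp
  have "{..?xs ! (m - 1)} = (!) ?xs ` {..<m}"
  proof (intro equalityI subsetI)
    fix x assume x: "x \<in> {..?xs ! (m - 1)}"
    obtain l where l: "l < CARD('n)" "?xs ! l = x"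
      using in_set_conv_nth[of x ?xs] len by auto
    have "\<not> m - 1 < l"
      using sorted_wrt_nth_less[OF st, of "m - 1" l] l x len by auto
    then show "x \<in> (!) ?xs ` {..<m}" using l assms(1) by (intro image_eqI[of _ _ l]) auto
  next
    fix x assume "x \<in> (!) ?xs ` {..<m}"
    then obtain l where "l < m" "x = ?xs ! l" by auto
    then show "x \<in> {..?xs ! (m - 1)}"
      using sorted_nth_mono[of ?xs l "m - 1"] assms len by auto
  qed
  moreover have "inj_on ((!) ?xs) {..<m}"
    using assms len by (intro inj_on_nth) auto
  ultimately show ?thesis by (simp add: pos_def ix_def card_image)
qed

lemma pos_bounds: "1 \<le> pos (p :: 'n::{finite,linorder})" "pos p \<le> CARD('n)"
  unfolding pos_def by (auto simp: Suc_le_eq card_gt_0_iff intro: card_mono)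

lemma ix_pos: "ix (pos p) = (p :: 'n::{finite,linorder})"
proof -
  have "inj_on (ix :: nat \<Rightarrow> 'n) {1..CARD('n)}"
    by (rule inj_on_inverseI[of _ pos]) (simp add: pos_ix)
  then have "(ix :: nat \<Rightarrow> 'n) ` {1..CARD('n)} = UNIV"
    by (intro card_subset_eq) (auto simp: card_image)
  then obtain m where m: "m \<in> {1..CARD('n)}" "ix m = p" by (metis UNIV_I imageE)
  then show ?thesis using pos_ix[of m, where 'n = 'n] by auto
qed

lemma offset_Suc: "1 \<le> i \<Longrightarrow> offset s (Suc i) = offset s i + s i"
  by (simp add: offset_def)

lemma offset_decompose:
  assumes "1 \<le> m" "m \<le> (\<Sum>i=1..k. s i)"
  obtains i a where "i \<in> {1..k}" "a \<in> {1..s i}" "m = offset s i + a"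
  using assms
proof (induction k arbitrary: thesis)
  case (Suc k)
  show ?case
  proof (cases "m \<le> (\<Sum>i=1..k. s i)")
    case True
    then obtain i a where "i \<in> {1..k}" "a \<in> {1..s i}" "m = offset s i + a" using Suc by metis
    then show ?thesis using Suc.prems(1)[of i a] by simp
  next
    case False
    have "offset s (Suc k) = (\<Sum>i=1..k. s i)"
      by (simp add: offset_def atLeastLessThanSuc_atLeastAtMost)
    then show ?thesis using Suc.prems(1)[of "Suc k" "m - offset s (Suc k)"] Suc.prems(2,3) False by simp
  qed
qed simp

section \<open>The Brunovsky form and the Krylov space\<close>

lemma row_eq: "row i M = M $ i"
  by (simp add: row_def)

lemma matrix_mult_nth: "((M :: 'a::semiring_1 ^ 'n ^ 'm) ** N) $ i = M $ i v* N"
  by (simp add: matrix_matrix_mult_def vector_matrix_mult_def vec_eq_iff)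

lemma axis_vector_matrix_mult: "axis i 1 v* (M :: 'a::semiring_1 ^ 'n ^ 'm) = M $ i"
  by (simp add: vector_matrix_mult_def axis_def vec_eq_iff if_distrib[of "\<lambda>x. x * _"] cong: if_cong)

lemma matrix_inv_invertible:
  assumes "invertible P"
  shows "P ** matrix_inv P = mat 1" "matrix_inv P ** P = mat 1"
  using someI_ex[OF assms[unfolded invertible_def]] by (simp_all add: matrix_inv_def)

text \<open>Of the controllable pair there remain a partition \<open>\<rho>\<close> of n, its
  conjugate \<open>\<kappa>\<close>, and the canonical shape. It helps to read row a of block i as
  the i-th member of a chain that starts at row a of P and ends in block
  \<open>\<kappa> a\<close>.\<close>

locale brunovsky_form =
  fixes F A :: "real ^ 'n::{finite,linorder} ^ 'n::_"
    and G1 :: "real ^ 'r::{finite,linorder} ^ 'n::_"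
    and \<kappa> \<rho> :: "nat \<Rightarrow> nat" and k :: nat
  assumes decreasing: "\<And>i j. 1 \<le> i \<Longrightarrow> i \<le> j \<Longrightarrow> \<rho> j \<le> \<rho> i"
    and sum_\<rho>: "(\<Sum>i=1..k. \<rho> i) = CARD('n)"
    and \<kappa>_iff: "\<And>a i. 1 \<le> a \<Longrightarrow> 1 \<le> i \<Longrightarrow> i \<le> \<kappa> a \<longleftrightarrow> a \<le> \<rho> i"
    and k: "k = \<kappa> 1" and r1: "\<rho> 1 = CARD('r)"
    and formF: "brunovsky_F k \<rho> F" and formG: "brunovsky_G1 k \<rho> G1"
begin

lemma le_k_iff: "1 \<le> i \<Longrightarrow> i \<le> k \<longleftrightarrow> 1 \<le> \<rho> i"
  using \<kappa>_iff[of 1 i] by (simp add: k)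

lemma \<rho>_Suc_k: "\<rho> (k + 1) = 0"
  using le_k_iff[of "k + 1"] by simp

lemma row_index:
  fixes p :: 'n
  obtains i a where "i \<in> {1..k}" "a \<in> {1..\<rho> i}" "p = ix (offset \<rho> i + a)"
proof -
  obtain i a where "i \<in> {1..k}" "a \<in> {1..\<rho> i}" "pos p = offset \<rho> i + a"
    using offset_decompose[of "pos p" \<rho> k] pos_bounds[of p] sum_\<rho> by metis
  then show ?thesis using that[of i a] ix_pos[of p] by metis
qed

text \<open>Rows without a counterpart in the next block vanish. For i = k these are all rows, since
  \<open>\<rho> (k + 1) = 0\<close>, so the last block needs no separate case.\<close>

lemma F_row:
  assumes i: "i \<in> {1..k}" and a: "a \<in> {1..\<rho> i}"
  shows "F $ ix (offset \<rho> i + a) = (if a \<le> \<rho> (i + 1) then axis (ix (offset \<rho> (i + 1) + a)) 1 else 0)"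
proof -
  have entry: "F $ ix (offset \<rho> i + a) $ ix (offset \<rho> j + b) = (if j = i + 1 \<and> a = b then 1 else 0)"
    if "j \<in> {1..k}" "b \<in> {1..\<rho> j}" for j b
    using formF i a that by (simp add: brunovsky_F_def block_entry_def)
  have "F $ ix (offset \<rho> i + a) $ q = (if a \<le> \<rho> (i + 1) then axis (ix (offset \<rho> (i + 1) + a)) 1 else 0) $ q" for q
  proof -
    obtain j b where q: "j \<in> {1..k}" "b \<in> {1..\<rho> j}" "q = ix (offset \<rho> j + b)" by (rule row_index)
    have ik: "i + 1 \<in> {1..k}" if "a \<le> \<rho> (i + 1)"
      using that a le_k_iff[of "i + 1"] by auto
    show ?thesis
    proof (cases "a \<le> \<rho> (i + 1) \<and> q = ix (offset \<rho> (i + 1) + a)")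
      case True
      then show ?thesis using entry[of "i + 1" a] ik a by (simp add: axis_def)
    next
      case False
      then have "\<not> (j = i + 1 \<and> a = b)" using q by auto
      then show ?thesis using entry[OF q(1,2)] q(3) False by (auto simp: axis_def)
    qed
  qed
  then show ?thesis by (simp add: vec_eq_iff)
qed

text \<open>The column block sizes telescope: block k - i + 1 starts after
  \<open>\<rho> (i + 1)\<close> columns. Its column b is therefore column
  \<open>\<rho> (i + 1) + b\<close> of \<open>G1\<close>, which is exactly the number a of the row
  holding the entry 1.\<close>

lemma G1_row:
  assumes i: "i \<in> {1..k}" and a: "a \<in> {1..\<rho> i}"
  shows "G1 $ ix (offset \<rho> i + a) = (if a \<le> \<rho> (i + 1) then 0 else axis (ix a) 1)"
proof -
  define \<gamma> where "\<gamma> = (\<lambda>j. \<rho> (k + 1 - j) - \<rho> (k + 2 - j))"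
  have entry: "G1 $ ix (offset \<rho> i + a) $ ix (offset \<gamma> j + b) = (if j = k - i + 1 \<and> a = \<rho> (i + 1) + b then 1 else 0)"
    if "j \<in> {1..k}" "b \<in> {1..\<gamma> j}" for j b
    using formG i a that unfolding brunovsky_G1_def Let_def \<gamma>_def[symmetric] by (simp add: block_entry_def)
  have off: "offset \<gamma> (Suc l) = \<rho> (k + 1 - l)" if "l \<le> k" for l
    using that
  proof (induction l)
    case 0
    then show ?case using \<rho>_Suc_k by (simp add: offset_def)
  next
    case (Suc l)
    have "\<rho> (k + 1 - l) \<le> \<rho> (k - l)" using Suc.prems by (intro decreasing) auto
    moreover have "k + 1 - l = Suc (k - l)" using Suc.prems by auto
    ultimately show ?case using Suc by (simp add: offset_Suc \<gamma>_def)
  qed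
  have sum\<gamma>: "(\<Sum>j=1..k. \<gamma> j) = CARD('r)"
    using off[of k] r1 by (simp add: offset_def atLeastLessThanSuc_atLeastAtMost)
  have offi: "offset \<gamma> (k - i + 1) = \<rho> (i + 1)" using off[of "k - i"] i by simp
  have "G1 $ ix (offset \<rho> i + a) $ c = (if a \<le> \<rho> (i + 1) then 0 else axis (ix a) 1) $ c" for c
  proof -
    obtain j b where c: "j \<in> {1..k}" "b \<in> {1..\<gamma> j}" "pos c = offset \<gamma> j + b"
      using offset_decompose[of "pos c" \<gamma> k] pos_bounds[of c] sum\<gamma> by metis
    have c': "c = ix (offset \<gamma> j + b)" using ix_pos[of c] c(3) by simp
    show ?thesis
    proof (cases "\<not> a \<le> \<rho> (i + 1) \<and> c = ix a")
      case True
      have "k + 1 - (k - i + 1) = i" "k + 2 - (k - i + 1) = i + 1" using i by auto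
      then have "a - \<rho> (i + 1) \<in> {1..\<gamma> (k - i + 1)}" "k - i + 1 \<in> {1..k}"
        using True a i by (auto simp: \<gamma>_def)
      then show ?thesis using entry[of "k - i + 1" "a - \<rho> (i + 1)"] True offi by (simp add: axis_def)
    next
      case False
      have "\<not> (j = k - i + 1 \<and> a = \<rho> (i + 1) + b)"
        using False c' offi c(2) by auto
      then show ?thesis using entry[OF c(1,2)] c' False by (auto simp: axis_def)
    qed
  qed
  then show ?thesis by (simp add: vec_eq_iff)
qed

text \<open>Splits the closed-loop equation by rows: inside a chain no feedback occurs and the row
  states the Krylov recursion, while the end of chain a exposes row a of
  \<open>K ** P\<close>.\<close>

lemma closed_loop_row:
  assumes "i \<in> {1..k}" "a \<in> {1..\<rho> i}"
  shows "((F + G1 ** K) ** P) $ ix (offset \<rho> i + a) =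
    (if a \<le> \<rho> (i + 1) then P $ ix (offset \<rho> (i + 1) + a) else (K ** P) $ ix a)"
proof -
  have "((F + G1 ** K) ** P) $ ix (offset \<rho> i + a) =
      F $ ix (offset \<rho> i + a) v* P + G1 $ ix (offset \<rho> i + a) v* (K ** P)"
    by (simp add: matrix_mult_add_left matrix_mult_nth flip: matrix_mul_assoc)
  then show ?thesis by (simp add: F_row[OF assms] G1_row[OF assms] axis_vector_matrix_mult)
qed

lemma mem_krylov_space:
  "P \<in> krylov_space A k \<rho> \<longleftrightarrow>
    (\<forall>i\<in>{1..k}. \<forall>a\<in>{1..\<rho> i}. P $ ix (offset \<rho> i + a) = P $ ix a v* matpow A (i - 1))"
  by (simp add: krylov_space_def row_eq)

text \<open>Follows the chain of a fixed a from block to block, using only rows of the closed loop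
  in which K does not occur. Singular P are covered as well, as the kernels require.\<close>

lemma krylov_space_if_intertwine:
  assumes "P ** A = (F + G1 ** K) ** P"
  shows "P \<in> krylov_space A k \<rho>"
  unfolding mem_krylov_space
proof (intro ballI)
  fix i a assume "i \<in> {1..k}" "a \<in> {1..\<rho> i}"
  then have "1 \<le> i" "i \<le> k" "a \<in> {1..\<rho> i}" by auto
  then show "P $ ix (offset \<rho> i + a) = P $ ix a v* matpow A (i - 1)"
  proof (induction i rule: dec_induct)
    case base
    then show ?case by (simp add: offset_def)
  next
    case (step i)
    have i: "i \<in> {1..k}" "a \<in> {1..\<rho> i}" using step.prems step.hyps decreasing[of i "Suc i"] by auto
    have "(P ** A) $ ix (offset \<rho> i + a) = P $ ix (offset \<rho> (i + 1) + a)"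
      unfolding assms closed_loop_row[OF i] using step.prems by simp
    moreover have "P $ ix (offset \<rho> i + a) = P $ ix a v* matpow A (i - 1)" using step i by simp
    moreover have "matpow A i = matpow A (i - 1) ** A" using step.hyps by (cases i) auto
    ultimately show ?case by (simp add: matrix_mult_nth vector_matrix_mul_assoc)
  qed
qed

text \<open>For Krylov P the rows inside the chains hold automatically. What remains are the chain
  ends, where the row of \<open>P ** A\<close> is row a of P times A to the power
  \<open>\<kappa> a\<close>.\<close>

lemma intertwine_iff:
  assumes P: "P \<in> krylov_space A k \<rho>"
  shows "P ** A = (F + G1 ** K) ** P \<longleftrightarrow>
    K ** P = (\<chi> c. row (ix (pos c)) P v* matpow A (\<kappa> (pos c)))"
proof -
  have PA: "(P ** A) $ ix (offset \<rho> i + a) = P $ ix a v* matpow A i" if "i \<in> {1..k}" "a \<in> {1..\<rho> i}" for i a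
  proof -
    have "P $ ix (offset \<rho> i + a) = P $ ix a v* matpow A (i - 1)"
      using P that by (simp add: mem_krylov_space)
    moreover have "matpow A i = matpow A (i - 1) ** A" using that by (cases i) auto
    ultimately show ?thesis by (simp add: matrix_mult_nth vector_matrix_mul_assoc)
  qed
  show ?thesis
  proof
    assume eq: "P ** A = (F + G1 ** K) ** P"
    have "(K ** P) $ c = P $ ix (pos c) v* matpow A (\<kappa> (pos c))" for c
    proof -
      \<comment> \<open>By conjugacy \<open>\<kappa> (pos c)\<close> is the last block with at least
        \<open>pos c\<close> rows, that is, the end of this chain.\<close>
      let ?a = "pos c" and ?i = "\<kappa> (pos c)"
      have a: "1 \<le> ?a" "?a \<le> \<rho> 1" using pos_bounds[of c] r1 by auto
      have i: "1 \<le> ?i" using \<kappa>_iff[OF a(1), of 1] a by simp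
      have "?a \<le> \<rho> ?i" using \<kappa>_iff[OF a(1) i] by simp
      then have i': "?i \<in> {1..k}" "?a \<in> {1..\<rho> ?i}" using le_k_iff[OF i] a i by auto
      have "\<not> ?a \<le> \<rho> (?i + 1)" using \<kappa>_iff[OF a(1), of "?i + 1"] by simp
      then have "((F + G1 ** K) ** P) $ ix (offset \<rho> ?i + ?a) = (K ** P) $ c"
        using closed_loop_row[OF i', of K P] by (simp add: ix_pos)
      then show ?thesis using PA[OF i'] eq by simp
    qed
    then show "K ** P = (\<chi> c. row (ix (pos c)) P v* matpow A (\<kappa> (pos c)))"
      by (simp add: vec_eq_iff row_eq)
  next
    assume K: "K ** P = (\<chi> c. row (ix (pos c)) P v* matpow A (\<kappa> (pos c)))"
    have "(P ** A) $ p = ((F + G1 ** K) ** P) $ p" for p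
    proof -
      obtain i a where p: "i \<in> {1..k}" "a \<in> {1..\<rho> i}" "p = ix (offset \<rho> i + a)" by (rule row_index)
      show ?thesis
      proof (cases "a \<le> \<rho> (i + 1)")
        case True
        then have "i + 1 \<in> {1..k}" "a \<in> {1..\<rho> (i + 1)}" using le_k_iff[of "i + 1"] p by auto
        then have "P $ ix (offset \<rho> (i + 1) + a) = P $ ix a v* matpow A i"
          using P by (simp add: mem_krylov_space)
        then show ?thesis unfolding p(3) closed_loop_row[OF p(1,2)] PA[OF p(1,2)] using True by simp
      next
        case False
        have "i \<le> \<kappa> a" "\<not> i + 1 \<le> \<kappa> a"
          using \<kappa>_iff[of a i] \<kappa>_iff[of a "i + 1"] p False by auto
        then have "\<kappa> a = i" by simp
        moreover have "a \<le> CARD('r)" using decreasing[of 1 i] r1 p by auto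
        then have "pos (ix a :: 'r) = a" using p by (intro pos_ix) auto
        ultimately show ?thesis
          unfolding p(3) closed_loop_row[OF p(1,2)] PA[OF p(1,2)] K using False by (simp add: row_eq)
      qed
    qed
    then show "P ** A = (F + G1 ** K) ** P" by (simp add: vec_eq_iff)
  qed
qed

lemma intertwine_iff_feedback:
  assumes P: "invertible P"
  shows "P ** A = (F + G1 ** K) ** P \<longleftrightarrow> P \<in> krylov_space A k \<rho> \<and> K = feedback_of A \<kappa> P"
proof -
  have "K ** P = W \<longleftrightarrow> K = W ** matrix_inv P" for W
    using matrix_inv_invertible[OF P] by (metis matrix_mul_assoc matrix_mul_rid)
  then show ?thesis
    using krylov_space_if_intertwine[of P K] intertwine_iff[of P K] unfolding feedback_of_def by blast
qed

lemma subspace_krylov_space: "subspace (krylov_space A k \<rho>)"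
  by (auto simp: subspace_def mem_krylov_space vector_matrix_left_distrib scaleR_vector_matrix_assoc)

text \<open>The Krylov conditions determine P from its first r rows, which form an r by n
  matrix.\<close>

lemma dim_krylov_space: "dim (krylov_space A k \<rho>) \<le> DIM(real ^ 'n::_ ^ 'r::_)"
proof -
  define h where "h P = (\<chi> c :: 'r. P $ ix (pos c))" for P :: "real ^ 'n::_ ^ 'n::_"
  have h: "linear h" by (rule linearI) (simp_all add: h_def vec_eq_iff)
  have "inj_on h (span (krylov_space A k \<rho>))"
    unfolding span_eq_iff[THEN iffD2, OF subspace_krylov_space]
  proof (rule inj_onI)
    fix P Q assume PQ: "P \<in> krylov_space A k \<rho>" "Q \<in> krylov_space A k \<rho>" "h P = h Q"
    have "P $ p = Q $ p" for p
    proof -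
      obtain i a where p: "i \<in> {1..k}" "a \<in> {1..\<rho> i}" "p = ix (offset \<rho> i + a)" by (rule row_index)
      have "a \<le> CARD('r)" using decreasing[of 1 i] r1 p by auto
      then have "pos (ix a :: 'r) = a" using p by (intro pos_ix) auto
      moreover have "h P $ ix a = h Q $ ix a" using PQ(3) by simp
      ultimately have "P $ ix a = Q $ ix a" by (simp add: h_def)
      then show ?thesis using PQ(1,2) p by (simp add: mem_krylov_space)
    qed
    then show "P = Q" by (simp add: vec_eq_iff)
  qed
  then have "dim (h ` krylov_space A k \<rho>) = dim (krylov_space A k \<rho>)"
    by (rule dim_image_eq[OF h])
  then show ?thesis using dim_subset_UNIV[of "h ` krylov_space A k \<rho>"] by simp
qed

end

section \<open>The orbit space\<close>

lemma linear_matrix_mult_left: "linear (\<lambda>P :: real ^ 'n ^ 'm. C ** P)"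
  by (rule linearI) (simp_all add: matrix_add_ldistrib matrix_mult_scaleR_right)

lemma linear_matrix_mult_right: "linear (\<lambda>P :: real ^ 'n ^ 'm. P ** C)"
  by (rule linearI) (simp_all add: matrix_mult_add_left matrix_mult_scaleR_left)

lemma bounded_bilinear_matrix_mult: "bounded_bilinear (\<lambda>(P :: real ^ 'n ^ 'm) (Q :: real ^ 'k ^ 'n). P ** Q)"
  unfolding bilinear_conv_bounded_bilinear[symmetric] bilinear_def
  by (simp add: linear_matrix_mult_left linear_matrix_mult_right)

lemma invertible_iff_inj: "invertible (P :: real ^ 'n ^ 'n) \<longleftrightarrow> inj ((*v) P)"
  by (simp add: invertible_left_inverse matrix_left_invertible_injective)

lemma inj_matrix_mult_left:
  assumes "invertible (P :: real ^ 'n ^ 'n)"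
  shows "inj (\<lambda>X :: real ^ 'k ^ 'n. P ** X)"
proof (rule injI)
  fix X Y :: "real ^ 'k ^ 'n"
  assume "P ** X = P ** Y"
  then have "matrix_inv P ** P ** X = matrix_inv P ** P ** Y" by (simp flip: matrix_mul_assoc)
  then show "X = Y" by (simp add: matrix_inv_invertible(2)[OF assms])
qed

lemma open_invertible: "open {P :: real ^ 'n ^ 'n. invertible P}"
proof -
  have "continuous_on UNIV (\<lambda>P :: real ^ 'n ^ 'n. P *v y)" for y
    by (simp add: linear_continuous_on linear_conv_bounded_linear[symmetric] linear_iff
        matrix_vector_mult_add_rdistrib scaleR_matrix_vector_assoc)
  then have "open {P \<in> (UNIV :: (real ^ 'n ^ 'n) set). inj ((*v) P)}"
    by (intro open_linear_injective) (auto simp: matrix_vector_mul_linear)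
  then show ?thesis by (simp add: invertible_iff_inj)
qed

text \<open>The inverse solves \<open>P ** X = mat 1\<close>, an injective linear system whose
  coefficients are linear in P.\<close>

lemma smooth_on_matrix_inv: "smooth_on {P :: real ^ 'n ^ 'n. invertible P} matrix_inv"
proof (rule smooth_onI_Ck[OF open_invertible order_refl])
  show "Ck_on k {P :: real ^ 'n ^ 'n. invertible P} matrix_inv" for k
  proof (rule Ck_on_linear_solution[OF open_invertible, where B = "(**)" and c = "\<lambda>_. mat 1"])
    show "linear ((**) P)" for P :: "real ^ 'n ^ 'n" by (rule linear_matrix_mult_left)
    show "inj ((**) P)" if "P \<in> {P. invertible P}" for P :: "real ^ 'n ^ 'n"
      using that by (simp add: inj_matrix_mult_left)
    show "Ck_on k {P :: real ^ 'n ^ 'n. invertible P} (\<lambda>P. P ** Y)" for Y :: "real ^ 'n ^ 'n"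
      by (rule smooth_on_open_imp_Ck_on[OF open_invertible smooth_on_linear[OF linear_matrix_mult_right]])
    show "Ck_on k {P :: real ^ 'n ^ 'n. invertible P} (\<lambda>_. mat 1 :: real ^ 'n ^ 'n)" by (rule Ck_on_const[OF open_invertible])
    show "P ** matrix_inv P = mat 1" if "P \<in> {P. invertible P}" for P :: "real ^ 'n ^ 'n"
      using that matrix_inv_invertible(1) by blast
  qed
qed simp

lemma smooth_on_feedback_of:
  "smooth_on {P :: real ^ 'n::{finite,linorder} ^ 'n::_. invertible P}
     (feedback_of A \<kappa> :: _ \<Rightarrow> real ^ 'n::_ ^ 'r::{finite,linorder})"
proof (rule smooth_onI_Ck[OF open_invertible order_refl])
  fix j
  let ?GL = "{P :: real ^ 'n::_ ^ 'n::_. invertible P}"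
  let ?W = "\<lambda>P :: real ^ 'n::_ ^ 'n::_. (\<chi> c. row (ix (pos c)) P v* matpow A (\<kappa> (pos c))) :: real ^ 'n::_ ^ 'r::_"
  have "linear ?W"
    by (rule linearI) (simp_all add: vec_eq_iff row_eq vector_matrix_left_distrib scaleR_vector_matrix_assoc)
  then have "Ck_on j ?GL ?W"
    by (intro Ck_on_linear[OF open_invertible _ Ck_on_ident[OF open_invertible]])
      (simp add: linear_conv_bounded_linear)
  moreover have "Ck_on j ?GL matrix_inv"
    by (rule smooth_on_open_imp_Ck_on[OF open_invertible smooth_on_matrix_inv])
  ultimately show "Ck_on j ?GL (feedback_of A \<kappa> :: _ \<Rightarrow> real ^ 'n::_ ^ 'r::_)"
    unfolding feedback_of_def
    by (rule Ck_on_bilinear[OF open_invertible bounded_bilinear_matrix_mult])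
qed simp

text \<open>One invertible solution P gives all others: left multiplication by P maps the commutant
  of A isomorphically onto the solution space.\<close>

lemma dim_intertwining:
  fixes A B P :: "real ^ 'n ^ 'n"
  assumes P: "invertible P" "P ** A = B ** P"
  shows "dim {X. X ** A = B ** X} = dim {X. X ** A = A ** X}"
proof -
  obtain P' where P': "P ** P' = mat 1" "P' ** P = mat 1" using P(1) by (auto simp: invertible_def)
  have "{X. X ** A = B ** X} = (**) P ` {X. X ** A = A ** X}"
  proof (intro equalityI subsetI)
    fix X assume "X \<in> {X. X ** A = B ** X}"
    then have X: "X ** A = B ** X" by simp
    have "P' ** X ** A = P' ** B ** P ** (P' ** X)"
      using X P'(1) by (metis matrix_mul_assoc matrix_mul_rid)
    also have "P' ** B ** P = A" using P(2) P'(2) by (metis matrix_mul_assoc matrix_mul_lid)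
    finally have "P' ** X \<in> {X. X ** A = A ** X}" by simp
    moreover have "X = P ** (P' ** X)" using P'(1) by (simp add: matrix_mul_assoc)
    ultimately show "X \<in> (**) P ` {X. X ** A = A ** X}" by blast
  next
    fix Y assume "Y \<in> (**) P ` {X. X ** A = A ** X}"
    then obtain X where "Y = P ** X" "X ** A = A ** X" by auto
    then have "Y ** A = B ** Y" using P(2) by (metis matrix_mul_assoc)
    then show "Y \<in> {X. X ** A = B ** X}" by simp
  qed
  moreover have "inj_on ((**) P) (span {X. X ** A = A ** X})"
    using inj_matrix_mult_left[OF P(1)] by (rule inj_on_subset) simp
  ultimately show ?thesis using dim_image_eq[OF linear_matrix_mult_left[of P]] by simp
qed

text \<open>B and C are the conjugates of A by P and Q. They coincide exactly when Q^-1 P commutes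
  with A, that is, when P and Q differ by an element of the centralizer.\<close>

lemma orbit_eq_iff:
  assumes P: "invertible P" "P ** A = B ** P" and Q: "invertible Q" "Q ** A = C ** Q"
  shows "orbit A P = orbit A Q \<longleftrightarrow> B = C"
proof
  obtain P' where P': "P ** P' = mat 1" "P' ** P = mat 1" using P(1) by (auto simp: invertible_def)
  have one: "mat 1 \<in> centralizer A" by (simp add: centralizer_def invertible_def exI[of _ "mat 1"])
  {
    assume "orbit A P = orbit A Q"
    moreover have "P ** mat 1 \<in> orbit A P" using one unfolding orbit_def by blast
    ultimately obtain X where X: "X ** A = A ** X" "P = Q ** X"
      by (auto simp: orbit_def centralizer_def)
    have "B ** P = C ** P" using P(2) Q(2) X by (metis matrix_mul_assoc)
    then show "B = C" using P'(1) by (metis matrix_mul_assoc matrix_mul_rid)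
  }
  have sub: "orbit A P \<subseteq> orbit A Q"
    if P: "invertible P" "P ** A = B ** P" and Q: "invertible Q" "Q ** A = B ** Q" for P Q
  proof
    fix Y assume "Y \<in> orbit A P"
    then obtain X where X: "invertible X" "X ** A = A ** X" "Y = P ** X"
      by (auto simp: orbit_def centralizer_def)
    obtain Q' where Q': "Q ** Q' = mat 1" "Q' ** Q = mat 1" using Q(1) by (auto simp: invertible_def)
    have "Q' ** B ** Q = A" using Q(2) Q'(2) by (metis matrix_mul_assoc matrix_mul_lid)
    have "Q' ** P ** X ** A = Q' ** B ** (P ** X)" using X(2) P(2) by (metis matrix_mul_assoc)
    also have "\<dots> = Q' ** B ** Q ** (Q' ** P ** X)" using Q'(1) by (metis matrix_mul_assoc matrix_mul_lid)
    also have "\<dots> = A ** (Q' ** P ** X)" using \<open>Q' ** B ** Q = A\<close> by simp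
    finally have "Q' ** P ** X ** A = A ** (Q' ** P ** X)" .
    moreover have "invertible (Q' ** P ** X)"
      using P(1) X(1) Q' by (intro invertible_mult) (auto simp: invertible_def)
    moreover have "Y = Q ** (Q' ** P ** X)" using X(3) Q'(1) by (metis matrix_mul_assoc matrix_mul_lid)
    ultimately show "Y \<in> orbit A Q" unfolding orbit_def centralizer_def by blast
  qed
  show "orbit A P = orbit A Q" if "B = C"
    using sub P Q that by blast
qed

context brunovsky_form
begin

lemma krylov_matrices_eq: "krylov_matrices A k \<rho> = krylov_space A k \<rho> \<inter> {P. invertible P}"
  by (auto simp: krylov_matrices_def full_rank_injective invertible_iff_inj)

text \<open>The constant dimension is that of the whole commutant of A, singular matrices included,
  because the solution spaces are linear, unlike the group \<open>centralizer A\<close>.\<close>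

lemma family:
  "linear_equation_family (\<lambda>K P. P ** A - (F + G1 ** K) ** P) (krylov_space A k \<rho>) {P. invertible P}
     (feedback_of A \<kappa> :: _ \<Rightarrow> real ^ 'n::_ ^ 'r::_) (dim {X. X ** A = A ** X})"
proof (rule linear_equation_family.intro)
  show "linear (\<lambda>P. P ** A - (F + G1 ** K) ** P)" for K
    by (intro linear_compose_sub linear_matrix_mult_left linear_matrix_mult_right)
  show "Ck_on j UNIV (\<lambda>K. P ** A - (F + G1 ** K) ** P)" for j P
  proof -
    have "bounded_linear (\<lambda>K. G1 ** K ** P)"
      using linear_compose[OF linear_matrix_mult_left[of G1] linear_matrix_mult_right[of P]]
      by (simp add: o_def linear_conv_bounded_linear)
    then have "Ck_on j UNIV (\<lambda>K. (P ** A - F ** P) - G1 ** K ** P)"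
      by (intro Ck_on_diff[OF _ Ck_on_const Ck_on_linear[OF _ _ Ck_on_ident]]) auto
    then show ?thesis by (simp add: matrix_mult_add_left algebra_simps)
  qed
  show "P \<in> krylov_space A k \<rho>" if "P ** A - (F + G1 ** K) ** P = 0" for K P
    using krylov_space_if_intertwine that by simp
  show "P ** A - (F + G1 ** K) ** P = 0 \<longleftrightarrow> P \<in> krylov_space A k \<rho> \<and> K = feedback_of A \<kappa> P"
    if "P \<in> {P. invertible P}" for K P
    using intertwine_iff_feedback[of P K] that by simp
  show "dim {X. X ** A - (F + G1 ** feedback_of A \<kappa> P) ** X = 0} = dim {X. X ** A = A ** X}"
    if "P \<in> krylov_space A k \<rho> \<inter> {P. invertible P}" for P
    using dim_intertwining[of P A "F + G1 ** feedback_of A \<kappa> P"] intertwine_iff_feedback[of P "feedback_of A \<kappa> P"] that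
    by simp
qed (use subspace_krylov_space open_invertible smooth_on_feedback_of dim_krylov_space in auto)

text \<open>The closed loop is similar to A exactly when the equation has an invertible solution P,
  and then K is the feedback of P.\<close>

lemma feedback_set_eq:
  assumes "A \<in> similarity_class \<alpha>"
  shows "feedback_set \<alpha> F G1 = feedback_of A \<kappa> ` krylov_matrices A k \<rho>"
  unfolding feedback_set_def similarity_class_iff[OF assms] krylov_matrices_eq
  using intertwine_iff_feedback by blast

lemma orbit_eq_iff_feedback:
  assumes "P \<in> krylov_matrices A k \<rho>" "Q \<in> krylov_matrices A k \<rho>"
  shows "orbit A P = orbit A Q \<longleftrightarrow> feedback_of A \<kappa> P = (feedback_of A \<kappa> Q :: real ^ 'n::_ ^ 'r::_)"
proof -
  let ?f = "feedback_of A \<kappa> :: _ \<Rightarrow> real ^ 'n::_ ^ 'r::_"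
  have inv: "invertible P" "invertible Q" using assms by (auto simp: krylov_matrices_eq)
  have eqs: "P ** A = (F + G1 ** ?f P) ** P" "Q ** A = (F + G1 ** ?f Q) ** Q"
    using assms intertwine_iff_feedback by (auto simp: krylov_matrices_eq)
  show ?thesis
  proof
    assume "orbit A P = orbit A Q"
    then have "Q ** A = (F + G1 ** ?f P) ** Q"
      using orbit_eq_iff[OF inv(1) eqs(1) inv(2) eqs(2)] eqs(2) by simp
    then show "?f P = ?f Q" using intertwine_iff_feedback[OF inv(2)] by blast
  next
    assume "?f P = ?f Q"
    then show "orbit A P = orbit A Q" using orbit_eq_iff[OF inv(1) eqs(1) inv(2) eqs(2)] by simp
  qed
qed

end

text \<open>E is existential because its dimension involves the commutant of A. The map
  \<open>\<phi>\<close> is fixed before Q, so one map serves every quotient structure, and the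
  existence of some Q keeps the last clause from being vacuous.\<close>

theorem theorem4p8:
  fixes \<alpha> :: "nat \<Rightarrow> real poly"
    and F A :: "real ^ 'n::{finite,linorder} ^ 'n::_"
    and G :: "real ^ 'm::{finite,linorder} ^ 'n::_"
    and G1 :: "real ^ 'r::{finite,linorder} ^ 'n::_"
    and \<kappa> \<rho> :: "nat \<Rightarrow> nat" and k :: nat
  assumes monic: "\<forall>i\<in>{1..CARD('n)}. lead_coeff (\<alpha> i) = 1"
    and chain: "\<forall>i\<in>{1..<CARD('n)}. \<alpha> i dvd \<alpha> (Suc i)"
    and degrees: "(\<Sum>i=1..CARD('n). degree (\<alpha> i)) = CARD('n)"
    and ctrb: "controllable F G"
    and rho: "\<rho> = brunovsky_index F G"
    and kappa: "\<kappa> = controllability_index F G"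
    and k: "k = \<kappa> 1"
    and padded: "zero_padded G1 G"
    and rankG1: "rank G1 = CARD('r)"
    and r1: "\<rho> 1 = CARD('r)"
    and kappa_pos: "\<forall>i\<in>{1..CARD('m)}. 0 < \<kappa> i \<longleftrightarrow> i \<le> CARD('r)"
    and formF: "brunovsky_F k \<rho> F"
    and formG: "brunovsky_G1 k \<rho> G1"
    and major: "majorized (map \<kappa> [1..<CARD('m) + 1])
                  (map (\<lambda>i. degree (\<alpha> i)) (rev [1..<CARD('n) + 1]))"
    and A: "A \<in> similarity_class \<alpha>"
  shows "\<exists>E \<phi>. smooth_manifold (submanifold E (feedback_set \<alpha> F G1)) \<and>
           (\<forall>P\<in>krylov_matrices A k \<rho>. \<phi> (orbit A P) = feedback_of A \<kappa> P) \<and>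
           (\<exists>Q :: ((real ^ 'n::_ ^ 'n::_) set, real ^ 'n::_ ^ 'n::_) manifold.
              quotient_manifold (open_submanifold (krylov_space A k \<rho>) (krylov_matrices A k \<rho>)) (orbit A) Q) \<and>
           (\<forall>Q :: ((real ^ 'n::_ ^ 'n::_) set, real ^ 'n::_ ^ 'n::_) manifold.
              quotient_manifold (open_submanifold (krylov_space A k \<rho>) (krylov_matrices A k \<rho>)) (orbit A) Q \<longrightarrow>
              diffeomorphism Q (submanifold E (feedback_set \<alpha> F G1)) \<phi>)"
proof -
  interpret brunovsky_form F A G1 \<kappa> \<rho> k
  proof
    show "\<rho> j \<le> \<rho> i" if "1 \<le> i" "i \<le> j" for i j
      unfolding rho using that by (rule brunovsky_index_decreasing)
    show "(\<Sum>i=1..k. \<rho> i) = CARD('n)"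
      unfolding rho by (rule sum_brunovsky_index_controllable[OF ctrb]) (simp add: k kappa)
    show "i \<le> \<kappa> a \<longleftrightarrow> a \<le> \<rho> i" if "1 \<le> a" "1 \<le> i" for a i
      unfolding rho kappa using le_controllability_index_iff[OF ctrb that] .
  qed (fact k r1 formF formG)+
  let ?L = "krylov_space A k \<rho>" and ?S = "krylov_matrices A k \<rho>" and ?H = "feedback_set \<alpha> F G1"
  let ?f = "feedback_of A \<kappa> :: _ \<Rightarrow> real ^ 'n::_ ^ 'r::_"
  obtain E where sections: "local_sections ?L ?S E ?H ?f" and dim_E: "dim E \<le> dim ?L"
    using linear_equation_family.local_sections_exists[OF family]
    unfolding feedback_set_eq[OF A] krylov_matrices_eq by blast
  interpret local_sections ?L ?S E ?H ?f by (fact sections)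
  \<comment> \<open>The representative of the orbit is arbitrary;
    \<open>orbit_eq_iff_feedback\<close> makes the value independent of it.\<close>
  define \<phi> where "\<phi> X = ?f (SOME P. P \<in> ?S \<and> orbit A P = X)" for X
  have \<phi>: "\<phi> (orbit A P) = ?f P" if P: "P \<in> ?S" for P
  proof -
    have "(SOME Q. Q \<in> ?S \<and> orbit A Q = orbit A P) \<in> ?S \<and>
        orbit A (SOME Q. Q \<in> ?S \<and> orbit A Q = orbit A P) = orbit A P"
      by (rule someI[of "\<lambda>Q. Q \<in> ?S \<and> orbit A Q = orbit A P" P]) (use P in simp)
    then show ?thesis unfolding \<phi>_def using orbit_eq_iff_feedback P by blast
  qed
  \<comment> \<open>Charts of Q take values in the n by n matrices; L lies there, so there is room
    for a copy of E.\<close>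
  have "dim E \<le> DIM(real ^ 'n::_ ^ 'n::_)" using dim_E dim_subset_UNIV[of ?L] by linarith
  then have "\<exists>Q :: ((real ^ 'n::_ ^ 'n::_) set, real ^ 'n::_ ^ 'n::_) manifold.
      quotient_manifold (open_submanifold ?L ?S) (orbit A) Q"
    by (rule quotient_manifold_exists[rotated]) (rule orbit_eq_iff_feedback)
  moreover have inj: "inj_on \<phi> (orbit A ` ?S)"
  proof (rule inj_onI)
    fix X Y assume "X \<in> orbit A ` ?S" "Y \<in> orbit A ` ?S" "\<phi> X = \<phi> Y"
    then obtain P Q where PQ: "P \<in> ?S" "Q \<in> ?S" "X = orbit A P" "Y = orbit A Q" by blast
    with \<open>\<phi> X = \<phi> Y\<close> have "?f P = ?f Q" by (simp add: \<phi>)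
    then show "X = Y" using orbit_eq_iff_feedback PQ by blast
  qed
  have "diffeomorphism Q (submanifold E ?H) \<phi>"
    if "quotient_manifold (open_submanifold ?L ?S) (orbit A) Q"
    for Q :: "((real ^ 'n::_ ^ 'n::_) set, real ^ 'n::_ ^ 'n::_) manifold"
    by (rule quotient_diffeomorphism[OF that _ inj]) (rule \<phi>)
  ultimately show ?thesis using N \<phi> by blast
qed

end
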